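(* Let $k$ be an algebraically closed field of characteristic zero. For any integer $n\geq 2$ and any $E\in GL_n(k)$, the lazy cohomology group of the Hopf algebra $\mathcal{B}(E)$ is trivial.
   Context: $M^t$ denotes the transpose of a matrix $M$. The Hopf algebra $\mathcal{B}(E)$. For $E\in GL_n(k)$, $\mathcal{B}(E)$ is the $k$-algebra generated by $a_{ij}$, $1\leq i,j\leq n$, subject to the matrix relations $E^{-1}a^tEa=I_n=aE^{-1}a^tE$ where $a=(a_{ij})$. It is a Hopf algebra with $\Delta(a_{ij})=\sum_{l=1}^n a_{il}\otimes a_{lj}$, $\varepsilon(a_{ij})=\delta_{ij}$, $S(a)=E^{-1}a^tE$. Lazy cohomology (Bichon–Carnovale). Let $H$ be a Hopf algebra over $k$ (Sweedler notation $x_{(1)}\otimes x_{(2)}$). A lazy 2-cocycle is a convolution-invertible bilinear map $\sigma:H\times H\to k$ with $\sigma(1,x)=\sigma(x,1)=\varepsilon(x)$, satisfying the cocycle identity $\sigma(x_{(1)}y_{(1)},z)\,\sigma(x_{(2)},y_{(2)})=\sigma(x,y_{(1)}z_{(1)})\,\sigma(y_{(2)},z_{(2)})$ and the laziness condition $\sigma(x_{(1)},y_{(1)})\,x_{(2)}y_{(2)}=\sigma(x_{(2)},y_{(2)})\,x_{(1)}y_{(1)}$ for all $x,y,z\in H$. Lazy 2-cocycles form a group $Z^2_L(H)$ under convolution. For a convolution-invertible linear map $\mu:H\to k$ with $\mu(1)=1$ that is lazy, i.e. $\mu(x_{(1)})x_{(2)}=\mu(x_{(2)})x_{(1)}$ for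 all $x$, put $\partial\mu(x,y)=\mu(x_{(1)})\mu(y_{(1)})\mu^{-1}(x_{(2)}y_{(2)})$; the set of these $\partial\mu$ is a central subgroup $B^2_L(H)$ of $Z^2_L(H)$. The lazy cohomology group of $H$ is $H^2_L(H)=Z^2_L(H)/B^2_L(H)$. *)

theory Defs
  imports
    "HOL-Analysis.Finite_Cartesian_Product"
    "HOL-Library.Poly_Mapping"
    "HOL-Computational_Algebra.Polynomial"
    "HOL-Algebra.QuotRing"
    "HOL-Algebra.Module"
    "HOL-Algebra.Elementary_Groups"
    "HOL-Algebra.Algebraic_Closure_Type"
begin

section \<open>Algebras over a field\<close>

text \<open>
  The ground field is a type \<open>'k\<close>. A \<open>'k\<close>-algebra is a record of type \<open>('k, 'h) module\<close>
  (a ring with a scalar multiplication), as quotient algebras live on carrier sets.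
\<close>

definition ground_field :: "('k::field, 'k) module" where
  "ground_field = ring.extend ring_of_type_algebra (module.fields (*))"

definition opposite_algebra :: "('k, 'h, 'm) module_scheme \<Rightarrow> ('k, 'h, 'm) module_scheme" where
  "opposite_algebra A = A\<lparr>monoid.mult := \<lambda>x y. y \<otimes>\<^bsub>A\<^esub> x\<rparr>"

text \<open>
  The value, on a class of representatives, of the map induced by \<open>f\<close>; it is meaningful when
  \<open>f\<close> is constant on the class.
\<close>

definition induced :: "('a \<Rightarrow> 'b) \<Rightarrow> 'a set \<Rightarrow> 'b" where
  "induced f S = the_elem (f ` S)"


section \<open>Tensor products\<close>

text \<open>
  \<open>M \<otimes> N\<close> is the quotient of the vector space with basis \<open>carrier M \<times> carrier N\<close> by the
  span of the bilinearity relations.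
\<close>

definition scale_pm :: "'k \<Rightarrow> ('x \<Rightarrow>\<^sub>0 'k) \<Rightarrow> ('x \<Rightarrow>\<^sub>0 'k::field)" where
  "scale_pm c = Poly_Mapping.map ((*) c)"

definition tensor_relators ::
  "('k::field, 'h, 'm) module_scheme \<Rightarrow> ('k, 'g, 'n) module_scheme \<Rightarrow> ('h \<times> 'g \<Rightarrow>\<^sub>0 'k) set" where
  "tensor_relators M N =
     {Poly_Mapping.single (x \<oplus>\<^bsub>M\<^esub> x', y) 1 - Poly_Mapping.single (x, y) 1
        - Poly_Mapping.single (x', y) 1
      | x x' y. x \<in> carrier M \<and> x' \<in> carrier M \<and> y \<in> carrier N} \<union>
     {Poly_Mapping.single (x, y \<oplus>\<^bsub>N\<^esub> y') 1 - Poly_Mapping.single (x, y) 1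
        - Poly_Mapping.single (x, y') 1
      | x y y'. x \<in> carrier M \<and> y \<in> carrier N \<and> y' \<in> carrier N} \<union>
     {Poly_Mapping.single (c \<odot>\<^bsub>M\<^esub> x, y) 1 - Poly_Mapping.single (x, y) c
      | c x y. x \<in> carrier M \<and> y \<in> carrier N} \<union>
     {Poly_Mapping.single (x, c \<odot>\<^bsub>N\<^esub> y) 1 - Poly_Mapping.single (x, y) c
      | c x y. x \<in> carrier M \<and> y \<in> carrier N}"

definition tensor_class ::
  "('k::field, 'h, 'm) module_scheme \<Rightarrow> ('k, 'g, 'n) module_scheme
    \<Rightarrow> ('h \<times> 'g \<Rightarrow>\<^sub>0 'k) \<Rightarrow> ('h \<times> 'g \<Rightarrow>\<^sub>0 'k) set" where
  "tensor_class M N f = {g. g - f \<in> module.span scale_pm (tensor_relators M N)}"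

definition pure_tensor ::
  "('k::field, 'h, 'm) module_scheme \<Rightarrow> ('k, 'g, 'n) module_scheme
    \<Rightarrow> 'h \<Rightarrow> 'g \<Rightarrow> ('h \<times> 'g \<Rightarrow>\<^sub>0 'k) set" where
  "pure_tensor M N x y = tensor_class M N (Poly_Mapping.single (x, y) 1)"

definition formal_tensor_mult ::
  "('k::field, 'h, 'm) module_scheme \<Rightarrow> ('k, 'g, 'n) module_scheme
    \<Rightarrow> ('h \<times> 'g \<Rightarrow>\<^sub>0 'k) \<Rightarrow> ('h \<times> 'g \<Rightarrow>\<^sub>0 'k) \<Rightarrow> ('h \<times> 'g \<Rightarrow>\<^sub>0 'k)" where
  "formal_tensor_mult M N f g =
     (\<Sum>p\<in>Poly_Mapping.keys f. \<Sum>q\<in>Poly_Mapping.keys g.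
        Poly_Mapping.single (fst p \<otimes>\<^bsub>M\<^esub> fst q, snd p \<otimes>\<^bsub>N\<^esub> snd q)
          (Poly_Mapping.lookup f p * Poly_Mapping.lookup g q))"

definition tensor_product ::
  "('k::field, 'h, 'm) module_scheme \<Rightarrow> ('k, 'g, 'n) module_scheme
    \<Rightarrow> ('k, ('h \<times> 'g \<Rightarrow>\<^sub>0 'k) set) module" where
  "tensor_product M N =
     \<lparr>carrier = tensor_class M N ` {f. Poly_Mapping.keys f \<subseteq> carrier M \<times> carrier N},
      monoid.mult = (\<lambda>s t. induced (\<lambda>(f, g). tensor_class M N (formal_tensor_mult M N f g)) (s \<times> t)),
      one = pure_tensor M N \<one>\<^bsub>M\<^esub> \<one>\<^bsub>N\<^esub>,
      ring.zero = tensor_class M N 0,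
      add = (\<lambda>s t. induced (\<lambda>(f, g). tensor_class M N (f + g)) (s \<times> t)),
      module.smult = (\<lambda>c t. induced (\<lambda>f. tensor_class M N (scale_pm c f)) t)\<rparr>"

text \<open>
  The linear map \<open>M \<otimes> N \<rightarrow> V\<close> induced by a bilinear map \<open>b\<close> from \<open>M \<times> N\<close> to \<open>V\<close>.
\<close>

definition tensor_lift ::
  "('k::field, 'v, 'm) module_scheme \<Rightarrow> ('h \<Rightarrow> 'g \<Rightarrow> 'v) \<Rightarrow> ('h \<times> 'g \<Rightarrow>\<^sub>0 'k) set \<Rightarrow> 'v" where
  "tensor_lift V b =
     induced (\<lambda>f. \<Oplus>\<^bsub>V\<^esub>p\<in>Poly_Mapping.keys f. Poly_Mapping.lookup f p \<odot>\<^bsub>V\<^esub> b (fst p) (snd p))"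


section \<open>Lazy cohomology\<close>

record (overloaded) ('k::zero, 'h) hopf_algebra = "('k, 'h) module" +
  comult :: "'h \<Rightarrow> ('h \<times> 'h \<Rightarrow>\<^sub>0 'k) set"
  counit :: "'h \<Rightarrow> 'k"
  antipode :: "'h \<Rightarrow> 'h"

text \<open>
  \<open>sweedler V H x (\<lambda>x1 x2. b x1 x2)\<close> is the Sweedler sum \<open>b(x\<^sub>(\<^sub>1\<^sub>), x\<^sub>(\<^sub>2\<^sub>))\<close> for a bilinear
  map \<open>b\<close> with values in \<open>V\<close>.
\<close>

definition sweedler ::
  "('k::field, 'v, 'm) module_scheme \<Rightarrow> ('k, 'h, 'l) hopf_algebra_scheme
    \<Rightarrow> 'h \<Rightarrow> ('h \<Rightarrow> 'h \<Rightarrow> 'v) \<Rightarrow> 'v" where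
  "sweedler V H x b = tensor_lift V b (comult H x)"

abbreviation sweedler_k ::
  "('k::field, 'h, 'l) hopf_algebra_scheme \<Rightarrow> 'h \<Rightarrow> ('h \<Rightarrow> 'h \<Rightarrow> 'k) \<Rightarrow> 'k" where
  "sweedler_k \<equiv> sweedler ground_field"

text \<open>
  Functions on carrier sets are extensional, so that they are equal iff they agree on the carriers.
\<close>

definition linear_functionals :: "('k::field, 'h, 'l) hopf_algebra_scheme \<Rightarrow> ('h \<Rightarrow> 'k) set" where
  "linear_functionals H =
     {\<mu> \<in> extensional (carrier H).
        (\<forall>x\<in>carrier H. \<forall>y\<in>carrier H. \<mu> (x \<oplus>\<^bsub>H\<^esub> y) = \<mu> x + \<mu> y) \<and>
        (\<forall>c. \<forall>x\<in>carrier H. \<mu> (c \<odot>\<^bsub>H\<^esub> x) = c * \<mu> x)}"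

definition bilinear_forms :: "('k::field, 'h, 'l) hopf_algebra_scheme \<Rightarrow> ('h \<times> 'h \<Rightarrow> 'k) set" where
  "bilinear_forms H =
     {\<sigma> \<in> extensional (carrier H \<times> carrier H).
        (\<forall>x\<in>carrier H. \<forall>x'\<in>carrier H. \<forall>y\<in>carrier H.
           \<sigma> (x \<oplus>\<^bsub>H\<^esub> x', y) = \<sigma> (x, y) + \<sigma> (x', y)) \<and>
        (\<forall>x\<in>carrier H. \<forall>y\<in>carrier H. \<forall>y'\<in>carrier H.
           \<sigma> (x, y \<oplus>\<^bsub>H\<^esub> y') = \<sigma> (x, y) + \<sigma> (x, y')) \<and>
        (\<forall>c. \<forall>x\<in>carrier H. \<forall>y\<in>carrier H. \<sigma> (c \<odot>\<^bsub>H\<^esub> x, y) = c * \<sigma> (x, y)) \<and>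
        (\<forall>c. \<forall>x\<in>carrier H. \<forall>y\<in>carrier H. \<sigma> (x, c \<odot>\<^bsub>H\<^esub> y) = c * \<sigma> (x, y))}"

text \<open>The convolution monoids of linear maps \<open>H \<rightarrow> k\<close> and of bilinear maps \<open>H \<times> H \<rightarrow> k\<close>.\<close>

definition convolution :: "('k::field, 'h, 'l) hopf_algebra_scheme \<Rightarrow> ('h \<Rightarrow> 'k) monoid" where
  "convolution H =
     \<lparr>carrier = linear_functionals H,
      monoid.mult = (\<lambda>\<mu> \<nu>. \<lambda>x\<in>carrier H. sweedler_k H x (\<lambda>x1 x2. \<mu> x1 * \<nu> x2)),
      one = (\<lambda>x\<in>carrier H. counit H x)\<rparr>"

definition convolution2 :: "('k::field, 'h, 'l) hopf_algebra_scheme \<Rightarrow> ('h \<times> 'h \<Rightarrow> 'k) monoid" where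
  "convolution2 H =
     \<lparr>carrier = bilinear_forms H,
      monoid.mult = (\<lambda>\<sigma> \<tau>. \<lambda>(x, y)\<in>carrier H \<times> carrier H.
        sweedler_k H x (\<lambda>x1 x2. sweedler_k H y (\<lambda>y1 y2. \<sigma> (x1, y1) * \<tau> (x2, y2)))),
      one = (\<lambda>(x, y)\<in>carrier H \<times> carrier H. counit H x * counit H y)\<rparr>"

definition lazy_cocycles :: "('k::field, 'h, 'l) hopf_algebra_scheme \<Rightarrow> ('h \<times> 'h \<Rightarrow> 'k) set" where
  "lazy_cocycles H =
     {\<sigma> \<in> Units (convolution2 H).
        (\<forall>x\<in>carrier H. \<sigma> (\<one>\<^bsub>H\<^esub>, x) = counit H x \<and> \<sigma> (x, \<one>\<^bsub>H\<^esub>) = counit H x) \<and>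
        (\<forall>x\<in>carrier H. \<forall>y\<in>carrier H. \<forall>z\<in>carrier H.
           sweedler_k H x (\<lambda>x1 x2. sweedler_k H y (\<lambda>y1 y2.
             \<sigma> (x1 \<otimes>\<^bsub>H\<^esub> y1, z) * \<sigma> (x2, y2))) =
           sweedler_k H y (\<lambda>y1 y2. sweedler_k H z (\<lambda>z1 z2.
             \<sigma> (x, y1 \<otimes>\<^bsub>H\<^esub> z1) * \<sigma> (y2, z2)))) \<and>
        (\<forall>x\<in>carrier H. \<forall>y\<in>carrier H.
           sweedler H H x (\<lambda>x1 x2. sweedler H H y (\<lambda>y1 y2.
             \<sigma> (x1, y1) \<odot>\<^bsub>H\<^esub> (x2 \<otimes>\<^bsub>H\<^esub> y2))) =
           sweedler H H x (\<lambda>x1 x2. sweedler H H y (\<lambda>y1 y2.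
             \<sigma> (x2, y2) \<odot>\<^bsub>H\<^esub> (x1 \<otimes>\<^bsub>H\<^esub> y1))))}"

definition lazy_functionals :: "('k::field, 'h, 'l) hopf_algebra_scheme \<Rightarrow> ('h \<Rightarrow> 'k) set" where
  "lazy_functionals H =
     {\<mu> \<in> Units (convolution H).
        \<mu> \<one>\<^bsub>H\<^esub> = 1 \<and>
        (\<forall>x\<in>carrier H.
           sweedler H H x (\<lambda>x1 x2. \<mu> x1 \<odot>\<^bsub>H\<^esub> x2) = sweedler H H x (\<lambda>x1 x2. \<mu> x2 \<odot>\<^bsub>H\<^esub> x1))}"

definition coboundary :: "('k::field, 'h, 'l) hopf_algebra_scheme \<Rightarrow> ('h \<Rightarrow> 'k) \<Rightarrow> 'h \<times> 'h \<Rightarrow> 'k" where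
  "coboundary H \<mu> = (\<lambda>(x, y)\<in>carrier H \<times> carrier H.
     sweedler_k H x (\<lambda>x1 x2. sweedler_k H y (\<lambda>y1 y2.
       \<mu> x1 * \<mu> y1 * (inv\<^bsub>convolution H\<^esub> \<mu>) (x2 \<otimes>\<^bsub>H\<^esub> y2))))"

definition lazy_coboundaries :: "('k::field, 'h, 'l) hopf_algebra_scheme \<Rightarrow> ('h \<times> 'h \<Rightarrow> 'k) set" where
  "lazy_coboundaries H = coboundary H ` lazy_functionals H"

definition lazy_cocycle_group ::
  "('k::field, 'h, 'l) hopf_algebra_scheme \<Rightarrow> ('h \<times> 'h \<Rightarrow> 'k) monoid" where
  "lazy_cocycle_group H = (convolution2 H)\<lparr>carrier := lazy_cocycles H\<rparr>"

definition lazy_cohomology ::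
  "('k::field, 'h, 'l) hopf_algebra_scheme \<Rightarrow> ('h \<times> 'h \<Rightarrow> 'k) set monoid" where
  "lazy_cohomology H = lazy_cocycle_group H Mod lazy_coboundaries H"


section \<open>Free algebras\<close>

text \<open>
  The free monoid, written additively, so that \<open>'x free_word \<Rightarrow>\<^sub>0 'k\<close>, with the
  convolution product of finitely supported functions, is the free algebra on \<open>'x\<close>.
\<close>

datatype 'x free_word = Free_Word (letters: "'x list")

instantiation free_word :: (type) monoid_add
begin

definition zero_free_word :: "'a free_word" where
  "0 = Free_Word []"

definition plus_free_word :: "'a free_word \<Rightarrow> 'a free_word \<Rightarrow> 'a free_word" where
  "v + w = Free_Word (letters v @ letters w)"

instance
  by standard (simp_all add: zero_free_word_def plus_free_word_def)

end

type_synonym ('x, 'k) free_algebra = "'x free_word \<Rightarrow>\<^sub>0 'k"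

definition free_gen :: "'x \<Rightarrow> ('x, 'k::field) free_algebra" where
  "free_gen x = Poly_Mapping.single (Free_Word [x]) 1"

definition free_const :: "'k \<Rightarrow> ('x, 'k::field) free_algebra" where
  "free_const c = Poly_Mapping.single 0 c"

text \<open>The algebra map from the free algebra to \<open>A\<close> that extends \<open>\<phi>\<close>.\<close>

definition free_lift ::
  "('k::field, 'h, 'm) module_scheme \<Rightarrow> ('x \<Rightarrow> 'h) \<Rightarrow> ('x, 'k) free_algebra \<Rightarrow> 'h" where
  "free_lift A \<phi> f =
     (\<Oplus>\<^bsub>A\<^esub>w\<in>Poly_Mapping.keys f.
        Poly_Mapping.lookup f w \<odot>\<^bsub>A\<^esub> foldr (\<lambda>x y. \<phi> x \<otimes>\<^bsub>A\<^esub> y) (letters w) \<one>\<^bsub>A\<^esub>)"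


section \<open>The Hopf algebra of a nondegenerate bilinear form\<close>

definition gen_matrix :: "('n \<times> 'n, 'k::field) free_algebra ^ 'n ^ 'n" where
  "gen_matrix = (\<chi> i j. free_gen (i, j))"

definition const_matrix :: "'k::field ^ 'n ^ 'n \<Rightarrow> ('n \<times> 'n, 'k) free_algebra ^ 'n ^ 'n" where
  "const_matrix E = (\<chi> i j. free_const (E $ i $ j))"

definition antipode_matrix :: "'k::field ^ 'n ^ 'n \<Rightarrow> ('n \<times> 'n, 'k) free_algebra ^ 'n ^ 'n" where
  "antipode_matrix E = const_matrix (matrix_inv E) ** Finite_Cartesian_Product.transpose gen_matrix ** const_matrix E"

definition B_relators :: "'k::field ^ 'n ^ 'n \<Rightarrow> ('n \<times> 'n, 'k) free_algebra set" where
  "B_relators E =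
     {(antipode_matrix E ** gen_matrix - mat 1) $ i $ j | i j. True} \<union>
     {(gen_matrix ** antipode_matrix E - mat 1) $ i $ j | i j. True}"

definition B_ideal :: "'k::field ^ 'n ^ 'n \<Rightarrow> ('n \<times> 'n, 'k) free_algebra set" where
  "B_ideal E = Idl\<^bsub>ring_of_type_algebra\<^esub> (B_relators E)"

definition B_class ::
  "'k::field ^ 'n ^ 'n \<Rightarrow> ('n \<times> 'n, 'k) free_algebra \<Rightarrow> ('n \<times> 'n, 'k) free_algebra set" where
  "B_class E f = B_ideal E +>\<^bsub>ring_of_type_algebra\<^esub> f"

definition B_algebra :: "'k::field ^ 'n ^ 'n \<Rightarrow> ('k, ('n \<times> 'n, 'k) free_algebra set) module" where
  "B_algebra E =
     ring.extend (ring_of_type_algebra Quot B_ideal E)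
       (module.fields (\<lambda>c. induced (\<lambda>f. B_class E (free_const c * f))))"

text \<open>
  The three structure maps are induced by the algebra maps from the free algebra to
  \<open>B(E) \<otimes> B(E)\<close>, to the field, and to the opposite algebra of \<open>B(E)\<close> with the
  prescribed values on the generators.
\<close>

definition B_hopf ::
  "'k::field ^ 'n ^ 'n \<Rightarrow> ('k, ('n \<times> 'n, 'k) free_algebra set) hopf_algebra" where
  "B_hopf E =
     module.extend (B_algebra E)
       (hopf_algebra.fields
          (induced (free_lift (tensor_product (B_algebra E) (B_algebra E))
             (\<lambda>(i, j). \<Oplus>\<^bsub>tensor_product (B_algebra E) (B_algebra E)\<^esub>l\<in>UNIV.
                pure_tensor (B_algebra E) (B_algebra E)
                  (B_class E (free_gen (i, l))) (B_class E (free_gen (l, j))))))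
          (induced (free_lift ground_field (\<lambda>(i, j). if i = j then 1 else 0)))
          (induced (free_lift (opposite_algebra (B_algebra E))
             (\<lambda>(i, j). B_class E (antipode_matrix E $ i $ j)))))"

end

theory Submission
  imports Defs
begin

text \<open>
  A linear functional on \<open>H = B(E)\<close> is a family of matrices, its values on the products
  \<open>a\<^bsub>i\<^sub>1j\<^sub>1\<^esub> \<dots> a\<^bsub>i\<^sub>nj\<^sub>n\<^esub>\<close>, that intertwines the insertions of \<open>E\<close> and of \<open>D = E\<^sup>-\<^sup>1\<close>
  into the tensor powers of the fundamental comodule \<open>V\<close>; convolution is the matrix product. For a
  lazy cocycle \<open>\<sigma>\<close> the matrices \<open>\<sigma>\<^sub>m\<^sub>,\<^sub>n\<close> of \<open>\<sigma>\<close> on \<open>V\<^sup>\<otimes>\<^sup>m \<otimes> V\<^sup>\<otimes>\<^sup>n\<close> commute with all functionals. Since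
  functionals take arbitrary values on the generators, \<open>\<sigma>\<^sub>1\<^sub>,\<^sub>1\<close> fixes the invariants \<open>D\<close> and \<open>E\<close>
  up to scalars, which coincide by the cocycle identity. With \<open>c\<^sup>2\<close> equal to this scalar,
  \<open>\<nu>\<^sub>n\<^sub>+\<^sub>1 = c\<^sup>-\<^sup>1 (1 \<otimes> \<nu>\<^sub>n) \<sigma>\<^sub>1\<^sub>,\<^sub>n\<close> defines an invertible lazy functional with
  \<open>\<nu>\<^sub>m\<^sub>+\<^sub>n = (\<nu>\<^sub>m \<otimes> \<nu>\<^sub>n) \<sigma>\<^sub>m\<^sub>,\<^sub>n\<close>, that is, \<open>\<sigma> = \<partial>(\<nu>\<^sup>-\<^sup>1)\<close>.
\<close>

section \<open>Families of matrices indexed by words\<close>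

text \<open>A matrix that commutes with all functionals is a comodule endomorphism, so a lazy
  cocycle acts as a coherent system of automorphisms of the tensor powers of V. A cochain
  \<open>\<nu>\<close> trivializing it is determined by one scalar, its value on V, once the cocycle
  identity is used to peel off letters. This scalar is not free: D embeds the trivial comodule into
  V \<otimes> V, where \<open>\<nu>\<close> has to be 1, and since \<open>\<nu>\<close> carries the
  factor \<open>inverse c\<close> for each of the two letters, c must be a square root. Conversely,
  fixing D and E is what \<open>\<nu>\<close> needs in order to respect the relations of the
  algebra.

  The Schur argument needs enough functionals. Instead of the representation theory of the algebra,
  an explicit family built from the Kauffman bracket supplies them, for every loop value and with no
  choice of the bracket variable in the field.

  The other obstacle is that the algebra, its tensor square and all Sweedler sums are sets of
  representatives. Over a field a subspace is the common kernel of the functionals vanishing on it,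
  so each identity in these quotients is tested by scalar families.\<close>

definition words :: "nat \<Rightarrow> 'n list set" where
  "words n = {xs. length xs = n}"

lemma in_words [simp]: "xs \<in> words n \<longleftrightarrow> length xs = n"
  by (simp add: words_def)

lemma finite_words [simp]: "finite (words n :: 'n::finite list set)"
  using finite_lists_length_eq[of "UNIV :: 'n set" n] by (simp add: words_def)

lemma words_0 [simp]: "words 0 = {[]}"
  by (auto simp: words_def)

lemma sum_words_Suc:
  fixes f :: "'n::finite list \<Rightarrow> 'a::comm_monoid_add"
  shows "sum f (words (Suc n)) = (\<Sum>i\<in>UNIV. \<Sum>K\<in>words n. f (i # K))"
proof -
  have "sum f (words (Suc n)) = sum (\<lambda>(i, K). f (i # K)) (UNIV \<times> words n)"
    by (rule sum.reindex_bij_witness[of _ "\<lambda>(i, K). i # K" "\<lambda>L. (hd L, tl L)"])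
      (auto simp: length_Suc_conv)
  then show ?thesis
    by (simp add: sum.cartesian_product)
qed

lemma sum_words_add:
  fixes f :: "'n::finite list \<Rightarrow> 'a::comm_monoid_add"
  shows "sum f (words (m + n)) = (\<Sum>P\<in>words m. \<Sum>Q\<in>words n. f (P @ Q))"
  by (induction m arbitrary: f) (simp_all add: sum_words_Suc)

text \<open>The minimum and the truncated subtraction cover words shorter than m: the first part is
  then the whole word and the second is empty.\<close>

lemma sum_words_split:
  fixes f :: "'n::finite list \<Rightarrow> 'n list \<Rightarrow> 'a::comm_monoid_add"
  shows "(\<Sum>K\<in>words n. f (take m K) (drop m K)) =
    (\<Sum>P\<in>words (min m n). \<Sum>Q\<in>words (n - m). f P Q)"
proof -
  have "(\<Sum>K\<in>words (min m n + (n - m)). f (take m K) (drop m K)) =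
      (\<Sum>P\<in>words (min m n). \<Sum>Q\<in>words (n - m). f P Q)"
    unfolding sum_words_add by (intro sum.cong refl) (auto simp: min_def split: if_splits)
  moreover have "min m n + (n - m) = n"
    by simp
  ultimately show ?thesis
    by simp
qed

text \<open>
  \<open>F I J\<close> is the value of a functional at the product of the \<open>a\<^bsub>ij\<^esub>\<close> with \<open>(i, j)\<close> running through the
  zipped words \<open>I\<close>, \<open>J\<close>; it is only meaningful for words of equal length.
\<close>

type_synonym ('n, 'k) family = "'n list \<Rightarrow> 'n list \<Rightarrow> 'k"

definition conv :: "('n::finite, 'k::field) family \<Rightarrow> ('n, 'k) family \<Rightarrow> ('n, 'k) family" where
  "conv F Y = (\<lambda>I J. \<Sum>K\<in>words (length I). F I K * Y K J)"

text \<open>Families are total functions; the value 0 off the meaningful pairs makes a family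
  determined by its functional and makes \<open>delta\<close> a right unit.\<close>

definition balanced :: "('n, 'k::zero) family \<Rightarrow> bool" where
  "balanced F \<longleftrightarrow> (\<forall>I J. length I \<noteq> length J \<longrightarrow> F I J = 0)"

definition delta :: "('n, 'k::zero_neq_one) family" where
  "delta = (\<lambda>I J. if I = J then 1 else 0)"

text \<open>The operator F \<otimes> Y on all tensor powers at once, cut after m letters. On words
  with at most m letters it is F times the value of Y at the empty words.\<close>

definition tensor :: "nat \<Rightarrow> ('n, 'k::times) family \<Rightarrow> ('n, 'k) family \<Rightarrow> ('n, 'k) family" where
  "tensor m F Y = (\<lambda>I J. F (take m I) (take m J) * Y (drop m I) (drop m J))"

lemma balancedD: "balanced F \<Longrightarrow> length I \<noteq> length J \<Longrightarrow> F I J = 0"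
  by (simp add: balanced_def)

lemma balanced_delta [simp]: "balanced delta"
  by (auto simp: balanced_def delta_def)

lemma balanced_conv [simp]: "balanced Y \<Longrightarrow> balanced (conv F Y)"
  by (auto simp: balanced_def conv_def intro!: sum.neutral)

lemma balanced_tensor [simp]:
  fixes F Y :: "('n, 'k::mult_zero) family"
  assumes "balanced F" "balanced Y"
  shows "balanced (tensor m F Y)"
  unfolding balanced_def
proof (intro allI impI)
  fix I J :: "'n list"
  assume "length I \<noteq> length J"
  then have "length (take m I) \<noteq> length (take m J) \<or> length (drop m I) \<noteq> length (drop m J)"
    by auto
  then show "tensor m F Y I J = 0"
    using assms unfolding balanced_def tensor_def by (metis mult_zero_left mult_zero_right)
qed

lemma conv_assoc: "conv (conv F Y) Z = conv F (conv Y Z)"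
proof (intro ext)
  fix I J
  have "conv (conv F Y) Z I J =
      (\<Sum>L\<in>words (length I). \<Sum>K\<in>words (length I). F I K * (Y K L * Z L J))"
    by (simp add: conv_def sum_distrib_right mult.assoc)
  also have "\<dots> = conv F (conv Y Z) I J"
    by (subst sum.swap) (simp add: conv_def sum_distrib_left)
  finally show "conv (conv F Y) Z I J = conv F (conv Y Z) I J" .
qed

lemma conv_delta_left [simp]: "conv delta F = F"
  by (intro ext) (simp add: conv_def delta_def if_distrib[of "\<lambda>x. x * _"] cong: if_cong)

lemma conv_delta_right [simp]: "balanced F \<Longrightarrow> conv F delta = F"
  by (intro ext) (auto simp: conv_def delta_def balanced_def if_distrib[of "\<lambda>x. _ * x"] cong: if_cong)

lemma tensor_delta [simp]: "tensor m delta delta = (delta :: ('n, 'k::semiring_1) family)"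
proof (intro ext)
  fix I J :: "'n list"
  have "I = J \<longleftrightarrow> take m I = take m J \<and> drop m I = drop m J"
    by (metis append_take_drop_id)
  then show "tensor m delta delta I J = (delta I J :: 'k)"
    by (auto simp: tensor_def delta_def)
qed

lemma tensor_assoc:
  fixes F Y Z :: "('n, 'k::semigroup_mult) family"
  shows "tensor m F (tensor n Y Z) = tensor (m + n) (tensor m F Y) Z"
proof -
  have "drop m (take (m + n) I) = take n (drop m I)" for I :: "'n list"
    by (metis add.commute take_drop)
  then show ?thesis
    by (intro ext) (simp add: tensor_def mult.assoc add.commute min_def)
qed

text \<open>The intermediate word splits at m into two independent halves, so the sum factors. Most
  computations with \<open>tensor\<close> rest on this interchange law.\<close>

lemma conv_tensor: "conv (tensor m F Y) (tensor m F' Y') = tensor m (conv F F') (conv Y Y')"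
proof (intro ext)
  fix I J
  have "conv (tensor m F Y) (tensor m F' Y') I J =
    (\<Sum>K\<in>words (length I). F (take m I) (take m K) * F' (take m K) (take m J) *
      (Y (drop m I) (drop m K) * Y' (drop m K) (drop m J)))"
    by (simp add: conv_def tensor_def ac_simps)
  also have "\<dots> = (\<Sum>P\<in>words (min m (length I)). \<Sum>Q\<in>words (length I - m).
       F (take m I) P * F' P (take m J) * (Y (drop m I) Q * Y' Q (drop m J)))"
    by (rule sum_words_split)
  also have "\<dots> = tensor m (conv F F') (conv Y Y') I J"
    by (simp add: tensor_def conv_def sum_product min.commute)
  finally show "conv (tensor m F Y) (tensor m F' Y') I J = tensor m (conv F F') (conv Y Y') I J" .
qed

lemma conv_tensor_delta_left:
  "conv (tensor m delta Y) Z I J =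
    (\<Sum>K\<in>words (length (drop m I)). Y (drop m I) K * Z (take m I @ K) J)"
proof -
  have "conv (tensor m delta Y) Z I J =
    (\<Sum>K\<in>words (length I). (if take m K = take m I then 1 else 0) *
      (Y (drop m I) (drop m K) * Z (take m K @ drop m K) J))"
    by (simp add: conv_def tensor_def delta_def mult.assoc eq_commute)
  also have "\<dots> = (\<Sum>P\<in>words (min m (length I)). \<Sum>Q\<in>words (length I - m).
      (if P = take m I then 1 else 0) * (Y (drop m I) Q * Z (P @ Q) J))"
    by (rule sum_words_split)
  also have "\<dots> = (\<Sum>P\<in>words (min m (length I)). if P = take m I then
      (\<Sum>Q\<in>words (length I - m). Y (drop m I) Q * Z (P @ Q) J) else 0)"
    by (intro sum.cong refl) auto
  finally show ?thesis
    by (simp add: min.commute)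
qed

lemma conv_tensor_left:
  "conv (tensor m Y delta) Z I J =
    (\<Sum>K\<in>words (length (take m I)). Y (take m I) K * Z (K @ drop m I) J)"
proof -
  have "conv (tensor m Y delta) Z I J =
    (\<Sum>K\<in>words (length I). (if drop m K = drop m I then 1 else 0) *
      (Y (take m I) (take m K) * Z (take m K @ drop m K) J))"
    by (simp add: conv_def tensor_def delta_def ac_simps eq_commute)
  also have "\<dots> = (\<Sum>P\<in>words (min m (length I)). \<Sum>Q\<in>words (length I - m).
      (if Q = drop m I then 1 else 0) * (Y (take m I) P * Z (P @ Q) J))"
    by (rule sum_words_split)
  also have "\<dots> = (\<Sum>P\<in>words (min m (length I)). \<Sum>Q\<in>words (length I - m).
      if Q = drop m I then (Y (take m I) P * Z (P @ Q) J) else 0)"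
    by (intro sum.cong refl) auto
  finally show ?thesis
    by (simp add: min.commute)
qed

text \<open>The summation word has the length of I while its frozen prefix comes from J; equal
  lengths make the two fit.\<close>

lemma conv_tensor_delta_right:
  assumes "length I = length J"
  shows "conv Z (tensor m delta Y) I J =
    (\<Sum>K\<in>words (length (drop m J)). Z I (take m J @ K) * Y K (drop m J))"
proof -
  have "conv Z (tensor m delta Y) I J =
    (\<Sum>K\<in>words (length I). (if take m K = take m J then 1 else 0) *
      (Z I (take m K @ drop m K) * Y (drop m K) (drop m J)))"
    by (simp add: conv_def tensor_def delta_def ac_simps eq_commute)
  also have "\<dots> = (\<Sum>P\<in>words (min m (length I)). \<Sum>Q\<in>words (length I - m).
      (if P = take m J then 1 else 0) * (Z I (P @ Q) * Y Q (drop m J)))"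
    by (rule sum_words_split)
  also have "\<dots> = (\<Sum>P\<in>words (min m (length I)). if P = take m J then
      (\<Sum>Q\<in>words (length I - m). Z I (P @ Q) * Y Q (drop m J)) else 0)"
    by (intro sum.cong refl) auto
  finally show ?thesis
    using assms by (simp add: min.commute)
qed

lemma conv_tensor_right:
  assumes "length I = length J"
  shows "conv Z (tensor m Y delta) I J =
    (\<Sum>K\<in>words (length (take m J)). Z I (K @ drop m J) * Y K (take m J))"
proof -
  have "conv Z (tensor m Y delta) I J =
    (\<Sum>K\<in>words (length I). (if drop m K = drop m J then 1 else 0) *
      (Z I (take m K @ drop m K) * Y (take m K) (take m J)))"
    by (simp add: conv_def tensor_def delta_def ac_simps eq_commute)
  also have "\<dots> = (\<Sum>P\<in>words (min m (length I)). \<Sum>Q\<in>words (length I - m).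
      (if Q = drop m J then 1 else 0) * (Z I (P @ Q) * Y P (take m J)))"
    by (rule sum_words_split)
  also have "\<dots> = (\<Sum>P\<in>words (min m (length I)). \<Sum>Q\<in>words (length I - m).
      if Q = drop m J then (Z I (P @ Q) * Y P (take m J)) else 0)"
    by (intro sum.cong refl) auto
  finally show ?thesis
    using assms by (simp add: min.commute)
qed

lemma tensor_factor:
  assumes "balanced F" "balanced Y"
  shows "tensor m F Y = conv (tensor m F delta) (tensor m delta Y)"
  using assms by (simp add: conv_tensor)

section \<open>Families compatible with a bilinear form\<close>

locale bilinear_form =
  fixes E D :: "'n::finite \<Rightarrow> 'n \<Rightarrow> 'k::field"
  assumes ED: "(\<Sum>j\<in>UNIV. E i j * D j k) = (if i = k then 1 else 0)"
    and DE: "(\<Sum>j\<in>UNIV. D i j * E j k) = (if i = k then 1 else 0)"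
begin

text \<open>The relations of the algebra in the forms a^t E a = E and a D a^t = D, multiplied on
  both sides by arbitrary monomials. A pair of adjacent letters is contracted with E in the rows or
  with D in the columns.\<close>

definition compatible :: "('n, 'k) family \<Rightarrow> bool" where
  "compatible F \<longleftrightarrow> balanced F \<and>
    (\<forall>I J I' J' k j. length I = length J \<longrightarrow> length I' = length J' \<longrightarrow>
      (\<Sum>l\<in>UNIV. \<Sum>m\<in>UNIV. E l m * F (I @ l # m # I') (J @ k # j # J')) = E k j * F (I @ I') (J @ J') \<and>
      (\<Sum>l\<in>UNIV. \<Sum>m\<in>UNIV. D l m * F (I @ k # j # I') (J @ l # m # J')) = D k j * F (I @ I') (J @ J'))"

lemma compatible_balanced: "compatible F \<Longrightarrow> balanced F"
  by (simp add: compatible_def)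

lemma compatible_E:
  "compatible F \<Longrightarrow> length I = length J \<Longrightarrow> length I' = length J' \<Longrightarrow>
    (\<Sum>l\<in>UNIV. \<Sum>m\<in>UNIV. E l m * F (I @ l # m # I') (J @ k # j # J')) = E k j * F (I @ I') (J @ J')"
  by (simp add: compatible_def)

lemma compatible_D:
  "compatible F \<Longrightarrow> length I = length J \<Longrightarrow> length I' = length J' \<Longrightarrow>
    (\<Sum>l\<in>UNIV. \<Sum>m\<in>UNIV. D l m * F (I @ k # j # I') (J @ l # m # J')) = D k j * F (I @ I') (J @ J')"
  by (simp add: compatible_def)

text \<open>Freezing a prefix amounts to multiplying the argument of the functional by a fixed
  monomial on the left, which preserves the relations.\<close>

lemma compatible_prefix:
  assumes "compatible F" "length P = length Q"
  shows "compatible (\<lambda>I J. F (P @ I) (Q @ J))"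
  unfolding compatible_def
proof (intro conjI allI impI)
  show "balanced (\<lambda>I J. F (P @ I) (Q @ J))"
    using assms by (simp add: compatible_def balanced_def)
next
  fix I J I' J' :: "'n list" and k j
  assume "length I = length J" "length I' = length J'"
  then show "(\<Sum>l\<in>UNIV. \<Sum>m\<in>UNIV. E l m * F (P @ I @ l # m # I') (Q @ J @ k # j # J')) =
      E k j * F (P @ I @ I') (Q @ J @ J')"
    "(\<Sum>l\<in>UNIV. \<Sum>m\<in>UNIV. D l m * F (P @ I @ k # j # I') (Q @ J @ l # m # J')) =
      D k j * F (P @ I @ I') (Q @ J @ J')"
    using compatible_E[OF assms(1), of "P @ I" "Q @ J" I' J' k j]
      compatible_D[OF assms(1), of "P @ I" "Q @ J" I' J' k j] assms(2) by simp_all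
qed

lemma compatible_suffix:
  assumes "compatible F" "length P = length Q"
  shows "compatible (\<lambda>I J. F (I @ P) (J @ Q))"
  unfolding compatible_def
proof (intro conjI allI impI)
  show "balanced (\<lambda>I J. F (I @ P) (J @ Q))"
    using assms by (simp add: compatible_def balanced_def)
next
  fix I J I' J' :: "'n list" and k j
  assume "length I = length J" "length I' = length J'"
  then show "(\<Sum>l\<in>UNIV. \<Sum>m\<in>UNIV. E l m * F ((I @ l # m # I') @ P) ((J @ k # j # J') @ Q)) =
      E k j * F ((I @ I') @ P) ((J @ J') @ Q)"
    "(\<Sum>l\<in>UNIV. \<Sum>m\<in>UNIV. D l m * F ((I @ k # j # I') @ P) ((J @ l # m # J') @ Q)) =
      D k j * F ((I @ I') @ P) ((J @ J') @ Q)"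
    using compatible_E[OF assms(1), of I J "I' @ P" "J' @ Q" k j]
      compatible_D[OF assms(1), of I J "I' @ P" "J' @ Q" k j] assms(2) by simp_all
qed

lemma compatibleI_pair:
  assumes "balanced F"
    and "\<And>I J I' J' k j. length I = length J \<Longrightarrow> length I' = length J' \<Longrightarrow>
      (\<Sum>l\<in>UNIV. \<Sum>m\<in>UNIV. E l m * F (I @ l # m # I') (J @ k # j # J')) = E k j * F (I @ I') (J @ J')"
    and "\<And>I J I' J' k j. length I = length J \<Longrightarrow> length I' = length J' \<Longrightarrow>
      (\<Sum>l\<in>UNIV. \<Sum>m\<in>UNIV. D l m * F (I @ k # j # I') (J @ l # m # J')) = D k j * F (I @ I') (J @ J')"
  shows "compatible F"
  using assms by (simp add: compatible_def)

lemma compatible_delta: "compatible delta"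
proof (rule compatibleI_pair)
  fix I J I' J' :: "'n list" and k j
  assume len: "length I = length J" "length I' = length J'"
  have "E l m * delta (I @ l # m # I') (J @ k # j # J') =
      (if m = j then if l = k then E k j * delta (I @ I') (J @ J') else 0 else 0)" for l m
    using len by (auto simp: delta_def)
  then show "(\<Sum>l\<in>UNIV. \<Sum>m\<in>UNIV. E l m * delta (I @ l # m # I') (J @ k # j # J')) =
      E k j * delta (I @ I') (J @ J')"
    by simp
  have "D l m * delta (I @ k # j # I') (J @ l # m # J') =
      (if m = j then if l = k then D k j * delta (I @ I') (J @ J') else 0 else 0)" for l m
    using len by (auto simp: delta_def)
  then show "(\<Sum>l\<in>UNIV. \<Sum>m\<in>UNIV. D l m * delta (I @ k # j # I') (J @ l # m # J')) =
      D k j * delta (I @ I') (J @ J')"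
    by simp
qed simp

text \<open>
  Every matrix extends to a compatible family: the linear functionals on \<open>\<B>(E)\<close> separate the
  generators. Up to a scalar, the operators \<open>A P + A\<^sup>-\<^sup>1 Q\<close> below are the entries of the Kauffman bracket
  braiding of the fundamental comodule with itself, which represents \<open>\<B>(E)\<close> whenever
  \<open>A\<^sup>2 + A\<^sup>-\<^sup>2 + d = 0\<close> for \<open>d\<close> the loop value. Working over the ring generated by a universal such
  \<open>A\<close> and applying the linear form with \<open>A \<mapsto> 1\<close>, \<open>A\<^sup>-\<^sup>1 \<mapsto> 0\<close> leaves the matrix units only.
  The values of this form on powers of \<open>A\<close> are the numbers \<open>bracket\<close>.
\<close>

definition loop_value :: 'k where
  "loop_value = (\<Sum>i\<in>UNIV. \<Sum>j\<in>UNIV. E i j * D i j)"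

text \<open>Chebyshev polynomials of the second kind in the normalization S(n+2) = x S(n+1) - S(n),
  at x = - \<open>loop_value\<close>, with the index shifted so that the sequence starts with
  0.\<close>

fun chebyshev :: "nat \<Rightarrow> 'k" where
  "chebyshev 0 = 0"
| "chebyshev (Suc 0) = 1"
| "chebyshev (Suc (Suc n)) = - loop_value * chebyshev (Suc n) - chebyshev n"

text \<open>The recurrence reads the same in both directions and the value at 0 is 0, so the
  solution continues to negative indices as an odd function.\<close>

definition chebyshev_int :: "int \<Rightarrow> 'k" where
  "chebyshev_int z = (if z \<ge> 0 then chebyshev (nat z) else - chebyshev (nat (- z)))"

text \<open>The relation for A links only exponents of the same parity. Halving gives both parities
  the same sequence, with the exponent 1 sent to 1 and the exponent -1 sent to 0.\<close>

definition bracket :: "int \<Rightarrow> 'k" where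
  "bracket z = chebyshev_int ((z + 1) div 2)"

lemma chebyshev_int_rec: "chebyshev_int (z + 1) + loop_value * chebyshev_int z + chebyshev_int (z - 1) = 0"
proof (cases z rule: int_cases3)
  case zero
  then show ?thesis
    by (simp add: chebyshev_int_def)
next
  case (pos m)
  then obtain n where "m = Suc n"
    using gr0_conv_Suc by auto
  then have "z + 1 = int (Suc (Suc n))" "z = int (Suc n)" "z - 1 = int n"
    using pos by simp_all
  then show ?thesis
    unfolding chebyshev_int_def by (simp only: nat_int of_nat_0_le_iff if_True) simp
next
  case (neg m)
  then obtain n where "m = Suc n"
    using gr0_conv_Suc by auto
  then have "z - 1 = - int (Suc (Suc n))" "z = - int (Suc n)" "z + 1 = - int n"
    using neg by simp_all
  moreover have "chebyshev_int (- int i) = - chebyshev i" for i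
    by (cases i) (simp_all add: chebyshev_int_def del: of_nat_Suc)
  ultimately show ?thesis
    by (simp only:) simp
qed

lemma bracket_rec: "bracket (z + 2) + loop_value * bracket z + bracket (z - 2) = 0"
proof -
  have "(z + 2 + 1) div 2 = (z + 1) div 2 + 1" "(z - 2 + 1) div 2 = (z + 1) div 2 - 1"
    by presburger+
  then show ?thesis
    using chebyshev_int_rec[of "(z + 1) div 2"] by (simp add: bracket_def)
qed

text \<open>The entry (p, q) of the product of the operators along the word, after applying the
  linear form. The exponent collected so far is z: the choice of P in a letter adds 1 to it, the
  choice of Q subtracts 1.\<close>

fun bracket_family :: "int \<Rightarrow> ('n \<times> 'n) list \<Rightarrow> 'n \<Rightarrow> 'n \<Rightarrow> 'k" where
  "bracket_family z [] p q = (if p = q then bracket z else 0)"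
| "bracket_family z ((i, j) # w) p q =
    (if p = j then bracket_family (z + 1) w i q else 0)
    + D p i * (\<Sum>r\<in>UNIV. E j r * bracket_family (z - 1) w r q)"

lemma sum_if_delta:
  fixes f :: "'n \<Rightarrow> 'k"
  shows "(\<Sum>j\<in>UNIV. (if j = k then 1 else 0) * f j) = f k" "(\<Sum>j\<in>UNIV. (if k = j then 1 else 0) * f j) = f k"
    "(\<Sum>j\<in>UNIV. f j * (if j = k then 1 else 0)) = f k" "(\<Sum>j\<in>UNIV. f j * (if k = j then 1 else 0)) = f k"
    "(\<Sum>j\<in>UNIV. (if j = k then f j else 0)) = f k" "(\<Sum>j\<in>UNIV. (if k = j then f j else 0)) = f k"
    "(\<Sum>j\<in>UNIV. g j * (if j = k then f j else 0)) = g k * f k" "(\<Sum>j\<in>UNIV. g j * (if k = j then f j else 0)) = g k * f k"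
  by (simp_all add: if_distrib[of "\<lambda>x. _ * x"] if_distrib[of "\<lambda>x. x * _"] cong: if_cong)

lemma ED_sum: "(\<Sum>j\<in>UNIV. E i j * (\<Sum>k\<in>UNIV. D j k * f k)) = f i"
proof -
  have "(\<Sum>j\<in>UNIV. E i j * (\<Sum>k\<in>UNIV. D j k * f k)) = (\<Sum>j\<in>UNIV. \<Sum>k\<in>UNIV. E i j * D j k * f k)"
    by (simp add: sum_distrib_left mult.assoc)
  also have "\<dots> = (\<Sum>k\<in>UNIV. (\<Sum>j\<in>UNIV. E i j * D j k) * f k)"
    by (subst sum.swap) (simp add: sum_distrib_right)
  finally show ?thesis by (simp only: ED sum_if_delta)
qed

lemma DE_sum: "(\<Sum>j\<in>UNIV. D i j * (\<Sum>k\<in>UNIV. E j k * f k)) = f i"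
proof -
  have "(\<Sum>j\<in>UNIV. D i j * (\<Sum>k\<in>UNIV. E j k * f k)) = (\<Sum>j\<in>UNIV. \<Sum>k\<in>UNIV. D i j * E j k * f k)"
    by (simp add: sum_distrib_left mult.assoc)
  also have "\<dots> = (\<Sum>k\<in>UNIV. (\<Sum>j\<in>UNIV. D i j * E j k) * f k)"
    by (subst sum.swap) (simp add: sum_distrib_right)
  finally show ?thesis by (simp only: DE sum_if_delta)
qed

lemma sum_linear_step:
  fixes f :: "'n \<Rightarrow> 'n \<Rightarrow> 'k"
  shows "(\<Sum>l\<in>UNIV. \<Sum>m\<in>UNIV. f l m * (c * g l m + d * (\<Sum>r\<in>UNIV. h r * k r l m))) =
    c * (\<Sum>l\<in>UNIV. \<Sum>m\<in>UNIV. f l m * g l m)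
    + d * (\<Sum>r\<in>UNIV. h r * (\<Sum>l\<in>UNIV. \<Sum>m\<in>UNIV. f l m * k r l m))"
proof -
  have "(\<Sum>l\<in>UNIV. \<Sum>m\<in>UNIV. \<Sum>r\<in>UNIV. h r * (f l m * k r l m)) =
      (\<Sum>l\<in>UNIV. \<Sum>r\<in>UNIV. \<Sum>m\<in>UNIV. h r * (f l m * k r l m))"
    by (intro sum.cong refl sum.swap)
  also have "\<dots> = (\<Sum>r\<in>UNIV. h r * (\<Sum>l\<in>UNIV. \<Sum>m\<in>UNIV. f l m * k r l m))"
    by (subst sum.swap) (simp only: sum_distrib_left)
  finally have *: "(\<Sum>l\<in>UNIV. \<Sum>m\<in>UNIV. \<Sum>r\<in>UNIV. h r * (f l m * k r l m)) = \<dots>" .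
  have "f l m * (c * g l m + d * (\<Sum>r\<in>UNIV. h r * k r l m)) =
      c * (f l m * g l m) + d * (\<Sum>r\<in>UNIV. h r * (f l m * k r l m))" for l m
    by (simp add: distrib_left sum_distrib_left mult.left_commute)
  then show ?thesis
    by (simp only: sum.distrib sum_distrib_left[symmetric] *)
qed

text \<open>The case distinction becomes a factor 0 or 1, so that sums over row and column indices
  can be pulled out by linearity.\<close>

lemma bracket_family_Cons:
  "bracket_family z ((i, j) # w) p q = (if p = j then 1 else 0) * bracket_family (z + 1) w i q
    + D p i * (\<Sum>r\<in>UNIV. E j r * bracket_family (z - 1) w r q)"
  by simp

declare bracket_family.simps(2) [simp del]

text \<open>Every entry is a linear combination of values of \<open>bracket\<close> at shifts of z,
  with coefficients that do not involve z; hence the relation of the scalars passes to all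
  entries.\<close>

lemma bracket_family_rec:
  "bracket_family (z + 2) w p q + loop_value * bracket_family z w p q + bracket_family (z - 2) w p q = 0"
proof (induction w arbitrary: z p)
  case Nil
  then show ?case
    using bracket_rec by simp
next
  case (Cons a w)
  obtain i j where a: "a = (i, j)"
    by fastforce
  have eq: "z + 2 + 1 = z + 1 + 2" "z + 2 - 1 = z - 1 + 2" "z - 2 + 1 = z + 1 - 2" "z - 2 - 1 = z - 1 - 2"
    by simp_all
  define b where "b = (\<lambda>z p. bracket_family z w p q)"
  have b: "bracket_family z w p q = b z p" for z p
    by (simp add: b_def)
  have "(\<Sum>r\<in>UNIV. E j r * b (z - 1 + 2) r) + loop_value * (\<Sum>r\<in>UNIV. E j r * b (z - 1) r)
      + (\<Sum>r\<in>UNIV. E j r * b (z - 1 - 2) r) =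
      (\<Sum>r\<in>UNIV. E j r * (b (z - 1 + 2) r + loop_value * b (z - 1) r + b (z - 1 - 2) r))"
    by (simp add: distrib_left sum.distrib sum_distrib_left mult.left_commute)
  moreover have IH: "b (z + 2) p + loop_value * b z p + b (z - 2) p = 0" for z p
    using Cons.IH unfolding b_def .
  ultimately have *: "(\<Sum>r\<in>UNIV. E j r * b (z - 1 + 2) r) + loop_value * (\<Sum>r\<in>UNIV. E j r * b (z - 1) r)
      + (\<Sum>r\<in>UNIV. E j r * b (z - 1 - 2) r) = 0"
    by (simp only: IH) simp
  have lin: "x * y1 + d * s1 + t * (x * y2 + d * s2) + (x * y3 + d * s3) =
      x * (y1 + t * y2 + y3) + d * (s1 + t * s2 + s3)" for x y1 y2 y3 d s1 s2 s3 t :: 'k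
    by (simp add: algebra_simps)
  then show ?case
    unfolding a bracket_family_Cons eq b by (simp only: lin IH * ) simp
qed

text \<open>Two adjacent letters give four terms. The one with Q in the first and P in the second is
  the right-hand side, as D cancels E. The other three share a factor and carry the exponents z + 2,
  z and z - 2, the middle one with a closed loop, so they cancel by
  \<open>bracket_family_rec\<close>.\<close>

lemma bracket_family_E:
  "(\<Sum>l\<in>UNIV. \<Sum>m\<in>UNIV. E l m * bracket_family z (u @ (l, k) # (m, j) # w) p q) =
    E k j * bracket_family z (u @ w) p q"
proof (induction u arbitrary: z p)
  case Nil
  define a where "a = (\<lambda>z s. bracket_family z w s q)"
  define c where "c = (\<lambda>z. \<Sum>s\<in>UNIV. E j s * a z s)"
  define d where "d = (if p = k then 1 else 0 :: 'k)"
  have 1: "bracket_family z ((m, j) # w) s q = (if s = j then 1 else 0) * a (z + 1) m + D s m * c (z - 1)" for z s m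
    by (simp only: bracket_family_Cons a_def c_def)
  have "E l m * bracket_family z ((l, k) # (m, j) # w) p q =
      (if l = j then 1 else 0) * (d * (E l m * a (z + 2) m)) + d * c z * (E l m * D l m)
      + E k j * (D p l * (E l m * a z m)) + c (z - 2) * (D p l * (E l m * (if k = m then 1 else 0)))" for l m
  proof -
    have h: "(\<Sum>r\<in>UNIV. E k r * bracket_family (z - 1) ((m, j) # w) r q) =
        E k j * a z m + (\<Sum>r\<in>UNIV. E k r * D r m) * c (z - 2)"
      unfolding 1 by (simp only: distrib_left sum.distrib mult.assoc[symmetric] sum_distrib_right[symmetric] sum_if_delta) simp
    show ?thesis
      unfolding bracket_family_Cons[of z l k "(m, j) # w"] h ED by (simp add: 1 d_def algebra_simps)
  qed
  then have "(\<Sum>l\<in>UNIV. \<Sum>m\<in>UNIV. E l m * bracket_family z ((l, k) # (m, j) # w) p q) =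
      d * c (z + 2) + d * c z * loop_value + E k j * a z p + c (z - 2) * d"
    by (simp only: sum.distrib sum_distrib_left[symmetric] DE_sum DE sum_if_delta)
      (simp add: c_def loop_value_def d_def)
  also have "\<dots> = d * (c (z + 2) + loop_value * c z + c (z - 2)) + E k j * a z p"
    by (simp add: algebra_simps)
  also have "c (z + 2) + loop_value * c z + c (z - 2) =
      (\<Sum>s\<in>UNIV. E j s * (a (z + 2) s + loop_value * a z s + a (z - 2) s))"
    by (simp add: c_def distrib_left sum.distrib sum_distrib_left mult.left_commute)
  also have "\<dots> = 0"
    unfolding a_def bracket_family_rec by simp
  finally show ?case by (simp add: a_def)
next
  case (Cons b u)
  obtain i i' where b: "b = (i, i')"
    by fastforce
  show ?case
    unfolding b append_Cons bracket_family_Cons sum_linear_step Cons.IH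
    by (simp add: distrib_left sum_distrib_left mult.left_commute)
qed

text \<open>The mirror image of the previous computation: now P in the first letter and Q in the
  second give the right-hand side, and the other three terms cancel.\<close>

lemma bracket_family_D:
  "(\<Sum>l\<in>UNIV. \<Sum>m\<in>UNIV. D l m * bracket_family z (u @ (k, l) # (j, m) # w) p q) =
    D k j * bracket_family z (u @ w) p q"
proof (induction u arbitrary: z p)
  case Nil
  define a where "a = (\<lambda>z s. bracket_family z w s q)"
  define c where "c = (\<lambda>m z. \<Sum>s\<in>UNIV. E m s * a z s)"
  have 1: "bracket_family z ((j, m) # w) s q = (if s = m then 1 else 0) * a (z + 1) j + D s j * c m (z - 1)" for z s m
    by (simp only: bracket_family_Cons a_def c_def)
  have "D l m * bracket_family z ((k, l) # (j, m) # w) p q =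
      (if p = l then 1 else 0) * ((if k = m then 1 else 0) * (D l m * a (z + 2) j))
      + (if p = l then 1 else 0) * (D k j * (D l m * c m z))
      + D p k * a z j * (E l m * D l m) + (if l = j then 1 else 0) * (D p k * (D l m * c m (z - 2)))" for l m
  proof -
    have h: "(\<Sum>r\<in>UNIV. E l r * bracket_family (z - 1) ((j, m) # w) r q) =
        E l m * a z j + (\<Sum>r\<in>UNIV. E l r * D r j) * c m (z - 2)"
      unfolding 1 by (simp only: distrib_left sum.distrib mult.assoc[symmetric] sum_distrib_right[symmetric] sum_if_delta) simp
    show ?thesis
      unfolding bracket_family_Cons[of z k l "(j, m) # w"] h ED by (simp add: 1 algebra_simps)
  qed
  then have "(\<Sum>l\<in>UNIV. \<Sum>m\<in>UNIV. D l m * bracket_family z ((k, l) # (j, m) # w) p q) =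
      D p k * a (z + 2) j + D k j * a z p + D p k * a z j * loop_value + D p k * a (z - 2) j"
    by (simp only: sum.distrib sum_distrib_left[symmetric] sum_if_delta c_def DE_sum loop_value_def)
  also have "\<dots> = D p k * (a (z + 2) j + loop_value * a z j + a (z - 2) j) + D k j * a z p"
    by (simp add: algebra_simps)
  also have "a (z + 2) j + loop_value * a z j + a (z - 2) j = 0"
    unfolding a_def bracket_family_rec by simp
  finally show ?case by (simp add: a_def)
next
  case (Cons b u)
  obtain i i' where b: "b = (i, i')"
    by fastforce
  show ?case
    unfolding b append_Cons bracket_family_Cons sum_linear_step Cons.IH
    by (simp add: distrib_left sum_distrib_left mult.left_commute)
qed

text \<open>A single letter at exponent 0 contributes \<open>bracket 1 = 1\<close> times a matrix
  unit and \<open>bracket (-1) = 0\<close> times the term with D and E, so one entry of the bracket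
  family isolates one generator. This takes the place of irreducibility of V.\<close>

lemma compatible_matrix_unit:
  obtains F where "compatible F" "\<And>i j. F [i] [j] = (if i = q \<and> j = p then 1 else 0)"
proof
  let ?F = "\<lambda>I J. if length I = length J then bracket_family 0 (zip I J) p q else 0"
  show "compatible ?F"
  proof (rule compatibleI_pair)
    show "balanced ?F"
      by (simp add: balanced_def)
  qed (simp_all add: bracket_family_E bracket_family_D)
  show "?F [i] [j] = (if i = q \<and> j = p then 1 else 0)" for i j
    by (simp add: bracket_family_Cons bracket_def chebyshev_int_def sum_if_delta)
qed

end

section \<open>Cancelling invertible families, and commutation in one tensor factor\<close>

lemma row_cancel:
  fixes F G :: "('n::finite, 'k::field) family"
  assumes "conv F G = delta" "length K = n"
    and "\<And>L. length L = n \<Longrightarrow> (\<Sum>K\<in>words n. u K * F K L) = (\<Sum>K\<in>words n. v K * F K L)"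
  shows "u K = v K"
proof -
  have *: "(\<Sum>L\<in>words n. (\<Sum>M\<in>words n. w M * F M L) * G L K) = w K" for w :: "'n list \<Rightarrow> 'k"
  proof -
    have "(\<Sum>L\<in>words n. (\<Sum>M\<in>words n. w M * F M L) * G L K) =
        (\<Sum>M\<in>words n. w M * conv F G M K)"
      by (subst (2) sum.cong[OF refl, of _ _ "\<lambda>M. \<Sum>L\<in>words n. w M * F M L * G L K"])
        (auto simp: conv_def sum_distrib_left mult.assoc sum_distrib_right intro: sum.swap)
    also have "\<dots> = w K"
      using assms(2) by (simp add: assms(1) delta_def if_distrib[of "\<lambda>x. _ * x"] cong: if_cong)
    finally show ?thesis .
  qed
  have "(\<Sum>L\<in>words n. (\<Sum>M\<in>words n. u M * F M L) * G L K) =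
      (\<Sum>L\<in>words n. (\<Sum>M\<in>words n. v M * F M L) * G L K)"
    by (intro sum.cong refl) (simp add: assms(3))
  then show ?thesis
    unfolding * .
qed

lemma column_cancel:
  fixes F G :: "('n::finite, 'k::field) family"
  assumes "conv G F = delta" "length K = n"
    and "\<And>L. length L = n \<Longrightarrow> (\<Sum>K\<in>words n. F L K * u K) = (\<Sum>K\<in>words n. F L K * v K)"
  shows "u K = v K"
proof -
  have *: "(\<Sum>L\<in>words n. G K L * (\<Sum>M\<in>words n. F L M * w M)) = w K" for w :: "'n list \<Rightarrow> 'k"
  proof -
    have "(\<Sum>L\<in>words n. G K L * (\<Sum>M\<in>words n. F L M * w M)) =
        (\<Sum>M\<in>words n. conv G F K M * w M)"
      using assms(2) by (subst (2) sum.cong[OF refl, of _ _ "\<lambda>M. \<Sum>L\<in>words n. G K L * F L M * w M"])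
        (auto simp: conv_def sum_distrib_left mult.assoc sum_distrib_right intro: sum.swap)
    also have "\<dots> = w K"
      using assms(2) by (simp add: assms(1) delta_def if_distrib[of "\<lambda>x. x * _"] cong: if_cong)
    finally show ?thesis .
  qed
  have "(\<Sum>L\<in>words n. G K L * (\<Sum>M\<in>words n. F L M * u M)) =
      (\<Sum>L\<in>words n. G K L * (\<Sum>M\<in>words n. F L M * v M))"
    by (intro sum.cong refl) (simp add: assms(3))
  then show ?thesis
    unfolding * .
qed

text \<open>Freezing the first m letters of Z reduces the claim to the blocks of Z. The side
  conditions of the last premise hold for every block cut out by \<open>take\<close> and
  \<open>drop\<close>; they are passed on because \<open>cut_append\<close> asks for them.\<close>

lemma tensor_right_commute:
  assumes "balanced Y" "balanced Z"
    and "\<And>P Q I J. length P = length Q \<Longrightarrow> length I = length J \<Longrightarrow> length P \<le> m \<Longrightarrow>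
      (length P < m \<Longrightarrow> I = []) \<Longrightarrow>
      conv Y (\<lambda>I J. Z (P @ I) (Q @ J)) I J = conv (\<lambda>I J. Z (P @ I) (Q @ J)) Y I J"
  shows "conv (tensor m delta Y) Z = conv Z (tensor m delta Y)"
proof (intro ext)
  fix I J
  show "conv (tensor m delta Y) Z I J = conv Z (tensor m delta Y) I J"
  proof (cases "length I = length J")
    case True
    have "conv (tensor m delta Y) Z I J =
        conv Y (\<lambda>A B. Z (take m I @ A) (take m J @ B)) (drop m I) (drop m J)"
      unfolding conv_tensor_delta_left by (simp add: conv_def)
    also have "\<dots> = conv (\<lambda>A B. Z (take m I @ A) (take m J @ B)) Y (drop m I) (drop m J)"
      using True by (intro assms(3)) auto
    also have "\<dots> = conv Z (tensor m delta Y) I J"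
      unfolding conv_tensor_delta_right[OF True] using True by (simp add: conv_def)
    finally show ?thesis .
  next
    case False
    then show ?thesis
      using assms(1,2) by (simp add: balancedD)
  qed
qed

lemma tensor_left_commute:
  assumes "balanced Y" "balanced Z"
    and "\<And>P Q I J. length P = length Q \<Longrightarrow> length I = length J \<Longrightarrow> length I \<le> m \<Longrightarrow>
      (length I < m \<Longrightarrow> P = []) \<Longrightarrow>
      conv Y (\<lambda>I J. Z (I @ P) (J @ Q)) I J = conv (\<lambda>I J. Z (I @ P) (J @ Q)) Y I J"
  shows "conv (tensor m Y delta) Z = conv Z (tensor m Y delta)"
proof (intro ext)
  fix I J
  show "conv (tensor m Y delta) Z I J = conv Z (tensor m Y delta) I J"
  proof (cases "length I = length J")
    case True
    have "conv (tensor m Y delta) Z I J =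
        conv Y (\<lambda>A B. Z (A @ drop m I) (B @ drop m J)) (take m I) (take m J)"
      unfolding conv_tensor_left by (simp add: conv_def)
    also have "\<dots> = conv (\<lambda>A B. Z (A @ drop m I) (B @ drop m J)) Y (take m I) (take m J)"
      using True by (intro assms(3)) auto
    also have "\<dots> = conv Z (tensor m Y delta) I J"
      unfolding conv_tensor_right[OF True] using True by (simp add: conv_def)
    finally show ?thesis .
  next
    case False
    then show ?thesis
      using assms(1,2) by (simp add: balancedD)
  qed
qed

section \<open>Central families; products and inverses of compatible families\<close>

context bilinear_form
begin

text \<open>For the family of a functional this is laziness, see \<open>lazy_iff_central\<close>.
  Only balance is demanded besides, so that the notion applies to \<open>cut s m\<close>, where a
  pair of letters may lie across the cut.\<close>

definition central :: "('n, 'k) family \<Rightarrow> bool" where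
  "central F \<longleftrightarrow> balanced F \<and> (\<forall>G. compatible G \<longrightarrow> conv F G = conv G F)"

lemma centralD: "central F \<Longrightarrow> compatible G \<Longrightarrow> conv F G = conv G F"
  by (simp add: central_def)

lemma central_conv:
  assumes "central F" "central G"
  shows "central (conv F G)"
  unfolding central_def
proof (intro conjI allI impI)
  fix H assume "compatible H"
  then show "conv (conv F G) H = conv H (conv F G)"
    using centralD[OF assms(1)] centralD[OF assms(2)] by (metis conv_assoc)
qed (use assms in \<open>simp add: central_def\<close>)

lemma central_inverse:
  assumes "central F" "balanced G" "conv F G = delta" "conv G F = delta"
  shows "central G"
  unfolding central_def
proof (intro conjI allI impI)
  fix H assume H: "compatible H"
  have "conv G H = conv G (conv (conv H F) G)"
    by (simp add: conv_assoc assms(3) compatible_balanced[OF H])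
  also have "\<dots> = conv H G"
    by (simp add: centralD[OF assms(1) H, symmetric] conv_assoc[symmetric] assms(4))
  finally show "conv G H = conv H G" .
qed (rule assms(2))

text \<open>Blocks of a compatible family with frozen prefix or suffix are again compatible, so F
  commutes with them on the first m letters and G on the remaining ones.\<close>

lemma central_tensor:
  assumes "central F" "central G"
  shows "central (tensor m F G)"
proof -
  have bal: "balanced F" "balanced G"
    using assms by (simp_all add: central_def)
  have "central (tensor m F delta)"
    using bal assms(1) unfolding central_def
    by (auto intro!: tensor_left_commute simp: compatible_balanced compatible_suffix)
  moreover have "central (tensor m delta G)"
    using bal assms(2) unfolding central_def
    by (auto intro!: tensor_right_commute simp: compatible_balanced compatible_prefix)
  ultimately show ?thesis
    unfolding tensor_factor[OF bal] by (rule central_conv)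
qed

lemma compatible_scale:
  assumes "compatible F"
  shows "compatible (\<lambda>I J. c * F I J)"
proof (rule compatibleI_pair)
  show "balanced (\<lambda>I J. c * F I J)"
    using compatible_balanced[OF assms] by (simp add: balanced_def)
qed (simp_all only: mult.left_commute[of _ c] sum_distrib_left[symmetric] compatible_E[OF assms] compatible_D[OF assms])

lemma sum_words_pair:
  fixes h :: "'n list \<Rightarrow> 'k"
  shows "(\<Sum>K\<in>words (i + Suc (Suc j)). h K) =
    (\<Sum>P\<in>words i. \<Sum>Q\<in>words j. \<Sum>a\<in>UNIV. \<Sum>b\<in>UNIV. h (P @ a # b # Q))"
proof -
  have "(\<Sum>K\<in>words (i + Suc (Suc j)). h K) =
      (\<Sum>P\<in>words i. \<Sum>a\<in>UNIV. \<Sum>b\<in>UNIV. \<Sum>Q\<in>words j. h (P @ a # b # Q))"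
    by (simp only: sum_words_add sum_words_Suc)
  also have "\<dots> = (\<Sum>P\<in>words i. \<Sum>a\<in>UNIV. \<Sum>Q\<in>words j. \<Sum>b\<in>UNIV. h (P @ a # b # Q))"
    by (intro sum.cong refl sum.swap)
  also have "\<dots> = (\<Sum>P\<in>words i. \<Sum>Q\<in>words j. \<Sum>a\<in>UNIV. \<Sum>b\<in>UNIV. h (P @ a # b # Q))"
    by (intro sum.cong refl sum.swap)
  finally show ?thesis .
qed

lemma sum_swap3:
  fixes h :: "'n \<Rightarrow> 'n \<Rightarrow> 'a \<Rightarrow> 'k"
  shows "(\<Sum>l\<in>UNIV. \<Sum>m\<in>UNIV. \<Sum>x\<in>A. h l m x) = (\<Sum>x\<in>A. \<Sum>l\<in>UNIV. \<Sum>m\<in>UNIV. h l m x)"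
proof -
  have "(\<Sum>l\<in>UNIV. \<Sum>m\<in>UNIV. \<Sum>x\<in>A. h l m x) = (\<Sum>l\<in>UNIV. \<Sum>x\<in>A. \<Sum>m\<in>UNIV. h l m x)"
    by (intro sum.cong refl sum.swap)
  also have "\<dots> = (\<Sum>x\<in>A. \<Sum>l\<in>UNIV. \<Sum>m\<in>UNIV. h l m x)"
    by (rule sum.swap)
  finally show ?thesis .
qed

text \<open>Compatibility on the left moves E from the row word to the contracted word,
  compatibility on the right moves it on to the column word; D travels the opposite way. This is the
  reason why the coproduct respects the relations.\<close>

lemma compatible_contract:
  assumes left: "\<And>K L. length K = length L \<Longrightarrow> compatible (\<lambda>I J. B I J K L)"
    and right: "\<And>I J. length I = length J \<Longrightarrow> compatible (\<lambda>K L. B I J K L)"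
  shows "compatible (\<lambda>I J. if length I = length J then \<Sum>K\<in>words (length I). B I K K J else 0)"
    (is "compatible ?F")
proof (rule compatibleI_pair)
  show "balanced ?F"
    by (simp add: balanced_def)
next
  fix I J I' J' :: "'n list" and k j
  assume len: "length I = length J" "length I' = length J'"
  have F: "?F (I @ I') (J @ J') = (\<Sum>P\<in>words (length I). \<Sum>Q\<in>words (length I').
      B (I @ I') (P @ Q) (P @ Q) (J @ J'))"
    using len by (simp add: sum_words_add)
  have "(\<Sum>l\<in>UNIV. \<Sum>m\<in>UNIV. E l m * ?F (I @ l # m # I') (J @ k # j # J')) =
    (\<Sum>l\<in>UNIV. \<Sum>m\<in>UNIV. \<Sum>K\<in>words (length I + Suc (Suc (length I'))).
      E l m * B (I @ l # m # I') K K (J @ k # j # J'))"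
    using len by (simp add: sum_distrib_left)
  also have "\<dots> = (\<Sum>P\<in>words (length I). \<Sum>Q\<in>words (length I'). \<Sum>a\<in>UNIV. \<Sum>b\<in>UNIV.
      E a b * B (I @ I') (P @ Q) (P @ a # b # Q) (J @ k # j # J'))"
    unfolding sum_swap3[where A = "words _"] unfolding sum_words_pair using len by (intro sum.cong refl compatible_E left) auto
  also have "\<dots> = E k j * ?F (I @ I') (J @ J')"
    unfolding F sum_distrib_left using len by (intro sum.cong refl compatible_E right) auto
  finally show "(\<Sum>l\<in>UNIV. \<Sum>m\<in>UNIV. E l m * ?F (I @ l # m # I') (J @ k # j # J')) =
    E k j * ?F (I @ I') (J @ J')" .
  have "(\<Sum>l\<in>UNIV. \<Sum>m\<in>UNIV. D l m * ?F (I @ k # j # I') (J @ l # m # J')) =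
    (\<Sum>l\<in>UNIV. \<Sum>m\<in>UNIV. \<Sum>K\<in>words (length I + Suc (Suc (length I'))).
      D l m * B (I @ k # j # I') K K (J @ l # m # J'))"
    using len by (simp add: sum_distrib_left)
  also have "\<dots> = (\<Sum>P\<in>words (length I). \<Sum>Q\<in>words (length I'). \<Sum>a\<in>UNIV. \<Sum>b\<in>UNIV.
      D a b * B (I @ k # j # I') (P @ a # b # Q) (P @ Q) (J @ J'))"
    unfolding sum_swap3[where A = "words _"] unfolding sum_words_pair using len by (intro sum.cong refl compatible_D right) auto
  also have "\<dots> = D k j * ?F (I @ I') (J @ J')"
    unfolding F sum_distrib_left using len by (intro sum.cong refl compatible_D left) auto
  finally show "(\<Sum>l\<in>UNIV. \<Sum>m\<in>UNIV. D l m * ?F (I @ k # j # I') (J @ l # m # J')) =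
    D k j * ?F (I @ I') (J @ J')" .
qed

lemma compatible_conv:
  assumes "compatible F" "compatible G"
  shows "compatible (conv F G)"
proof -
  have "conv F G = (\<lambda>I J. if length I = length J then \<Sum>K\<in>words (length I). F I K * G K J else 0)"
    using balanced_conv[OF compatible_balanced[OF assms(2)]]
    by (intro ext) (auto simp: conv_def balanced_def)
  moreover have "compatible \<dots>"
  proof (intro compatible_contract[of "\<lambda>I J K L. F I J * G K L"])
    show "compatible (\<lambda>I J. F I J * G K L)" for K L
      using compatible_scale[OF assms(1), of "G K L"] by (simp add: mult.commute)
  qed (rule compatible_scale[OF assms(2)])
  ultimately show ?thesis
    by simp
qed

text \<open>After multiplication by F the claim for G follows from the identity for F, and F can be
  cancelled: from row vectors in the case of E, from column vectors in the case of D.\<close>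

lemma compatible_inverse:
  assumes "compatible F" "balanced G" "conv F G = delta" "conv G F = delta"
  shows "compatible G"
proof (rule compatibleI_pair)
  fix I J I' J' :: "'n list" and k j
  assume len: "length I = length J" "length I' = length J'"
  let ?n = "length I + Suc (Suc (length I'))"
  have conv: "(\<Sum>K\<in>words n. F A K * G K B) = delta A B" "(\<Sum>K\<in>words n. G A K * F K B) = delta A B"
    if "length A = n" for A B n
    using fun_cong[OF fun_cong[OF assms(3)], of A B] fun_cong[OF fun_cong[OF assms(4)], of A B] that
    by (simp_all add: conv_def)
  define h where "h = length I"
  have split: "\<exists>P a b Q. L = P @ a # b # Q \<and> length P = length I \<and> length Q = length I'"
    if L: "length L = ?n" for L :: "'n list"
  proof -
    have "length (drop h L) = Suc (Suc (length I'))"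
      using L by (simp add: h_def)
    then obtain a b Q where "drop h L = a # b # Q" "length Q = length I'"
      unfolding length_Suc_conv by blast
    then show ?thesis
      using L append_take_drop_id[of h L] by (intro exI[of _ "take h L"] exI[of _ a] exI[of _ b] exI[of _ Q]) (auto simp: h_def)
  qed
  show "(\<Sum>l\<in>UNIV. \<Sum>m\<in>UNIV. E l m * G (I @ l # m # I') (J @ k # j # J')) = E k j * G (I @ I') (J @ J')"
  proof -
    let ?u = "\<lambda>K. \<Sum>l\<in>UNIV. \<Sum>m\<in>UNIV. E l m * G (I @ l # m # I') K"
    \<comment> \<open>Cancellation works with functions of the whole word, so the pair is read off
      at the positions h and h + 1, directly behind the prefix of the length of I.\<close>
    let ?v = "\<lambda>K. E (K ! h) (K ! Suc h) * G (I @ I') (take h K @ drop (Suc (Suc h)) K)"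
    have v: "?v (P @ a # b # Q) = E a b * G (I @ I') (P @ Q)" if "length P = length I" for P Q a b
      using that by (simp add: nth_append h_def)
    have "?u (J @ k # j # J') = ?v (J @ k # j # J')"
    proof (rule row_cancel[OF assms(3), where u = ?u and v = ?v])
      show "length (J @ k # j # J') = ?n"
        using len by simp
      fix L :: "'n list" assume "length L = ?n"
      then obtain P a b Q where L: "L = P @ a # b # Q" "length P = length I" "length Q = length I'"
        using split by blast
      have "(\<Sum>K\<in>words ?n. ?u K * F K L) =
          (\<Sum>l\<in>UNIV. \<Sum>m\<in>UNIV. E l m * (\<Sum>K\<in>words ?n. G (I @ l # m # I') K * F K L))"
        unfolding sum_distrib_left sum_swap3[where A = "words _"] by (simp only: sum_distrib_right mult.assoc)
      also have "\<dots> = (\<Sum>l\<in>UNIV. \<Sum>m\<in>UNIV. E l m * delta (I @ l # m # I') L)"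
        by (simp add: conv)
      also have "\<dots> = E a b * delta (I @ I') (P @ Q)"
        unfolding L using compatible_E[OF compatible_delta] L by simp
      also have "\<dots> = (\<Sum>P'\<in>words (length I). \<Sum>Q'\<in>words (length I').
          G (I @ I') (P' @ Q') * (E a b * F (P' @ Q') (P @ Q)))"
        using conv(2)[of "I @ I'" "length I + length I'" "P @ Q"]
        by (simp add: sum_words_add sum_distrib_left[symmetric] mult.left_commute[of _ "E a b"])
      also have "\<dots> = (\<Sum>P'\<in>words (length I). \<Sum>Q'\<in>words (length I').
          G (I @ I') (P' @ Q') * (\<Sum>a'\<in>UNIV. \<Sum>b'\<in>UNIV. E a' b' * F (P' @ a' # b' # Q') L))"
        using L by (intro sum.cong refl) (simp add: compatible_E[OF assms(1)])
      also have "\<dots> = (\<Sum>K\<in>words ?n. ?v K * F K L)"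
        unfolding sum_words_pair sum_distrib_left
        by (intro sum.cong refl) (simp only: v in_words mult.assoc mult.left_commute)
      finally show "(\<Sum>K\<in>words ?n. ?u K * F K L) = (\<Sum>K\<in>words ?n. ?v K * F K L)" .
    qed
    then show ?thesis
      using v len by simp
  qed
  show "(\<Sum>l\<in>UNIV. \<Sum>m\<in>UNIV. D l m * G (I @ k # j # I') (J @ l # m # J')) = D k j * G (I @ I') (J @ J')"
  proof -
    let ?u = "\<lambda>K. \<Sum>l\<in>UNIV. \<Sum>m\<in>UNIV. D l m * G K (J @ l # m # J')"
    let ?v = "\<lambda>K. D (K ! h) (K ! Suc h) * G (take h K @ drop (Suc (Suc h)) K) (J @ J')"
    have v: "?v (P @ a # b # Q) = D a b * G (P @ Q) (J @ J')" if "length P = length I" for P Q a b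
      using that by (simp add: nth_append h_def)
    have "?u (I @ k # j # I') = ?v (I @ k # j # I')"
    proof (rule column_cancel[OF assms(4), where u = ?u and v = ?v])
      show "length (I @ k # j # I') = ?n"
        by simp
      fix L :: "'n list" assume "length L = ?n"
      then obtain P a b Q where L: "L = P @ a # b # Q" "length P = length I" "length Q = length I'"
        using split by blast
      have "(\<Sum>K\<in>words ?n. F L K * ?u K) =
          (\<Sum>l\<in>UNIV. \<Sum>m\<in>UNIV. D l m * (\<Sum>K\<in>words ?n. F L K * G K (J @ l # m # J')))"
        unfolding sum_distrib_left sum_swap3[where A = "words _"] by (simp only: mult.left_commute)
      also have "\<dots> = (\<Sum>l\<in>UNIV. \<Sum>m\<in>UNIV. D l m * delta L (J @ l # m # J'))"
        using L by (simp add: conv)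
      also have "\<dots> = D a b * delta (P @ Q) (J @ J')"
        unfolding L using compatible_D[OF compatible_delta] L len by simp
      also have "\<dots> = (\<Sum>P'\<in>words (length I). \<Sum>Q'\<in>words (length I').
          (D a b * F (P @ Q) (P' @ Q')) * G (P' @ Q') (J @ J'))"
        using conv(1)[of "P @ Q" "length I + length I'" "J @ J'"] L
        by (simp add: sum_words_add sum_distrib_left[symmetric] mult.assoc)
      also have "\<dots> = (\<Sum>P'\<in>words (length I). \<Sum>Q'\<in>words (length I').
          (\<Sum>a'\<in>UNIV. \<Sum>b'\<in>UNIV. D a' b' * F L (P' @ a' # b' # Q')) * G (P' @ Q') (J @ J'))"
        using L by (intro sum.cong refl) (simp add: compatible_D[OF assms(1)])
      also have "\<dots> = (\<Sum>K\<in>words ?n. F L K * ?v K)"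
        unfolding sum_words_pair sum_distrib_right
        by (intro sum.cong refl) (simp only: v in_words mult.assoc mult.left_commute)
      finally show "(\<Sum>K\<in>words ?n. F L K * ?u K) = (\<Sum>K\<in>words ?n. F L K * ?v K)" .
    qed
    then show ?thesis
      using v by simp
  qed
qed (rule assms(2))

end

section \<open>Lazy cocycles as families\<close>

type_synonym ('n, 'k) family2 = "'n list \<Rightarrow> 'n list \<Rightarrow> 'n list \<Rightarrow> 'n list \<Rightarrow> 'k"

text \<open>\<open>cut s m\<close> lists the matrices of \<open>s\<close> on \<open>V\<^sup>\<otimes>\<^sup>m \<otimes> V\<^sup>\<otimes>\<^sup>n\<close> for all \<open>n\<close>.\<close>

definition cut :: "('n, 'k) family2 \<Rightarrow> nat \<Rightarrow> ('n, 'k) family" where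
  "cut s m = (\<lambda>I J. s (take m I) (take m J) (drop m I) (drop m J))"

definition balanced2 :: "('n, 'k::zero) family2 \<Rightarrow> bool" where
  "balanced2 s \<longleftrightarrow> (\<forall>I J K L. length I \<noteq> length J \<or> length K \<noteq> length L \<longrightarrow> s I J K L = 0)"

lemma balanced_cut [simp]:
  assumes "balanced2 s"
  shows "balanced (cut s m)"
  unfolding balanced_def
proof (intro allI impI)
  fix I J :: "'a list"
  assume "length I \<noteq> length J"
  then have "length (take m I) \<noteq> length (take m J) \<or> length (drop m I) \<noteq> length (drop m J)"
    by auto
  then show "cut s m I J = 0"
    using assms unfolding balanced2_def cut_def by blast
qed

lemma conv_cut:
  "conv (cut s m) F I J = (\<Sum>M\<in>words (length (take m I)). \<Sum>N\<in>words (length (drop m I)).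
    s (take m I) M (drop m I) N * F (M @ N) J)"
proof -
  have "conv (cut s m) F I J = (\<Sum>K\<in>words (length I).
      s (take m I) (take m K) (drop m I) (drop m K) * F (take m K @ drop m K) J)"
    by (simp add: conv_def cut_def)
  also have "\<dots> = (\<Sum>M\<in>words (min m (length I)). \<Sum>N\<in>words (length I - m).
    s (take m I) M (drop m I) N * F (M @ N) J)"
    by (rule sum_words_split)
  finally show ?thesis
    by (simp add: min.commute)
qed

lemma conv_cut_right:
  assumes "length I = length J"
  shows "conv F (cut s m) I J = (\<Sum>M\<in>words (length (take m I)). \<Sum>N\<in>words (length (drop m I)).
    F I (M @ N) * s M (take m J) N (drop m J))"
proof -
  have "conv F (cut s m) I J = (\<Sum>K\<in>words (length I).
      F I (take m K @ drop m K) * s (take m K) (take m J) (drop m K) (drop m J))"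
    by (simp add: conv_def cut_def)
  also have "\<dots> = (\<Sum>M\<in>words (min m (length I)). \<Sum>N\<in>words (length I - m).
    F I (M @ N) * s M (take m J) N (drop m J))"
    by (rule sum_words_split)
  finally show ?thesis
    by (simp add: min.commute)
qed

lemma conv_cut_cut:
  assumes "length I = length J"
  shows "conv (cut s m) (cut t m) I J = (\<Sum>M\<in>words (length (take m I)). \<Sum>N\<in>words (length (drop m I)).
    s (take m I) M (drop m I) N * t M (take m J) N (drop m J))"
  unfolding conv_cut_right[OF assms] by (intro sum.cong refl) (auto simp: cut_def min_def split: if_splits)

text \<open>The cocycle and its convolution inverse evaluated at pairs of monomials. Laziness is an
  identity in the algebra; it appears here after application of an arbitrary functional F, since
  functionals separate the elements.\<close>

locale lazy_cocycle_family = bilinear_form E D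
  for E D :: "'n::finite \<Rightarrow> 'n \<Rightarrow> 'k::field" +
  fixes s t :: "('n, 'k) family2"
  assumes s_bal: "balanced2 s" and t_bal: "balanced2 t"
    and s_left: "length K = length L \<Longrightarrow> compatible (\<lambda>I J. s I J K L)"
    and s_right: "length I = length J \<Longrightarrow> compatible (\<lambda>K L. s I J K L)"
    and s_unit_left: "s [] [] K L = delta K L"
    and s_unit_right: "s I J [] [] = delta I J"
    and cocycle: "length I = length J \<Longrightarrow> length K = length L \<Longrightarrow> length P = length Q \<Longrightarrow>
      (\<Sum>M\<in>words (length I). \<Sum>N\<in>words (length K). s (I @ K) (M @ N) P Q * s M J N L) =
      (\<Sum>N\<in>words (length K). \<Sum>R\<in>words (length P). s I J (K @ P) (N @ R) * s N L R Q)"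
    and lazy: "compatible F \<Longrightarrow> length I = length J \<Longrightarrow> length K = length L \<Longrightarrow>
      (\<Sum>M\<in>words (length I). \<Sum>N\<in>words (length K). s I M K N * F (M @ N) (J @ L)) =
      (\<Sum>M\<in>words (length I). \<Sum>N\<in>words (length K). F (I @ K) (M @ N) * s M J N L)"
    and inverse_right: "length I = length J \<Longrightarrow> length K = length L \<Longrightarrow>
      (\<Sum>M\<in>words (length I). \<Sum>N\<in>words (length K). s I M K N * t M J N L) = delta I J * delta K L"
    and inverse_left: "length I = length J \<Longrightarrow> length K = length L \<Longrightarrow>
      (\<Sum>M\<in>words (length I). \<Sum>N\<in>words (length K). t I M K N * s M J N L) = delta I J * delta K L"
begin

lemma delta_take_drop:
  "delta (take m I) (take m J) * delta (drop m I) (drop m J) = (delta I J :: 'k)" for I J :: "'n list"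
proof -
  have "I = J \<longleftrightarrow> take m I = take m J \<and> drop m I = drop m J"
    by (metis append_take_drop_id)
  then show ?thesis
    by (auto simp: delta_def)
qed

lemma cut_central: "central (cut s m)"
  unfolding central_def
proof (intro conjI allI impI ext)
  fix F I J assume F: "compatible F"
  show "conv (cut s m) F I J = conv F (cut s m) I J"
  proof (cases "length I = length J")
    case True
    then show ?thesis
      using lazy[OF F, of "take m I" "take m J" "drop m I" "drop m J"]
      by (simp add: conv_cut conv_cut_right)
  next
    case False
    then show ?thesis
      using s_bal F by (simp add: balancedD compatible_balanced)
  qed
qed (simp add: s_bal)

lemma cut_inverse: "conv (cut s m) (cut t m) = delta" "conv (cut t m) (cut s m) = delta"
proof -
  have "conv (cut s m) (cut t m) I J = delta I J \<and> conv (cut t m) (cut s m) I J = delta I J" for I J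
  proof (cases "length I = length J")
    case True
    then show ?thesis
      using inverse_right[of "take m I" "take m J" "drop m I" "drop m J"]
        inverse_left[of "take m I" "take m J" "drop m I" "drop m J"]
      by (simp add: conv_cut_cut delta_take_drop)
  next
    case False
    then show ?thesis
      using s_bal t_bal by (simp add: balancedD)
  qed
  then show "conv (cut s m) (cut t m) = delta" "conv (cut t m) (cut s m) = delta"
    by (auto intro!: ext)
qed

text \<open>The cocycle identity on three tensor powers, of degrees m, n and arbitrary, written as
  an equation of operators.\<close>

lemma cut_cocycle:
  "conv (cut s (m + n)) (tensor (m + n) (cut s m) delta) = conv (cut s m) (tensor m delta (cut s n))"
proof (intro ext)
  fix I J
  show "conv (cut s (m + n)) (tensor (m + n) (cut s m) delta) I J = conv (cut s m) (tensor m delta (cut s n)) I J"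
  proof (cases "length I = length J")
    case True
    define i1 i2 i3 where i: "i1 = take m I" "i2 = take n (drop m I)" "i3 = drop (m + n) I"
    define j1 j2 j3 where j: "j1 = take m J" "j2 = take n (drop m J)" "j3 = drop (m + n) J"
    have I: "take (m + n) I = i1 @ i2" "drop m I = i2 @ i3" and J: "take (m + n) J = j1 @ j2" "drop m J = j2 @ j3"
      by (simp_all add: i j take_add) (metis add.commute append_take_drop_id drop_drop)+
    have len: "length i1 = length j1" "length i2 = length j2" "length i3 = length j3"
      using True by (simp_all add: i j)
    \<comment> \<open>A block shorter than its nominal length leaves nothing for the later blocks;
      only then do \<open>take\<close> and \<open>drop\<close> recover the blocks from a
      concatenation.\<close>
    have small: "length j1 \<le> m" "length j1 < m \<Longrightarrow> j2 = []" "length j1 < m \<Longrightarrow> j3 = []"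
      "length j2 \<le> n" "length j2 < n \<Longrightarrow> j3 = []"
      by (auto simp: j)
    have "conv (cut s (m + n)) (tensor (m + n) (cut s m) delta) I J =
        (\<Sum>K\<in>words (length j1 + length j2). cut s (m + n) I (K @ j3) * cut s m K (j1 @ j2))"
      unfolding conv_tensor_right[OF True] by (simp add: J j(3)[symmetric])
    also have "\<dots> = (\<Sum>M\<in>words (length j1). \<Sum>N\<in>words (length j2). s (i1 @ i2) (M @ N) i3 j3 * s M j1 N j2)"
    proof -
      have "cut s (m + n) I ((M @ N) @ j3) * cut s m (M @ N) (j1 @ j2) = s (i1 @ i2) (M @ N) i3 j3 * s M j1 N j2"
        if "length M = length j1" "length N = length j2" for M N
        using small that len by (cases "length j1 < m"; cases "length j2 < n") (auto simp: cut_def I i(1,3)[symmetric])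
      then show ?thesis
        unfolding sum_words_add by (intro sum.cong refl) auto
    qed
    also have "\<dots> = (\<Sum>N\<in>words (length j2). \<Sum>R\<in>words (length j3). s i1 j1 (i2 @ i3) (N @ R) * s N j2 R j3)"
      using cocycle[OF len] len by simp
    also have "\<dots> = (\<Sum>K\<in>words (length j2 + length j3). cut s m I (j1 @ K) * cut s n K (j2 @ j3))"
    proof -
      have "cut s m I (j1 @ N @ R) * cut s n (N @ R) (j2 @ j3) = s i1 j1 (i2 @ i3) (N @ R) * s N j2 R j3"
        if "length N = length j2" "length R = length j3" for N R
        using small that len by (cases "length j1 < m"; cases "length j2 < n") (auto simp: cut_def I i(1)[symmetric])
      then show ?thesis
        unfolding sum_words_add by (intro sum.cong refl) auto
    qed
    also have "\<dots> = conv (cut s m) (tensor m delta (cut s n)) I J"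
      unfolding conv_tensor_delta_right[OF True] by (simp add: J j(1)[symmetric])
    finally show ?thesis .
  next
    case False
    then show ?thesis
      using s_bal by (simp add: balancedD)
  qed
qed

lemma cut_append:
  assumes "length I = length J" "length P = length Q" "length I \<le> m" "length I < m \<Longrightarrow> P = []"
  shows "cut s m (I @ P) (J @ Q) = s I J P Q"
  using assms by (cases "length I < m") (auto simp: cut_def)

text \<open>With one argument fixed at a monomial, a cocycle is a functional in the other argument,
  hence compatible, and a central family commutes with it.\<close>

lemma central_commute_cut:
  assumes "central F"
  shows "conv (tensor m F delta) (cut s m) = conv (cut s m) (tensor m F delta)"
    and "conv (tensor m delta F) (cut s m) = conv (cut s m) (tensor m delta F)"
proof -
  have bal: "balanced F" "balanced (cut s m)"
    using assms s_bal by (simp_all add: central_def)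
  show "conv (tensor m F delta) (cut s m) = conv (cut s m) (tensor m F delta)"
  proof (rule tensor_left_commute[OF bal])
    fix P Q I J :: "'n list"
    assume *: "length P = length Q" "length I = length J" "length I \<le> m" "length I < m \<Longrightarrow> P = []"
    then have "cut s m (A @ P) (B @ Q) = s A B P Q" if "length A = length I" "length B = length I" for A B
      using that by (intro cut_append) auto
    then have "conv F (\<lambda>I J. cut s m (I @ P) (J @ Q)) I J = conv F (\<lambda>I J. s I J P Q) I J"
      and "conv (\<lambda>I J. cut s m (I @ P) (J @ Q)) F I J = conv (\<lambda>I J. s I J P Q) F I J"
      using *(2) by (simp_all add: conv_def)
    then show "conv F (\<lambda>I J. cut s m (I @ P) (J @ Q)) I J = conv (\<lambda>I J. cut s m (I @ P) (J @ Q)) F I J"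
      using centralD[OF assms s_left[OF *(1)]] by simp
  qed
  show "conv (tensor m delta F) (cut s m) = conv (cut s m) (tensor m delta F)"
  proof (rule tensor_right_commute[OF bal])
    fix P Q I J :: "'n list"
    assume *: "length P = length Q" "length I = length J" "length P \<le> m" "length P < m \<Longrightarrow> I = []"
    then have "cut s m (P @ A) (Q @ B) = s P Q A B" if "length A = length I" "length B = length I" for A B
      using that by (intro cut_append) auto
    then have "conv F (\<lambda>I J. cut s m (P @ I) (Q @ J)) I J = conv F (\<lambda>I J. s P Q I J) I J"
      and "conv (\<lambda>I J. cut s m (P @ I) (Q @ J)) F I J = conv (\<lambda>I J. s P Q I J) F I J"
      using *(2) by (simp_all add: conv_def)
    then show "conv F (\<lambda>I J. cut s m (P @ I) (Q @ J)) I J = conv (\<lambda>I J. cut s m (P @ I) (Q @ J)) F I J"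
      using centralD[OF assms s_right[OF *(1)]] by simp
  qed
qed

section \<open>The scalar by which a lazy cocycle acts on the invariants of two letters\<close>

lemma sum_words_1:
  fixes f :: "'n list \<Rightarrow> 'k"
  shows "(\<Sum>K\<in>words (Suc 0). f K) = (\<Sum>i\<in>UNIV. f [i])"
  by (simp add: sum_words_Suc)

lemma sum_swap4:
  fixes h :: "'n \<Rightarrow> 'n \<Rightarrow> 'n \<Rightarrow> 'n \<Rightarrow> 'k"
  shows "(\<Sum>a\<in>UNIV. \<Sum>b\<in>UNIV. \<Sum>k\<in>UNIV. \<Sum>l\<in>UNIV. h a b k l) =
    (\<Sum>k\<in>UNIV. \<Sum>l\<in>UNIV. \<Sum>a\<in>UNIV. \<Sum>b\<in>UNIV. h a b k l)"
  by (rule trans[OF sum_swap3 sum.cong[OF refl sum_swap3]])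

lemma sum_swap_contract:
  fixes g h :: "'n \<Rightarrow> 'n \<Rightarrow> 'k"
  shows "(\<Sum>a\<in>UNIV. \<Sum>b\<in>UNIV. g a b * (\<Sum>k\<in>UNIV. \<Sum>l\<in>UNIV. h k l * f a b k l)) =
    (\<Sum>k\<in>UNIV. \<Sum>l\<in>UNIV. h k l * (\<Sum>a\<in>UNIV. \<Sum>b\<in>UNIV. g a b * f a b k l))"
  unfolding sum_distrib_left by (subst sum_swap4) (simp only: mult.left_commute)

text \<open>
  An invariant \<open>x\<close> of \<open>V \<otimes> V\<close> yields a matrix \<open>E x\<close> that commutes with the values of all functionals
  on the generators, hence with all matrices.
\<close>

lemma schur_D: "\<exists>c. \<forall>i m. (\<Sum>k\<in>UNIV. \<Sum>l\<in>UNIV. D k l * s [i] [k] [m] [l]) = c * D i m"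
proof -
  define x where "x = (\<lambda>i m. \<Sum>k\<in>UNIV. \<Sum>l\<in>UNIV. D k l * s [i] [k] [m] [l])"
  define y where "y = (\<lambda>p b. \<Sum>a\<in>UNIV. E p a * x a b)"
  have 1: "(\<Sum>a\<in>UNIV. \<Sum>b\<in>UNIV. F [i, m] [a, b] * x a b) = x i m * F [] []" if F: "compatible F" for F i m
  proof -
    have "(\<Sum>a\<in>UNIV. \<Sum>b\<in>UNIV. F [i, m] [a, b] * x a b) =
        (\<Sum>k\<in>UNIV. \<Sum>l\<in>UNIV. D k l * (\<Sum>a\<in>UNIV. \<Sum>b\<in>UNIV. F [i, m] [a, b] * s [a] [k] [b] [l]))"
      unfolding x_def by (rule sum_swap_contract)
    also have "\<dots> = (\<Sum>k\<in>UNIV. \<Sum>l\<in>UNIV. D k l * (\<Sum>a\<in>UNIV. \<Sum>b\<in>UNIV. s [i] [a] [m] [b] * F [a, b] [k, l]))"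
      using lazy[OF F, of "[i]" "[_]" "[m]" "[_]"] by (simp add: sum_words_1)
    also have "\<dots> = (\<Sum>a\<in>UNIV. \<Sum>b\<in>UNIV. s [i] [a] [m] [b] * (\<Sum>k\<in>UNIV. \<Sum>l\<in>UNIV. D k l * F [a, b] [k, l]))"
      by (rule sum_swap_contract[symmetric])
    also have "\<dots> = x i m * F [] []"
      using compatible_D[OF F, of "[]" "[]" "[]" "[]"] by (simp add: x_def sum_distrib_right sum_distrib_left ac_simps)
    finally show ?thesis .
  qed
  have 2: "(\<Sum>b\<in>UNIV. y p b * F [m] [b]) = (\<Sum>q\<in>UNIV. y q m * F [q] [p])" if F: "compatible F" for F p m
  proof -
    have "(\<Sum>b\<in>UNIV. y p b * F [m] [b]) = (\<Sum>a\<in>UNIV. \<Sum>b\<in>UNIV. x a b * (E p a * F [m] [b]))"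
      unfolding y_def sum_distrib_right by (subst sum.swap) (simp only: ac_simps)
    also have "\<dots> = (\<Sum>a\<in>UNIV. \<Sum>b\<in>UNIV. x a b * (\<Sum>q\<in>UNIV. \<Sum>i\<in>UNIV. E q i * F [q, i, m] [p, a, b]))"
      using compatible_E[OF F, of "[]" "[]" "[_]" "[_]"] by simp
    also have "\<dots> = (\<Sum>q\<in>UNIV. \<Sum>i\<in>UNIV. E q i * (\<Sum>a\<in>UNIV. \<Sum>b\<in>UNIV. F [q, i, m] [p, a, b] * x a b))"
      by (subst sum_swap_contract) (simp only: mult.commute)
    also have "\<dots> = (\<Sum>q\<in>UNIV. \<Sum>i\<in>UNIV. E q i * (x i m * F [q] [p]))"
      using 1[OF compatible_prefix[OF F, of "[_]" "[p]"]] by simp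
    also have "\<dots> = (\<Sum>q\<in>UNIV. y q m * F [q] [p])"
      by (simp add: y_def sum_distrib_right mult.assoc)
    finally show ?thesis .
  qed
  have 3: "y p p' = (if p = p' then y m m else 0)" for p p' m
  proof -
    obtain F where F: "compatible F" "\<And>i j. F [i] [j] = (if i = m \<and> j = p' then 1 else 0)"
      using compatible_matrix_unit[where p = p' and q = m] by blast
    have "(\<Sum>b\<in>UNIV. y p b * (if b = p' then 1 else 0)) = (\<Sum>q\<in>UNIV. y q m * (if q = m \<and> p = p' then 1 else 0))"
      using 2[OF F(1), of p m] by (simp add: F(2))
    then show ?thesis
      by (cases "p = p'") (simp_all add: sum_if_delta)
  qed
  obtain c where c: "y p p' = (if p = p' then c else 0)" for p p'
    using 3 by metis
  have "x i m = c * D i m" for i m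
  proof -
    have "x i m = (\<Sum>p\<in>UNIV. D i p * y p m)"
      unfolding y_def DE_sum ..
    then show ?thesis
      by (simp add: c sum_if_delta mult.commute)
  qed
  then show ?thesis
    unfolding x_def by blast
qed

text \<open>Take the cocycle identity on three generators and contract the rows of the first two
  with E and the columns of the last two with D. One side becomes z D for the E-contraction z of s,
  the other c times the identity matrix; hence z = c E with the scalar already found for D.\<close>

lemma schur:
  obtains c where "c \<noteq> 0"
    and "\<And>i m. (\<Sum>k\<in>UNIV. \<Sum>l\<in>UNIV. D k l * s [i] [k] [m] [l]) = c * D i m"
    and "\<And>k l. (\<Sum>i\<in>UNIV. \<Sum>j\<in>UNIV. E i j * s [i] [k] [j] [l]) = c * E k l"
proof -
  obtain c where c: "\<And>i m. (\<Sum>k\<in>UNIV. \<Sum>l\<in>UNIV. D k l * s [i] [k] [m] [l]) = c * D i m"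
    using schur_D by blast
  define z where "z = (\<lambda>k l. \<Sum>i\<in>UNIV. \<Sum>j\<in>UNIV. E i j * s [i] [k] [j] [l])"
  have 1: "(\<Sum>l\<in>UNIV. z k l * D l p) = (if k = p then c else 0)" for k p
  proof -
    have coc: "(\<Sum>a\<in>UNIV. \<Sum>b\<in>UNIV. s [i, j] [a, b] [p] [q] * s [a] [k] [b] [l]) =
        (\<Sum>a\<in>UNIV. \<Sum>b\<in>UNIV. s [i] [k] [j, p] [a, b] * s [a] [l] [b] [q])" for i j l q
      using cocycle[of "[i]" "[k]" "[j]" "[l]" "[p]" "[q]"] by (simp add: sum_words_1)
    have L: "(\<Sum>i\<in>UNIV. \<Sum>j\<in>UNIV. E i j * (\<Sum>a\<in>UNIV. \<Sum>b\<in>UNIV. s [a] [k] [b] [l] * s [i, j] [a, b] [p] [q])) =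
        (if p = q then z k l else 0)" for l q
    proof -
      have "(\<Sum>i\<in>UNIV. \<Sum>j\<in>UNIV. E i j * (\<Sum>a\<in>UNIV. \<Sum>b\<in>UNIV. s [a] [k] [b] [l] * s [i, j] [a, b] [p] [q])) =
          (\<Sum>a\<in>UNIV. \<Sum>b\<in>UNIV. s [a] [k] [b] [l] * (\<Sum>i\<in>UNIV. \<Sum>j\<in>UNIV. E i j * s [i, j] [a, b] [p] [q]))"
        by (rule sum_swap_contract)
      also have "\<dots> = (\<Sum>a\<in>UNIV. \<Sum>b\<in>UNIV. s [a] [k] [b] [l] * (E a b * delta [p] [q]))"
        using compatible_E[OF s_left[of "[p]" "[q]"], of "[]" "[]" "[]" "[]"] by (simp add: s_unit_left)
      finally show ?thesis
        by (simp add: z_def delta_def mult.commute)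
    qed
    have R: "(\<Sum>l\<in>UNIV. \<Sum>q\<in>UNIV. D l q * (\<Sum>a\<in>UNIV. \<Sum>b\<in>UNIV. s [i] [k] [j, p] [a, b] * s [a] [l] [b] [q])) =
        c * (if i = k then D j p else 0)" for i j
    proof -
      have "(\<Sum>l\<in>UNIV. \<Sum>q\<in>UNIV. D l q * (\<Sum>a\<in>UNIV. \<Sum>b\<in>UNIV. s [i] [k] [j, p] [a, b] * s [a] [l] [b] [q])) =
          (\<Sum>a\<in>UNIV. \<Sum>b\<in>UNIV. s [i] [k] [j, p] [a, b] * (\<Sum>l\<in>UNIV. \<Sum>q\<in>UNIV. D l q * s [a] [l] [b] [q]))"
        by (rule sum_swap_contract)
      also have "\<dots> = c * (\<Sum>a\<in>UNIV. \<Sum>b\<in>UNIV. D a b * s [i] [k] [j, p] [a, b])"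
        by (simp add: c sum_distrib_left ac_simps)
      also have "\<dots> = c * (if i = k then D j p else 0)"
        using compatible_D[OF s_right[of "[i]" "[k]"], of "[]" "[]" "[]" "[]"] by (simp add: s_unit_right delta_def)
      finally show ?thesis .
    qed
    have "(\<Sum>l\<in>UNIV. z k l * D l p) = (\<Sum>l\<in>UNIV. \<Sum>q\<in>UNIV. D l q * (if p = q then z k l else 0))"
      by (simp add: sum_if_delta mult.commute)
    also have "\<dots> = (\<Sum>l\<in>UNIV. \<Sum>q\<in>UNIV. D l q * (\<Sum>i\<in>UNIV. \<Sum>j\<in>UNIV. E i j *
        (\<Sum>a\<in>UNIV. \<Sum>b\<in>UNIV. s [i] [k] [j, p] [a, b] * s [a] [l] [b] [q])))"
      unfolding L[symmetric] coc[symmetric] by (simp only: mult.commute)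
    also have "\<dots> = (\<Sum>i\<in>UNIV. \<Sum>j\<in>UNIV. E i j * (\<Sum>l\<in>UNIV. \<Sum>q\<in>UNIV. D l q *
        (\<Sum>a\<in>UNIV. \<Sum>b\<in>UNIV. s [i] [k] [j, p] [a, b] * s [a] [l] [b] [q])))"
      by (rule sum_swap_contract)
    also have "\<dots> = (\<Sum>i\<in>UNIV. \<Sum>j\<in>UNIV. c * ((if i = k then 1 else 0) * (E i j * D j p)))"
      unfolding R by (intro sum.cong refl) simp
    also have "\<dots> = (if k = p then c else 0)"
      by (simp add: sum_distrib_left[symmetric] ED sum_if_delta)
    finally show ?thesis .
  qed
  have 2: "z k m = c * E k m" for k m
  proof -
    have "(\<Sum>p\<in>UNIV. (\<Sum>l\<in>UNIV. z k l * D l p) * E p m) = (\<Sum>l\<in>UNIV. z k l * (\<Sum>p\<in>UNIV. D l p * E p m))"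
      unfolding sum_distrib_right sum_distrib_left by (subst sum.swap) (simp only: mult.assoc)
    then show ?thesis
      unfolding 1 by (simp add: DE sum_if_delta if_distrib[of "\<lambda>x. x * _"] cong: if_cong)
  qed
  \<comment> \<open>For c = 0 the contraction of s with E vanishes, and the convolution inverse t
    would recover E = 0 from it, against E D = 1.\<close>
  have "c \<noteq> 0"
  proof
    assume "c = 0"
    then have z: "(\<Sum>i\<in>UNIV. \<Sum>j\<in>UNIV. E i j * s [i] [k] [j] [l]) = 0" for k l
      using 2 by (simp add: z_def)
    have "E a b = 0" for a b
    proof -
      have "E a b = (\<Sum>i\<in>UNIV. \<Sum>j\<in>UNIV. E i j * (\<Sum>k\<in>UNIV. \<Sum>l\<in>UNIV. t [k] [a] [l] [b] * s [i] [k] [j] [l]))"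
      proof -
        have "(\<Sum>k\<in>UNIV. \<Sum>l\<in>UNIV. t [k] [a] [l] [b] * s [i] [k] [j] [l]) =
            (if i = a then 1 else 0) * (if j = b then 1 else 0)" for i j
          using inverse_right[of "[i]" "[a]" "[j]" "[b]"] by (simp add: sum_words_1 delta_def mult.commute)
        then show ?thesis
          by (simp add: mult.assoc[symmetric] sum_if_delta) (simp add: sum_if_delta mult.commute[of "E _ _"])?
      qed
      also have "\<dots> = 0"
        by (subst sum_swap_contract) (simp add: z)
      finally show ?thesis .
    qed
    then show False
      using ED[of undefined undefined] by simp
  qed
  then show thesis
    using that c 2 unfolding z_def by blast
qed

end

text \<open>\<open>take 1 J\<close> and \<open>drop 1 J\<close> stand for the first letter of J and
  the rest. For empty J the first pair of blocks has unequal lengths, where a balanced s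
  vanishes.\<close>

primrec twist :: "('n::finite, 'k::field) family2 \<Rightarrow> 'k \<Rightarrow> ('n, 'k) family" where
  "twist s c [] = (\<lambda>J. if J = [] then 1 else 0)"
| "twist s c (i # I) = (\<lambda>J. inverse c *
    (\<Sum>K\<in>words (length I). twist s c I K * s [i] (take 1 J) K (drop 1 J)))"

text \<open>The inverse of \<open>twist\<close>. Inversion reverses the order of the factors, which
  gives c t (1 \<otimes> \<kappa>) for the inverse t of s, so the recursion runs along the column
  word.\<close>

definition cotwist :: "('n::finite, 'k::field) family2 \<Rightarrow> 'k \<Rightarrow> ('n, 'k) family" where
  "cotwist t c = (\<lambda>I J. rec_list (\<lambda>I. if I = [] then 1 else 0)
    (\<lambda>j J f I. c * (\<Sum>K\<in>words (length J). t (take 1 I) [j] (drop 1 I) K * f K)) J I)"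

lemma cotwist_simps:
  "cotwist t c I [] = (if I = [] then 1 else 0)"
  "cotwist t c I (j # J) = c * (\<Sum>K\<in>words (length J). t (take 1 I) [j] (drop 1 I) K * cotwist t c K J)"
  by (simp_all add: cotwist_def)

text \<open>It is used as the first factor of \<open>tensor 1\<close>, where it sees words with at
  most one letter: c for a letter, 1 for none.\<close>

definition degree_scale :: "'k \<Rightarrow> ('n, 'k::field) family" where
  "degree_scale c = (\<lambda>I J. if I = J then if I = [] then 1 else c else 0)"

lemma balanced_degree_scale [simp]: "balanced (degree_scale c)"
  by (auto simp: balanced_def degree_scale_def)

lemma balanced_twist:
  assumes "balanced2 s"
  shows "balanced (twist s c)"
proof -
  have s: "length J \<noteq> Suc (length K) \<Longrightarrow> s [i] (take 1 J) K (drop 1 J) = 0" for i J K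
    using assms unfolding balanced2_def by (cases J) auto
  have "length I \<noteq> length J \<longrightarrow> twist s c I J = 0" for I J
  proof (induction I arbitrary: J)
    case (Cons i I)
    then show ?case
      by (auto simp: s intro!: sum.neutral simp del: One_nat_def)
  qed auto
  then show ?thesis
    by (simp add: balanced_def)
qed

lemma balanced_cotwist:
  assumes "balanced2 t"
  shows "balanced (cotwist t c)"
proof -
  have t: "length I \<noteq> Suc (length K) \<Longrightarrow> t (take 1 I) [j] (drop 1 I) K = 0" for j I K
    using assms unfolding balanced2_def by (cases I) auto
  have "length I \<noteq> length J \<longrightarrow> cotwist t c I J = 0" for I J
    by (cases J) (auto simp: cotwist_simps t intro!: sum.neutral simp del: One_nat_def)
  then show ?thesis
    by (simp add: balanced_def)
qed

lemma conv_degree_scale: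
  assumes "c \<noteq> 0"
  shows "conv (degree_scale (inverse c)) (degree_scale c) = delta"
    "conv (degree_scale c) (degree_scale (inverse c)) = delta"
proof -
  have *: "conv (degree_scale a) (degree_scale b) = delta" if "a * b = 1" for a b
  proof (intro ext)
    fix I J
    have "conv (degree_scale a) (degree_scale b) I J =
        (\<Sum>K\<in>words (length I). if K = I then degree_scale a I I * degree_scale b I J else 0)"
      unfolding conv_def by (intro sum.cong refl) (auto simp: degree_scale_def)
    then show "conv (degree_scale a) (degree_scale b) I J = delta I J"
      using that by (auto simp: degree_scale_def delta_def)
  qed
  show "conv (degree_scale (inverse c)) (degree_scale c) = delta"
    "conv (degree_scale c) (degree_scale (inverse c)) = delta"
    using assms by (simp_all add: *)
qed

text \<open>One identity of families, valid also at the empty word, where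
  \<open>degree_scale\<close> is 1 instead of \<open>inverse c\<close>. In this form associativity
  and the interchange law apply to the recursion.\<close>

lemma twist_rec:
  assumes "balanced2 s" "\<And>K L. s [] [] K L = delta K L"
  shows "twist s c = conv (tensor 1 (degree_scale (inverse c)) (twist s c)) (cut s 1)"
proof (intro ext)
  fix I J
  show "twist s c I J = conv (tensor 1 (degree_scale (inverse c)) (twist s c)) (cut s 1) I J"
  proof (cases I)
    case Nil
    then show ?thesis
      using assms(2)[of "[]" J] balancedD[OF balanced_cut[OF assms(1), of 1], of "[]" J]
      by (cases J) (auto simp: conv_def tensor_def cut_def degree_scale_def delta_def)
  next
    case (Cons i I')
    have "conv (tensor 1 (degree_scale (inverse c)) (twist s c)) (cut s 1) (i # I') J =
        (\<Sum>a\<in>UNIV. \<Sum>K\<in>words (length I'). tensor 1 (degree_scale (inverse c)) (twist s c) (i # I') (a # K)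
          * cut s 1 (a # K) J)"
      by (simp add: conv_def sum_words_Suc)
    also have "\<dots> = (\<Sum>a\<in>UNIV. if a = i then twist s c (i # I') J else 0)"
      by (intro sum.cong refl) (auto simp: tensor_def cut_def degree_scale_def sum_distrib_left mult.assoc)
    finally show ?thesis
      by (simp add: Cons)
  qed
qed

lemma cotwist_rec:
  assumes "balanced2 t" "\<And>K L. t [] [] K L = delta K L"
  shows "cotwist t c = conv (cut t 1) (tensor 1 (degree_scale c) (cotwist t c))"
proof (intro ext)
  fix I J
  show "cotwist t c I J = conv (cut t 1) (tensor 1 (degree_scale c) (cotwist t c)) I J"
  proof (cases "length I = length J")
    case True
    show ?thesis
    proof (cases J)
      case Nil
      then show ?thesis
        using assms(2)[of "[]" "[]"] True
        by (auto simp: conv_def tensor_def cut_def degree_scale_def delta_def cotwist_simps)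
    next
      case (Cons j J')
      have "conv (cut t 1) (tensor 1 (degree_scale c) (cotwist t c)) I (j # J') =
          (\<Sum>a\<in>UNIV. \<Sum>K\<in>words (length J'). cut t 1 I (a # K)
            * tensor 1 (degree_scale c) (cotwist t c) (a # K) (j # J'))"
        using True by (simp add: conv_def Cons sum_words_Suc)
      also have "\<dots> = (\<Sum>a\<in>UNIV. if a = j then cotwist t c I (j # J') else 0)"
        by (intro sum.cong refl)
          (auto simp: tensor_def cut_def degree_scale_def sum_distrib_left ac_simps cotwist_simps)
      finally show ?thesis
        by (simp add: Cons)
    qed
  next
    case False
    then show ?thesis
      using balanced_cotwist[OF assms(1)] by (simp add: balancedD)
  qed
qed

section \<open>Multiplicativity, invertibility, centrality and compatibility of the cochain\<close>

locale normalized_cocycle_family = lazy_cocycle_family E D s t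
  for E D :: "'n::finite \<Rightarrow> 'n \<Rightarrow> 'k::field" and s t +
  fixes c :: 'k
  assumes c: "c \<noteq> 0"
    and c_D: "(\<Sum>k\<in>UNIV. \<Sum>l\<in>UNIV. D k l * s [i] [k] [m] [l]) = c * c * D i m"
    and c_E: "(\<Sum>i\<in>UNIV. \<Sum>j\<in>UNIV. E i j * s [i] [k] [j] [l]) = c * c * E k l"
begin

abbreviation \<nu> :: "('n, 'k) family" where
  "\<nu> \<equiv> twist s c"

abbreviation \<kappa> :: "('n, 'k) family" where
  "\<kappa> \<equiv> cotwist t c"

lemma balanced_\<nu> [simp]: "balanced \<nu>"
  by (rule balanced_twist[OF s_bal])

lemma balanced_\<kappa> [simp]: "balanced \<kappa>"
  by (rule balanced_cotwist[OF t_bal])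

lemma cut_balanced [simp]: "balanced (cut s m)" "balanced (cut t m)"
  using s_bal t_bal by simp_all

lemma t_unit_left: "t [] [] K L = delta K L"
proof (cases "length K = length L")
  case True
  then show ?thesis
    using inverse_right[of "[]" "[]" K L]
    by (simp add: s_unit_left delta_def if_distrib[of "\<lambda>x. x * _"] cong: if_cong)
next
  case False
  then show ?thesis
    using t_bal by (auto simp: balanced2_def delta_def)
qed

lemmas \<nu>_rec = twist_rec[OF s_bal s_unit_left, of c]
lemmas \<kappa>_rec = cotwist_rec[OF t_bal t_unit_left, of c]

text \<open>Induction on m: peel off one letter by the recursion, split the rest by the induction
  hypothesis, and regroup the two cocycle factors by the cocycle identity with the cut after 1 + m
  letters.\<close>

lemma \<nu>_mult: "\<nu> = conv (tensor m \<nu> \<nu>) (cut s m)"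
proof (induction m)
  case 0
  have "tensor 0 \<nu> \<nu> = \<nu>" "cut s 0 = delta"
    by (auto simp: tensor_def cut_def s_unit_left)
  then show ?case
    by simp
next
  case (Suc m)
  let ?C = "degree_scale (inverse c)"
  have "\<nu> = conv (tensor 1 ?C \<nu>) (cut s 1)"
    by (rule \<nu>_rec)
  also have "tensor 1 ?C \<nu> = conv (tensor 1 ?C (tensor m \<nu> \<nu>)) (tensor 1 delta (cut s m))"
    unfolding conv_tensor Suc[symmetric] by simp
  \<comment> \<open>Since \<open>cut s m\<close> is central, the second tensor factor can be moved
    past \<open>cut s 1\<close>; this is the order of the factors in the cocycle identity.\<close>
  also have "conv \<dots> (cut s 1) =
      conv (tensor 1 ?C (tensor m \<nu> \<nu>)) (conv (cut s 1) (tensor 1 delta (cut s m)))"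
    unfolding conv_assoc central_commute_cut(2)[OF cut_central] ..
  also have "conv (cut s 1) (tensor 1 delta (cut s m)) = conv (cut s (1 + m)) (tensor (1 + m) (cut s 1) delta)"
    by (rule cut_cocycle[symmetric])
  \<comment> \<open>Moved to the left, \<open>cut s 1\<close> meets the factors from which the
    recursion rebuilds \<open>\<nu>\<close> on the first 1 + m letters.\<close>
  also have "\<dots> = conv (tensor (1 + m) (cut s 1) delta) (cut s (1 + m))"
    by (rule central_commute_cut(1)[OF cut_central, symmetric])
  also have "conv (tensor 1 ?C (tensor m \<nu> \<nu>)) \<dots> =
      conv (tensor (1 + m) (conv (tensor 1 ?C \<nu>) (cut s 1)) (conv \<nu> delta)) (cut s (1 + m))"
    unfolding conv_assoc[symmetric] tensor_assoc conv_tensor ..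
  also have "\<dots> = conv (tensor (Suc m) \<nu> \<nu>) (cut s (Suc m))"
    unfolding \<nu>_rec[symmetric] by simp
  finally show ?case .
qed

text \<open>In this order the factors \<open>cut s 1\<close> and \<open>cut t 1\<close> meet and
  cancel, then the scalars cancel; what remains is the product on one letter less.\<close>

lemma \<nu>_\<kappa>: "conv \<nu> \<kappa> = delta"
proof -
  have "conv \<nu> \<kappa> = conv (conv (tensor 1 (degree_scale (inverse c)) \<nu>) (cut s 1))
      (conv (cut t 1) (tensor 1 (degree_scale c) \<kappa>))"
    using \<nu>_rec \<kappa>_rec by (rule arg_cong2)
  also have "\<dots> = conv (tensor 1 (degree_scale (inverse c)) \<nu>)
      (conv (conv (cut s 1) (cut t 1)) (tensor 1 (degree_scale c) \<kappa>))"
    by (simp only: conv_assoc)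
  also have "\<dots> = tensor 1 delta (conv \<nu> \<kappa>)"
    by (simp add: cut_inverse conv_tensor conv_degree_scale c)
  finally have rec: "conv \<nu> \<kappa> = tensor 1 delta (conv \<nu> \<kappa>)" .
  have "conv \<nu> \<kappa> I J = delta I J" for I J
  proof (induction I arbitrary: J)
    case Nil
    show ?case
      by (cases J) (simp_all add: conv_def delta_def cotwist_simps(1) balancedD)
  next
    case (Cons i I)
    show ?case
      by (subst rec) (cases J, auto simp: tensor_def Cons.IH delta_def)
  qed
  then show ?thesis
    by (intro ext)
qed

text \<open>In this order the cuts stand outside. By induction on the length the inner product is
  the identity on shorter words, and only then do the cuts cancel.\<close>

lemma \<kappa>_\<nu>: "conv \<kappa> \<nu> = delta"
proof -
  have "conv \<kappa> \<nu> = conv (conv (cut t 1) (tensor 1 (degree_scale c) \<kappa>))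
      (conv (tensor 1 (degree_scale (inverse c)) \<nu>) (cut s 1))"
    using \<kappa>_rec \<nu>_rec by (rule arg_cong2)
  also have "\<dots> = conv (cut t 1) (conv (conv (tensor 1 (degree_scale c) \<kappa>)
      (tensor 1 (degree_scale (inverse c)) \<nu>)) (cut s 1))"
    by (simp only: conv_assoc)
  also have "\<dots> = conv (cut t 1) (conv (tensor 1 delta (conv \<kappa> \<nu>)) (cut s 1))"
    by (simp add: conv_tensor conv_degree_scale c)
  finally have rec: "conv \<kappa> \<nu> = conv (cut t 1) (conv (tensor 1 delta (conv \<kappa> \<nu>)) (cut s 1))" .
  have "length I = n \<Longrightarrow> conv \<kappa> \<nu> I J = delta I J" for I J n
  proof (induction n arbitrary: I J)
    case 0
    then show ?case
      by (cases J) (simp_all add: conv_def delta_def cotwist_simps(1) balancedD)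
  next
    case (Suc n)
    have "conv (tensor 1 delta (conv \<kappa> \<nu>)) (cut s 1) A J = cut s 1 A J" if "length A = Suc n" for A
    proof -
      have "conv (tensor 1 delta (conv \<kappa> \<nu>)) (cut s 1) A J = conv (tensor 1 delta delta) (cut s 1) A J"
        unfolding conv_tensor_delta_left using that by (intro sum.cong refl) (simp add: Suc.IH)
      then show ?thesis
        by simp
    qed
    then have "conv (cut t 1) (conv (tensor 1 delta (conv \<kappa> \<nu>)) (cut s 1)) I J = conv (cut t 1) (cut s 1) I J"
      using Suc.prems unfolding conv_def[of "cut t 1"] by (intro sum.cong refl) auto
    then show ?case
      by (subst rec) (simp only: cut_inverse)
  qed
  then show ?thesis
    by (intro ext) blast
qed

text \<open>In the recursion \<open>cut s 1\<close> is central, and the other factor commutes with F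
  by the induction hypothesis for the blocks of F with a frozen first letter; hence F varies in the
  induction.\<close>

lemma \<nu>_central: "central \<nu>"
proof -
  have "compatible F \<Longrightarrow> conv \<nu> F I J = conv F \<nu> I J" if "length I = n" "length J = n" for F I J n
    using that
  proof (induction n arbitrary: F I J)
    case 0
    then show ?case
      by (simp add: conv_def)
  next
    case (Suc n)
    let ?T = "tensor 1 (degree_scale (inverse c)) \<nu>"
    have T: "conv ?T F A B = conv F ?T A B" if "length A = Suc n" "length B = Suc n" for A B
    proof -
      \<comment> \<open>On nonempty words \<open>degree_scale\<close> is a scalar and can be pulled
        out.\<close>
      have scale: "?T K L = inverse c * tensor 1 delta \<nu> K L" if "length K = Suc n" for K L
        using that by (cases K) (auto simp: tensor_def degree_scale_def delta_def)
      have "conv ?T F A B = inverse c * conv (tensor 1 delta \<nu>) F A B"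
        unfolding conv_def sum_distrib_left by (simp only: scale[OF that(1)] mult.assoc)
      also have "conv (tensor 1 delta \<nu>) F A B =
          conv \<nu> (\<lambda>I J. F (take 1 A @ I) (take 1 B @ J)) (drop 1 A) (drop 1 B)"
        unfolding conv_tensor_delta_left by (simp add: conv_def)
      also have "\<dots> = conv (\<lambda>I J. F (take 1 A @ I) (take 1 B @ J)) \<nu> (drop 1 A) (drop 1 B)"
        using that Suc.prems(1) by (intro Suc.IH compatible_prefix) auto
      also have "\<dots> = conv F (tensor 1 delta \<nu>) A B"
        using that by (subst conv_tensor_delta_right) (simp_all add: conv_def)
      also have "inverse c * \<dots> = conv F ?T A B"
        using that unfolding conv_def sum_distrib_left
        by (intro sum.cong refl) (simp only: in_words scale mult.left_commute)
      finally show ?thesis .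
    qed
    have "conv \<nu> F I J = conv ?T (conv (cut s 1) F) I J"
      by (subst \<nu>_rec) (simp only: conv_assoc)
    also have "\<dots> = conv (conv ?T F) (cut s 1) I J"
      by (simp only: conv_assoc centralD[OF cut_central Suc.prems(1)])
    also have "\<dots> = conv (conv F ?T) (cut s 1) I J"
      using Suc.prems T unfolding conv_def[of _ "cut s 1"] by (intro sum.cong refl) auto
    also have "\<dots> = conv F \<nu> I J"
      by (subst (2) \<nu>_rec) (simp only: conv_assoc)
    finally show ?case .
  qed
  moreover have "conv \<nu> F I J = conv F \<nu> I J" if "compatible F" "length I \<noteq> length J" for F I J
    using that by (simp add: balancedD compatible_balanced)
  ultimately show ?thesis
    unfolding central_def by (intro conjI allI impI ext balanced_\<nu>) metis
qed

text \<open>Each letter contributes \<open>inverse c\<close>. The resulting factor is the inverse of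
  the scalar by which s acts on D and E, so \<open>\<nu>\<close> fixes both.\<close>

lemma \<nu>_pair: "\<nu> [i, j] [k, l] = inverse (c * c) * s [i] [k] [j] [l]"
  by (simp add: sum_words_1 sum_if_delta s_unit_right delta_def mult.assoc sum_distrib_left[symmetric])

lemma \<nu>_append:
  assumes "length I = length J" "length K = length L"
  shows "\<nu> (I @ K) (J @ L) = (\<Sum>P\<in>words (length I). \<Sum>Q\<in>words (length K). \<nu> I P * \<nu> K Q * s P J Q L)"
proof -
  have "\<nu> (I @ K) (J @ L) = conv (tensor (length I) \<nu> \<nu>) (cut s (length I)) (I @ K) (J @ L)"
    using \<nu>_mult[of "length I"] by (rule fun_cong[OF fun_cong])
  also have "\<dots> = (\<Sum>P\<in>words (length I). \<Sum>Q\<in>words (length K). \<nu> I P * \<nu> K Q * s P J Q L)"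
    using assms by (simp add: conv_cut_right) (simp add: tensor_def)
  finally show ?thesis .
qed

text \<open>\<open>\<nu>_append\<close> splits off the words around a pair. On the pair itself
  \<open>\<nu>\<close> fixes D and E by the normalization, and the remaining cocycle factors absorb
  the pair because s is compatible in each argument.\<close>

lemma \<nu>_compatible: "compatible \<nu>"
proof (rule compatibleI_pair)
  have pair: "(\<Sum>K\<in>words (Suc (Suc j)). h K) = (\<Sum>Q\<in>words j. \<Sum>a\<in>UNIV. \<Sum>b\<in>UNIV. h (a # b # Q))"
    for h :: "'n list \<Rightarrow> 'k" and j
    using sum_words_pair[where i = 0] by simp
  fix I J I' J' :: "'n list" and k j
  assume len: "length I = length J" "length I' = length J'"
  show "(\<Sum>l\<in>UNIV. \<Sum>m\<in>UNIV. E l m * \<nu> (I @ l # m # I') (J @ k # j # J')) = E k j * \<nu> (I @ I') (J @ J')"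
  proof -
    \<comment> \<open>First a pair at the beginning of the word, where only compatibility in the
      first argument of s enters. The prefix I is added afterwards and uses the second
      argument.\<close>
    have 1: "(\<Sum>l\<in>UNIV. \<Sum>m\<in>UNIV. E l m * \<nu> (l # m # I') (a # b # Q)) = E a b * \<nu> I' Q"
      if Q: "length Q = length I'" for a b Q
    proof -
      have "(\<Sum>l\<in>UNIV. \<Sum>m\<in>UNIV. E l m * \<nu> (l # m # I') (a # b # Q)) =
          (\<Sum>l\<in>UNIV. \<Sum>m\<in>UNIV. E l m * (\<Sum>p\<in>UNIV. \<Sum>q\<in>UNIV.
            (\<Sum>R\<in>words (length I'). \<nu> I' R * s [p, q] [a, b] R Q) * \<nu> [l, m] [p, q]))"
        using \<nu>_append[of "[_, _]" "[a, b]" I' Q] Q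
        by (simp add: sum_words_Suc sum_distrib_right sum_distrib_left ac_simps del: twist.simps)
      also have "\<dots> = (\<Sum>p\<in>UNIV. \<Sum>q\<in>UNIV. (\<Sum>R\<in>words (length I'). \<nu> I' R * s [p, q] [a, b] R Q)
          * (\<Sum>l\<in>UNIV. \<Sum>m\<in>UNIV. E l m * \<nu> [l, m] [p, q]))"
        by (rule sum_swap_contract[symmetric])
      also have "\<dots> = (\<Sum>p\<in>UNIV. \<Sum>q\<in>UNIV. (\<Sum>R\<in>words (length I'). \<nu> I' R * s [p, q] [a, b] R Q) * E p q)"
      proof -
        have "(\<Sum>l\<in>UNIV. \<Sum>m\<in>UNIV. E l m * \<nu> [l, m] [p, q]) = E p q" for p q
          unfolding \<nu>_pair mult.left_commute[of _ "inverse (c * c)"] sum_distrib_left[symmetric] c_E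
          using c by (simp add: field_simps)
        then show ?thesis
          by simp
      qed
      also have "\<dots> = (\<Sum>R\<in>words (length I'). \<nu> I' R * (\<Sum>p\<in>UNIV. \<Sum>q\<in>UNIV. E p q * s [p, q] [a, b] R Q))"
        unfolding sum_distrib_right sum_distrib_left sum_swap3[where A = "words _"] by (simp only: ac_simps)
      also have "\<dots> = E a b * \<nu> I' Q"
        using compatible_E[OF s_left, of _ Q "[]" "[]" "[]" "[]" a b] Q
        by (simp add: s_unit_left delta_def sum_if_delta mult.left_commute if_distrib[of "\<lambda>x. _ * x"] cong: if_cong del: twist.simps)
      finally show ?thesis .
    qed
    have "(\<Sum>l\<in>UNIV. \<Sum>m\<in>UNIV. E l m * \<nu> (I @ l # m # I') (J @ k # j # J')) =
        (\<Sum>l\<in>UNIV. \<Sum>m\<in>UNIV. \<Sum>P\<in>words (length I). \<Sum>Q\<in>words (Suc (Suc (length I'))).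
          E l m * (\<nu> I P * \<nu> (l # m # I') Q * s P J Q (k # j # J')))"
      using len \<nu>_append[of I J "_ # _ # I'" "k # j # J'"] by (simp add: sum_distrib_left del: twist.simps)
    also have "\<dots> = (\<Sum>P\<in>words (length I). \<Sum>Q\<in>words (Suc (Suc (length I'))).
        \<nu> I P * (\<Sum>l\<in>UNIV. \<Sum>m\<in>UNIV. E l m * \<nu> (l # m # I') Q) * s P J Q (k # j # J'))"
      unfolding sum_swap3[where A = "words _"] sum_distrib_right sum_distrib_left by (simp only: ac_simps)
    also have "\<dots> = (\<Sum>P\<in>words (length I). \<Sum>Q\<in>words (length I').
        \<nu> I P * \<nu> I' Q * (\<Sum>a\<in>UNIV. \<Sum>b\<in>UNIV. E a b * s P J (a # b # Q) (k # j # J')))"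
      unfolding pair sum_distrib_left[of "\<nu> _ _ * \<nu> _ _"]
      by (intro sum.cong refl) (simp add: 1 ac_simps del: twist.simps)
    also have "\<dots> = (\<Sum>P\<in>words (length I). \<Sum>Q\<in>words (length I'). \<nu> I P * \<nu> I' Q * (E k j * s P J Q J'))"
      using compatible_E[OF s_right, of _ J "[]" "[]" _ J' k j] len
      by (intro sum.cong refl arg_cong2[where f = "(*)"]) auto
    also have "\<dots> = E k j * \<nu> (I @ I') (J @ J')"
      by (simp add: \<nu>_append[OF len] sum_distrib_left ac_simps del: twist.simps)
    finally show ?thesis .
  qed
  show "(\<Sum>l\<in>UNIV. \<Sum>m\<in>UNIV. D l m * \<nu> (I @ k # j # I') (J @ l # m # J')) = D k j * \<nu> (I @ I') (J @ J')"
  proof -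
    have 1: "(\<Sum>a\<in>UNIV. \<Sum>b\<in>UNIV. D a b * \<nu> (k # j # I') (a # b # Q)) = D k j * \<nu> I' Q"
      if Q: "length Q = length I'" for Q
    proof -
      have "(\<Sum>a\<in>UNIV. \<Sum>b\<in>UNIV. D a b * \<nu> (k # j # I') (a # b # Q)) =
          (\<Sum>a\<in>UNIV. \<Sum>b\<in>UNIV. D a b * (\<Sum>p\<in>UNIV. \<Sum>q\<in>UNIV.
            \<nu> [k, j] [p, q] * (\<Sum>R\<in>words (length I'). \<nu> I' R * s [p, q] [a, b] R Q)))"
        using \<nu>_append[of "[k, j]" "[_, _]" I' Q] Q
        by (simp add: sum_words_Suc sum_distrib_right sum_distrib_left ac_simps del: twist.simps)
      also have "\<dots> = (\<Sum>p\<in>UNIV. \<Sum>q\<in>UNIV. \<nu> [k, j] [p, q] *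
          (\<Sum>a\<in>UNIV. \<Sum>b\<in>UNIV. D a b * (\<Sum>R\<in>words (length I'). \<nu> I' R * s [p, q] [a, b] R Q)))"
        by (rule sum_swap_contract[symmetric])
      also have "\<dots> = (\<Sum>p\<in>UNIV. \<Sum>q\<in>UNIV. \<nu> [k, j] [p, q] * (D p q * \<nu> I' Q))"
      proof -
        have "(\<Sum>a\<in>UNIV. \<Sum>b\<in>UNIV. D a b * (\<Sum>R\<in>words (length I'). \<nu> I' R * s [p, q] [a, b] R Q)) =
          (\<Sum>R\<in>words (length I'). \<nu> I' R * (\<Sum>a\<in>UNIV. \<Sum>b\<in>UNIV. D a b * s [p, q] [a, b] R Q))" for p q
          unfolding sum_distrib_right sum_distrib_left sum_swap3[where A = "words _"] by (simp only: ac_simps)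
        also have "\<dots> p q = D p q * \<nu> I' Q" for p q
          using compatible_D[OF s_left, of _ Q "[]" "[]" "[]" "[]" p q] Q
          by (simp add: s_unit_left delta_def sum_if_delta mult.left_commute if_distrib[of "\<lambda>x. _ * x"] cong: if_cong del: twist.simps)
        finally show ?thesis
          by simp
      qed
      also have "\<dots> = (\<Sum>p\<in>UNIV. \<Sum>q\<in>UNIV. D p q * s [k] [p] [j] [q]) * (inverse (c * c) * \<nu> I' Q)"
        unfolding \<nu>_pair sum_distrib_right by (simp only: ac_simps)
      also have "\<dots> = D k j * \<nu> I' Q"
        unfolding c_D using c by (simp add: field_simps del: twist.simps)
      finally show ?thesis .
    qed
    have "(\<Sum>l\<in>UNIV. \<Sum>m\<in>UNIV. D l m * \<nu> (I @ k # j # I') (J @ l # m # J')) =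
        (\<Sum>l\<in>UNIV. \<Sum>m\<in>UNIV. \<Sum>P\<in>words (length I). \<Sum>Q\<in>words (Suc (Suc (length I'))).
          D l m * (\<nu> I P * \<nu> (k # j # I') Q * s P J Q (l # m # J')))"
      using len \<nu>_append[of I J "k # j # I'" "_ # _ # J'"] by (simp add: sum_distrib_left del: twist.simps)
    also have "\<dots> = (\<Sum>P\<in>words (length I). \<Sum>Q\<in>words (Suc (Suc (length I'))).
        \<nu> I P * \<nu> (k # j # I') Q * (\<Sum>l\<in>UNIV. \<Sum>m\<in>UNIV. D l m * s P J Q (l # m # J')))"
      unfolding sum_swap3[where A = "words _"] sum_distrib_right sum_distrib_left by (simp only: ac_simps)
    also have "\<dots> = (\<Sum>P\<in>words (length I). \<Sum>Q\<in>words (length I'). \<nu> I P * s P J Q J' *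
        (\<Sum>a\<in>UNIV. \<Sum>b\<in>UNIV. D a b * \<nu> (k # j # I') (a # b # Q)))"
      unfolding pair sum_distrib_left[of "\<nu> _ _ * s _ _ _ _"]
      using compatible_D[OF s_right, of _ J "[]" "[]" _ J'] len
      by (intro sum.cong refl) (auto simp: ac_simps simp del: twist.simps)
    also have "\<dots> = D k j * \<nu> (I @ I') (J @ J')"
      by (simp add: 1 \<nu>_append[OF len] sum_distrib_left ac_simps del: twist.simps)
    finally show ?thesis .
  qed
qed simp

text \<open>Solving \<open>\<nu>_mult\<close> for the cocycle puts the inverse
  \<open>\<kappa>\<close> in front of \<open>\<nu>\<close>. A coboundary has the functional on its
  two arguments and the inverse on their product, so \<open>\<kappa>\<close> is the functional to
  take.\<close>

lemma trivialization:
  "compatible \<kappa> \<and> central \<kappa> \<and> conv \<nu> \<kappa> = delta \<and> conv \<kappa> \<nu> = delta \<and> \<kappa> [] [] = 1 \<and>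
    (\<forall>m. cut s m = conv (tensor m \<kappa> \<kappa>) \<nu>)"
proof (intro conjI allI)
  show "compatible \<kappa>"
    by (rule compatible_inverse[OF \<nu>_compatible balanced_\<kappa> \<nu>_\<kappa> \<kappa>_\<nu>])
  show "central \<kappa>"
    by (rule central_inverse[OF \<nu>_central balanced_\<kappa> \<nu>_\<kappa> \<kappa>_\<nu>])
  fix m
  have "conv (tensor m \<kappa> \<kappa>) \<nu> = conv (tensor m \<kappa> \<kappa>) (conv (tensor m \<nu> \<nu>) (cut s m))"
    using \<nu>_mult by (rule arg_cong)
  also have "\<dots> = cut s m"
    by (simp add: conv_assoc[symmetric] conv_tensor \<kappa>_\<nu>)
  finally show "cut s m = conv (tensor m \<kappa> \<kappa>) \<nu>" ..
qed (simp_all add: \<nu>_\<kappa> \<kappa>_\<nu> cotwist_simps)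

end

section \<open>Linear functionals on finitely supported functions\<close>

definition lin :: "('x \<Rightarrow> 'k) \<Rightarrow> ('x \<Rightarrow>\<^sub>0 'k) \<Rightarrow> 'k::field" where
  "lin g f = (\<Sum>x\<in>Poly_Mapping.keys f. Poly_Mapping.lookup f x * g x)"

lemma lin_superset:
  assumes "finite A" "Poly_Mapping.keys f \<subseteq> A"
  shows "lin g f = (\<Sum>x\<in>A. Poly_Mapping.lookup f x * g x)"
  unfolding lin_def using assms by (intro sum.mono_neutral_left) (auto simp: in_keys_iff)

lemma lin_add [simp]: "lin g (f + f') = lin g f + lin g f'"
proof -
  let ?A = "Poly_Mapping.keys f \<union> Poly_Mapping.keys f'"
  have "lin g h = (\<Sum>x\<in>?A. Poly_Mapping.lookup h x * g x)" if "Poly_Mapping.keys h \<subseteq> ?A" for h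
    using that by (intro lin_superset) auto
  from this[of f] this[of f'] this[of "f + f'"] show ?thesis
    using Poly_Mapping.keys_add[of f f'] by (simp add: lookup_add distrib_right sum.distrib)
qed

lemma lookup_scale_pm [simp]: "Poly_Mapping.lookup (scale_pm c f) x = c * Poly_Mapping.lookup f x"
  unfolding scale_pm_def by transfer (simp add: when_def)

lemma lin_scale [simp]: "lin g (scale_pm c f) = c * lin g f"
proof -
  have "Poly_Mapping.keys (scale_pm c f) \<subseteq> Poly_Mapping.keys f"
    by (auto simp: in_keys_iff)
  from lin_superset[OF _ this] show ?thesis
    by (simp add: lin_def sum_distrib_left mult.assoc)
qed

lemma lin_zero [simp]: "lin g 0 = 0"
  by (simp add: lin_def)

lemma lin_single [simp]: "lin g (Poly_Mapping.single x c) = c * g x"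
  by (simp add: lin_def)

lemma lin_uminus [simp]: "lin g (- f) = - lin g f"
  using lin_add[of g "- f" f] by (simp add: eq_neg_iff_add_eq_0)

lemma lin_diff [simp]: "lin g (f - f') = lin g f - lin g f'"
  using lin_add[of g f "- f'"] by simp

lemma lin_sum: "lin g (sum f A) = (\<Sum>a\<in>A. lin g (f a))"
  by (induction A rule: infinite_finite_induct) simp_all

lemma lin_fun_cong: "(\<And>x. x \<in> Poly_Mapping.keys f \<Longrightarrow> g x = h x) \<Longrightarrow> lin g f = lin h f"
  by (simp add: lin_def)

lemma poly_mapping_expand: "f = (\<Sum>x\<in>Poly_Mapping.keys f. Poly_Mapping.single x (Poly_Mapping.lookup f x))"
  by (rule poly_mapping_eqI) (simp add: lookup_sum lookup_single when_def in_keys_iff)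

interpretation pm: vector_space "scale_pm :: 'k::field \<Rightarrow> ('x \<Rightarrow>\<^sub>0 'k) \<Rightarrow> _"
  by unfold_locales (auto intro!: poly_mapping_eqI simp: lookup_add algebra_simps)

interpretation pm_dual: vector_space_pair "scale_pm :: 'k::field \<Rightarrow> ('x \<Rightarrow>\<^sub>0 'k) \<Rightarrow> _" "(*) :: 'k \<Rightarrow> 'k \<Rightarrow> 'k"
  by unfold_locales (auto simp: algebra_simps)

lemma lin_span:
  assumes "f \<in> pm.span S" "\<And>s. s \<in> S \<Longrightarrow> lin g s = 0"
  shows "lin g f = 0"
  using assms(1) by (induction rule: pm.span_induct_alt) (simp_all add: assms(2))

text \<open>A vector outside the span can be added to a basis of it, and its coordinate function
  separates it from the span. Membership in tensor relations and in the ideal of the algebra is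
  decided by this test.\<close>

lemma in_span_iff:
  fixes f :: "'x \<Rightarrow>\<^sub>0 'k::field"
  shows "f \<in> pm.span S \<longleftrightarrow> (\<forall>g. (\<forall>s\<in>S. lin g s = 0) \<longrightarrow> lin g f = 0)"
proof (intro iffI allI impI)
  assume *: "\<forall>g. (\<forall>s\<in>S. lin g s = 0) \<longrightarrow> lin g f = 0"
  show "f \<in> pm.span S"
  proof (rule ccontr)
    assume f: "f \<notin> pm.span S"
    obtain B where B: "B \<subseteq> S" "pm.independent B" "S \<subseteq> pm.span B"
      using pm.maximal_independent_subset by blast
    then have "f \<notin> pm.span B"
      using f pm.span_mono by blast
    then have "pm.independent (insert f B)"
      using B(2) by (rule pm.independent_insertI)
    then obtain \<phi> where \<phi>: "Vector_Spaces.linear scale_pm (*) \<phi>"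
      "\<forall>x\<in>insert f B. \<phi> x = (if x = f then 1 else 0)"
      using pm_dual.linear_independent_extend[of "insert f B" "\<lambda>x. if x = f then 1 else 0"] by blast
    define g where "g = (\<lambda>x. \<phi> (Poly_Mapping.single x 1))"
    have \<phi>_lin: "\<phi> h = lin g h" for h
    proof -
      have "Poly_Mapping.single x c = scale_pm c (Poly_Mapping.single x 1)" for x and c :: 'k
        by (simp add: scale_pm_def)
      then have "\<phi> (Poly_Mapping.single x c) = c * g x" for x c
        by (metis \<phi>(1) g_def pm_dual.linear_scale)
      then show ?thesis
        by (subst poly_mapping_expand) (simp add: pm_dual.linear_sum[OF \<phi>(1)] lin_def)
    qed
    have "\<phi> s = 0" if "s \<in> S" for s
    proof -
      have "\<phi> b = 0" if "b \<in> B" for b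
        using that \<phi>(2) \<open>f \<notin> pm.span B\<close> pm.span_base by (metis insertCI)
      then show ?thesis
        using B(3) that pm_dual.linear_eq_0_on_span[OF \<phi>(1)] by blast
    qed
    then have "lin g f = 0"
      using * \<phi>_lin by simp
    then show False
      using \<phi>(2) by (simp add: \<phi>_lin[symmetric])
  qed
qed (use lin_span in blast)

lemma induced_eq:
  assumes "x \<in> S" "\<And>y. y \<in> S \<Longrightarrow> f y = f x"
  shows "induced f S = f x"
proof -
  have "f ` S = {f x}"
    using assms by blast
  then show ?thesis
    by (simp add: induced_def)
qed

section \<open>Tensor products\<close>

definition bilinear_on ::
  "('k::field, 'h, 'm) module_scheme \<Rightarrow> ('k, 'g, 'n) module_scheme \<Rightarrow> ('h \<Rightarrow> 'g \<Rightarrow> 'k) \<Rightarrow> bool" where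
  "bilinear_on M N b \<longleftrightarrow>
     (\<forall>x\<in>carrier M. \<forall>x'\<in>carrier M. \<forall>y\<in>carrier N. b (x \<oplus>\<^bsub>M\<^esub> x') y = b x y + b x' y) \<and>
     (\<forall>x\<in>carrier M. \<forall>y\<in>carrier N. \<forall>y'\<in>carrier N. b x (y \<oplus>\<^bsub>N\<^esub> y') = b x y + b x y') \<and>
     (\<forall>c. \<forall>x\<in>carrier M. \<forall>y\<in>carrier N. b (c \<odot>\<^bsub>M\<^esub> x) y = c * b x y) \<and>
     (\<forall>c. \<forall>x\<in>carrier M. \<forall>y\<in>carrier N. b x (c \<odot>\<^bsub>N\<^esub> y) = c * b x y)"

abbreviation lin2 :: "('h \<Rightarrow> 'g \<Rightarrow> 'k::field) \<Rightarrow> ('h \<times> 'g \<Rightarrow>\<^sub>0 'k) \<Rightarrow> 'k" where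
  "lin2 b \<equiv> lin (\<lambda>p. b (fst p) (snd p))"

lemma lin_relators_iff:
  fixes g :: "'h \<times> 'g \<Rightarrow> 'k::field"
  shows "(\<forall>r\<in>tensor_relators M N. lin g r = 0) \<longleftrightarrow> bilinear_on M N (\<lambda>x y. g (x, y))"
proof -
  have ball: "(\<forall>r\<in>{h x y z |x y z. P x y z}. Q r) \<longleftrightarrow> (\<forall>x y z. P x y z \<longrightarrow> Q (h x y z))" for h P Q
    by blast
  have diff: "a - b - c = 0 \<longleftrightarrow> a = b + c" for a b c :: 'k
    by (auto simp: algebra_simps)
  have ball3: "(\<forall>x y z. x \<in> A \<and> y \<in> B \<and> z \<in> C \<longrightarrow> Q x y z) \<longleftrightarrow> (\<forall>x\<in>A. \<forall>y\<in>B. \<forall>z\<in>C. Q x y z)" for A B C Q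
    by blast
  have ball2: "(\<forall>c x y. x \<in> A \<and> y \<in> B \<longrightarrow> Q c x y) \<longleftrightarrow> (\<forall>c. \<forall>x\<in>A. \<forall>y\<in>B. Q c x y)" for A B Q
    by blast
  show ?thesis
    unfolding tensor_relators_def bilinear_on_def ball_Un ball ball3 ball2 conj_assoc
    by (simp only: lin_diff lin_single mult_1_left diff, simp only: right_minus_eq)
qed

text \<open>The functionals that kill the relators are exactly the bilinear forms, so these separate
  the classes.\<close>

lemma tensor_class_eq_iff:
  "tensor_class M N f = tensor_class M N g \<longleftrightarrow> (\<forall>b. bilinear_on M N b \<longrightarrow> lin2 b f = lin2 b g)"
proof -
  have "tensor_class M N f = tensor_class M N g \<longleftrightarrow> f - g \<in> pm.span (tensor_relators M N)"
  proof
    assume "tensor_class M N f = tensor_class M N g"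
    moreover have "f \<in> tensor_class M N f"
      by (simp add: tensor_class_def pm.span_zero)
    ultimately show "f - g \<in> pm.span (tensor_relators M N)"
      by (simp add: tensor_class_def)
  next
    assume *: "f - g \<in> pm.span (tensor_relators M N)"
    have "h - f \<in> pm.span (tensor_relators M N) \<longleftrightarrow> h - g \<in> pm.span (tensor_relators M N)" for h
      using pm.span_add[OF _ *, of "h - f"] pm.span_diff[OF _ *, of "h - g"] by auto
    then show "tensor_class M N f = tensor_class M N g"
      by (simp add: tensor_class_def)
  qed
  also have "\<dots> \<longleftrightarrow> (\<forall>h. bilinear_on M N (\<lambda>x y. h (x, y)) \<longrightarrow> lin h (f - g) = 0)"
    by (simp only: in_span_iff lin_relators_iff)
  also have "\<dots> \<longleftrightarrow> (\<forall>b. bilinear_on M N b \<longrightarrow> lin2 b f = lin2 b g)"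
  proof (intro iffI allI impI)
    fix b
    assume *: "\<forall>h. bilinear_on M N (\<lambda>x y. h (x, y)) \<longrightarrow> lin h (f - g) = 0" and "bilinear_on M N b"
    then show "lin2 b f = lin2 b g"
      using *[rule_format, of "\<lambda>p. b (fst p) (snd p)"] by simp
  next
    fix h :: "'a \<times> 'b \<Rightarrow> 'c"
    assume *: "\<forall>b. bilinear_on M N b \<longrightarrow> lin2 b f = lin2 b g" and "bilinear_on M N (\<lambda>x y. h (x, y))"
    then show "lin h (f - g) = 0"
      using *[rule_format, of "\<lambda>x y. h (x, y)"] by simp
  qed
  finally show ?thesis .
qed

lemma mem_tensor_class: "f \<in> tensor_class M N f"
  by (simp add: tensor_class_def pm.span_zero)

lemma mem_tensor_classD:
  assumes "g \<in> tensor_class M N f"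
  shows "tensor_class M N g = tensor_class M N f"
proof -
  have *: "g - f \<in> pm.span (tensor_relators M N)"
    using assms by (simp add: tensor_class_def)
  have "h - g \<in> pm.span (tensor_relators M N) \<longleftrightarrow> h - f \<in> pm.span (tensor_relators M N)" for h
    using pm.span_add[OF _ *, of "h - g"] pm.span_diff[OF _ *, of "h - f"] by auto
  then show ?thesis
    by (simp add: tensor_class_def)
qed

lemma lin2_tensor_class:
  assumes "bilinear_on M N b" "g \<in> tensor_class M N f"
  shows "lin2 b g = lin2 b f"
  using mem_tensor_classD[OF assms(2)] assms(1) by (simp add: tensor_class_eq_iff)

abbreviation supported :: "('k, 'h, 'm) module_scheme \<Rightarrow> ('h \<times> 'h \<Rightarrow>\<^sub>0 'k::field) \<Rightarrow> bool" where
  "supported M f \<equiv> Poly_Mapping.keys f \<subseteq> carrier M \<times> carrier M"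

locale linear_ring = ring M for M :: "('k::field, 'h, 'm) module_scheme" (structure) +
  assumes smult_closed [simp, intro]: "x \<in> carrier M \<Longrightarrow> c \<odot> x \<in> carrier M"
    and smult_left: "x \<in> carrier M \<Longrightarrow> y \<in> carrier M \<Longrightarrow> (c \<odot> x) \<otimes> y = c \<odot> (x \<otimes> y)"
    and smult_right: "x \<in> carrier M \<Longrightarrow> y \<in> carrier M \<Longrightarrow> x \<otimes> (c \<odot> y) = c \<odot> (x \<otimes> y)"
begin

lemma supported_add: "supported M f \<Longrightarrow> supported M g \<Longrightarrow> supported M (f + g)"
  using Poly_Mapping.keys_add[of f g] by blast

lemma supported_scale: "supported M f \<Longrightarrow> supported M (scale_pm c f)"
  by (auto simp: in_keys_iff)

text \<open>Formal tensors may use arbitrary elements of the type, but relators have their support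
  in the carrier. Hence every representative of a supported class is supported, as maps defined by
  \<open>induced\<close> require.\<close>

lemma supported_class:
  assumes "supported M f" "g \<in> tensor_class M M f"
  shows "supported M g"
proof -
  have iff: "supported M r \<longleftrightarrow> (\<forall>p. p \<notin> carrier M \<times> carrier M \<longrightarrow> Poly_Mapping.lookup r p = 0)"
    for r :: "'h \<times> 'h \<Rightarrow>\<^sub>0 'k"
    by (auto simp: in_keys_iff)
  have relators: "tensor_relators M M \<subseteq> {r. supported M r}"
    unfolding tensor_relators_def iff by (auto simp: lookup_minus lookup_single when_def)
  have sub: "pm.subspace {r. supported M r}"
    by (rule pm.subspaceI) (simp_all add: supported_add supported_scale)
  have "g - f \<in> {r. supported M r}"
    using assms(2) pm.span_minimal[OF relators sub] by (auto simp: tensor_class_def)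
  then have "supported M ((g - f) + f)"
    using assms(1) by (intro supported_add) auto
  then show ?thesis
    by simp
qed

abbreviation T :: "('k, ('h \<times> 'h \<Rightarrow>\<^sub>0 'k) set) module" where
  "T \<equiv> tensor_product M M"

abbreviation cls :: "('h \<times> 'h \<Rightarrow>\<^sub>0 'k) \<Rightarrow> ('h \<times> 'h \<Rightarrow>\<^sub>0 'k) set" where
  "cls \<equiv> tensor_class M M"

lemma T_carrier: "carrier T = cls ` {f. supported M f}"
  by (simp add: tensor_product_def)

lemma T_zero: "\<zero>\<^bsub>T\<^esub> = cls 0"
  by (simp add: tensor_product_def)

lemma T_one: "\<one>\<^bsub>T\<^esub> = cls (Poly_Mapping.single (\<one>, \<one>) 1)"
  by (simp add: tensor_product_def pure_tensor_def)

lemma T_add: "cls f \<oplus>\<^bsub>T\<^esub> cls g = cls (f + g)"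
proof -
  have "induced (\<lambda>(f, g). cls (f + g)) (cls f \<times> cls g) = (\<lambda>(f, g). cls (f + g)) (f, g)"
    by (rule induced_eq) (clarsimp simp: mem_tensor_class tensor_class_eq_iff lin2_tensor_class)+
  then show ?thesis
    by (simp add: tensor_product_def)
qed

lemma T_smult: "c \<odot>\<^bsub>T\<^esub> cls f = cls (scale_pm c f)"
proof -
  have "induced (\<lambda>f. cls (scale_pm c f)) (cls f) = cls (scale_pm c f)"
    by (rule induced_eq) (clarsimp simp: mem_tensor_class tensor_class_eq_iff lin2_tensor_class)+
  then show ?thesis
    by (simp add: tensor_product_def)
qed

lemma lin2_formal_tensor_mult:
  "lin2 b (formal_tensor_mult M M f g) =
    lin2 (\<lambda>x y. lin2 (\<lambda>x' y'. b (x \<otimes> x') (y \<otimes> y')) g) f"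
  unfolding formal_tensor_mult_def lin_sum lin_single fst_conv snd_conv unfolding lin_def sum_distrib_left
  by (simp only: mult.assoc)

lemma lin2_formal_tensor_mult':
  "lin2 b (formal_tensor_mult M M f g) =
    lin2 (\<lambda>x' y'. lin2 (\<lambda>x y. b (x \<otimes> x') (y \<otimes> y')) f) g"
  unfolding formal_tensor_mult_def lin_sum lin_single fst_conv snd_conv unfolding lin_def sum_distrib_left
  by (subst sum.swap) (simp only: ac_simps)

text \<open>The representatives are exchanged one factor at a time: with one pair of carrier
  elements fixed, a bilinear form of the products is bilinear in the other pair.\<close>

lemma T_mult:
  assumes "supported M f" "supported M g"
  shows "cls f \<otimes>\<^bsub>T\<^esub> cls g = cls (formal_tensor_mult M M f g)"
proof -
  have "induced (\<lambda>(f, g). cls (formal_tensor_mult M M f g)) (cls f \<times> cls g) =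
      (\<lambda>(f, g). cls (formal_tensor_mult M M f g)) (f, g)"
  proof (rule induced_eq, goal_cases)
    case (2 y)
    then obtain f' g' where y: "y = (f', g')" and f': "f' \<in> cls f" and g': "g' \<in> cls g"
      by blast
    have "lin2 b (formal_tensor_mult M M f' g') = lin2 b (formal_tensor_mult M M f g)"
      if b: "bilinear_on M M b" for b
    proof -
      have 1: "bilinear_on M M (\<lambda>x y. b (x \<otimes> x') (y \<otimes> y'))" if "x' \<in> carrier M" "y' \<in> carrier M" for x' y'
        using that b unfolding bilinear_on_def by (auto simp: l_distr smult_left)
      have 2: "bilinear_on M M (\<lambda>x' y'. b (x \<otimes> x') (y \<otimes> y'))" if "x \<in> carrier M" "y \<in> carrier M" for x y
        using that b unfolding bilinear_on_def by (auto simp: r_distr smult_right)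
      have "lin2 b (formal_tensor_mult M M f' g') = lin2 b (formal_tensor_mult M M f' g)"
        unfolding lin2_formal_tensor_mult using supported_class[OF assms(1) f'] 
        by (intro lin_fun_cong lin2_tensor_class[OF 2 g']) auto
      also have "\<dots> = lin2 b (formal_tensor_mult M M f g)"
        unfolding lin2_formal_tensor_mult' using assms(2)
        by (intro lin_fun_cong lin2_tensor_class[OF 1 f']) auto
      finally show ?thesis .
    qed
    then show ?case
      by (simp add: y tensor_class_eq_iff)
  qed (simp add: mem_tensor_class)
  then show ?thesis
    by (simp add: tensor_product_def)
qed

lemma T_abelian_monoid: "abelian_monoid T"
proof (rule abelian_monoidI)
  fix x y assume "x \<in> carrier T" "y \<in> carrier T"
  then obtain f g where "x = cls f" "supported M f" "y = cls g" "supported M g"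
    unfolding T_carrier by blast
  then show "x \<oplus>\<^bsub>T\<^esub> y \<in> carrier T"
    by (simp only: T_add T_carrier) (rule imageI, simp only: mem_Collect_eq supported_add)
next
  show "\<zero>\<^bsub>T\<^esub> \<in> carrier T"
    unfolding T_zero T_carrier by (rule imageI) simp
qed (auto simp: T_carrier T_zero T_add ac_simps)

lemma T_finsum:
  assumes "finite A" "\<And>a. a \<in> A \<Longrightarrow> supported M (f a)"
  shows "(\<Oplus>\<^bsub>T\<^esub>a\<in>A. cls (f a)) = cls (\<Sum>a\<in>A. f a)" "supported M (\<Sum>a\<in>A. f a)"
proof -
  interpret T: abelian_monoid T
    by (rule T_abelian_monoid)
  have "(\<Oplus>\<^bsub>T\<^esub>a\<in>A. cls (f a)) = cls (\<Sum>a\<in>A. f a) \<and> supported M (\<Sum>a\<in>A. f a)"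
    using assms
  proof (induction A rule: finite_induct)
    case empty
    then show ?case
      by (simp add: T_zero)
  next
    case (insert a A)
    then have "cls (f a) \<in> carrier T" "(\<lambda>a. cls (f a)) \<in> A \<rightarrow> carrier T"
      by (auto simp: T_carrier)
    then show ?case
      using insert by (simp add: T.finsum_insert T_add supported_add)
  qed
  then show "(\<Oplus>\<^bsub>T\<^esub>a\<in>A. cls (f a)) = cls (\<Sum>a\<in>A. f a)" "supported M (\<Sum>a\<in>A. f a)"
    by simp_all
qed

end

section \<open>The algebra B(E) and its linear functionals\<close>

lemma ring_free_algebra: "ring (ring_of_type_algebra :: ('x, 'k::field) free_algebra ring)"
proof -
  have "\<exists>y. x + y = 0" for x :: "('x, 'k) free_algebra"
    using add.right_inverse by blast
  then show ?thesis
    unfolding ring_of_type_algebra_def by unfold_locales (auto simp: algebra_simps Units_def)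
qed

lemma ring_of_type_algebra_simps [simp]:
  "carrier ring_of_type_algebra = UNIV" "x \<otimes>\<^bsub>ring_of_type_algebra\<^esub> y = x * y"
  "\<one>\<^bsub>ring_of_type_algebra\<^esub> = 1" "\<zero>\<^bsub>ring_of_type_algebra\<^esub> = 0"
  "x \<oplus>\<^bsub>ring_of_type_algebra\<^esub> y = x + y"
  by (simp_all add: ring_of_type_algebra_def)

abbreviation mono :: "'x list \<Rightarrow> ('x, 'k::field) free_algebra" where
  "mono u \<equiv> Poly_Mapping.single (Free_Word u) 1"

lemma mono_mult: "Poly_Mapping.single (Free_Word u) a * Poly_Mapping.single (Free_Word v) b =
    Poly_Mapping.single (Free_Word (u @ v)) (a * b :: 'k::field)"
  by (simp add: mult_single plus_free_word_def)

lemma one_eq_mono: "1 = mono []"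
  by (simp flip: single_one add: zero_free_word_def)

lemma free_const_eq: "free_const c = Poly_Mapping.single (Free_Word []) c"
  by (simp add: free_const_def zero_free_word_def)

lemma free_const_mult: "free_const c * f = scale_pm c f"
  by (simp add: free_const_def scale_pm_def mult_map_scale_conv_mult)

lemma single_mono: "Poly_Mapping.single w c = scale_pm c (mono (letters w))" for c :: "'k::field"
  by (cases w) (simp add: scale_pm_def)

lemma free_const_commute:
  fixes f :: "('x, 'k::field) free_algebra"
  shows "free_const c * f = f * free_const c"
proof -
  have "free_const c * Poly_Mapping.single w a = Poly_Mapping.single w a * free_const c" for w :: "'x free_word" and a
    by (cases w) (simp add: free_const_eq mono_mult mult.commute)
  then have "free_const c * (\<Sum>w\<in>A. Poly_Mapping.single w (h w)) =
      (\<Sum>w\<in>A. Poly_Mapping.single w (h w)) * free_const c" for A :: "'x free_word set" and h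
    by (simp add: sum_distrib_left sum_distrib_right)
  then show ?thesis
    using poly_mapping_expand[of f] by metis
qed

lemma mult_scale_pm:
  fixes f g :: "('x, 'k::field) free_algebra"
  shows "scale_pm c f * g = scale_pm c (f * g)" "f * scale_pm c g = scale_pm c (f * g)"
proof -
  show "scale_pm c f * g = scale_pm c (f * g)"
    unfolding free_const_mult[symmetric] by (rule mult.assoc)
  show "f * scale_pm c g = scale_pm c (f * g)"
    unfolding free_const_mult[symmetric] mult.assoc[symmetric] by (simp only: free_const_commute[of c f])
qed

section \<open>The ideal of relations and the functionals that vanish on it\<close>

locale invertible_form =
  fixes E :: "'k::field ^ 'n::finite ^ 'n"
  assumes invertible: "invertible E"
begin

abbreviation D :: "'k ^ 'n ^ 'n" where
  "D \<equiv> matrix_inv E"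

sublocale bilinear_form "\<lambda>i j. E $ i $ j" "\<lambda>i j. D $ i $ j"
proof -
  have "E ** D = mat 1 \<and> D ** E = mat 1"
    using invertible unfolding invertible_def matrix_inv_def by (rule someI_ex)
  then have "(E ** D) $ i $ k = mat 1 $ i $ k" "(D ** E) $ i $ k = mat 1 $ i $ k" for i k
    by simp_all
  then show "bilinear_form (\<lambda>i j. E $ i $ j) (\<lambda>i j. D $ i $ j)"
    by unfold_locales (simp_all add: matrix_matrix_mult_def mat_def)
qed

abbreviation R :: "('n \<times> 'n, 'k) free_algebra ring" where
  "R \<equiv> ring_of_type_algebra"

abbreviation relator1 :: "'n \<Rightarrow> 'n \<Rightarrow> ('n \<times> 'n, 'k) free_algebra" where
  "relator1 i j \<equiv> (antipode_matrix E ** gen_matrix - mat 1) $ i $ j"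

abbreviation relator2 :: "'n \<Rightarrow> 'n \<Rightarrow> ('n \<times> 'n, 'k) free_algebra" where
  "relator2 i j \<equiv> (gen_matrix ** antipode_matrix E - mat 1) $ i $ j"

lemma relator1_expand:
  "relator1 i j = (\<Sum>k\<in>UNIV. \<Sum>l\<in>UNIV. \<Sum>m\<in>UNIV. Poly_Mapping.single (Free_Word [(l, k), (m, j)]) (D $ i $ k * E $ l $ m))
    - (if i = j then 1 else 0)"
proof -
  have "relator1 i j = (\<Sum>m\<in>UNIV. \<Sum>l\<in>UNIV. \<Sum>k\<in>UNIV. Poly_Mapping.single (Free_Word [(l, k), (m, j)]) (D $ i $ k * E $ l $ m))
    - (if i = j then 1 else 0)"
    by (simp add: antipode_matrix_def const_matrix_def gen_matrix_def matrix_matrix_mult_def Finite_Cartesian_Product.transpose_def mat_def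
      free_gen_def free_const_eq sum_distrib_right mono_mult)
  also have "(\<Sum>m\<in>UNIV. \<Sum>l\<in>UNIV. \<Sum>k\<in>UNIV. Poly_Mapping.single (Free_Word [(l, k), (m, j)]) (D $ i $ k * E $ l $ m)) =
    (\<Sum>m\<in>UNIV. \<Sum>k\<in>UNIV. \<Sum>l\<in>UNIV. Poly_Mapping.single (Free_Word [(l, k), (m, j)]) (D $ i $ k * E $ l $ m))"
    by (intro sum.cong refl sum.swap)
  also have "\<dots> = (\<Sum>k\<in>UNIV. \<Sum>m\<in>UNIV. \<Sum>l\<in>UNIV. Poly_Mapping.single (Free_Word [(l, k), (m, j)]) (D $ i $ k * E $ l $ m))"
    by (rule sum.swap)
  also have "\<dots> = (\<Sum>k\<in>UNIV. \<Sum>l\<in>UNIV. \<Sum>m\<in>UNIV. Poly_Mapping.single (Free_Word [(l, k), (m, j)]) (D $ i $ k * E $ l $ m))"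
    by (intro sum.cong refl sum.swap)
  finally show ?thesis .
qed

lemma relator2_expand:
  "relator2 i j = (\<Sum>l\<in>UNIV. \<Sum>m\<in>UNIV. \<Sum>k\<in>UNIV. Poly_Mapping.single (Free_Word [(i, m), (l, k)]) (D $ m $ k * E $ l $ j))
    - (if i = j then 1 else 0)"
proof -
  have "relator2 i j = (\<Sum>m\<in>UNIV. \<Sum>l\<in>UNIV. \<Sum>k\<in>UNIV. Poly_Mapping.single (Free_Word [(i, m), (l, k)]) (D $ m $ k * E $ l $ j))
    - (if i = j then 1 else 0)"
    by (simp add: antipode_matrix_def const_matrix_def gen_matrix_def matrix_matrix_mult_def Finite_Cartesian_Product.transpose_def mat_def
      free_gen_def free_const_eq sum_distrib_right sum_distrib_left mono_mult)
  also have "(\<Sum>m\<in>UNIV. \<Sum>l\<in>UNIV. \<Sum>k\<in>UNIV. Poly_Mapping.single (Free_Word [(i, m), (l, k)]) (D $ m $ k * E $ l $ j)) =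
    (\<Sum>l\<in>UNIV. \<Sum>m\<in>UNIV. \<Sum>k\<in>UNIV. Poly_Mapping.single (Free_Word [(i, m), (l, k)]) (D $ m $ k * E $ l $ j))"
    by (rule sum.swap)
  finally show ?thesis .
qed

lemma lin_relator1:
  "lin g (mono u * relator1 i j * mono v) =
    (\<Sum>k\<in>UNIV. D $ i $ k * (\<Sum>l\<in>UNIV. \<Sum>m\<in>UNIV. E $ l $ m * g (Free_Word (u @ (l, k) # (m, j) # v))))
    - (if i = j then g (Free_Word (u @ v)) else 0)"
proof -
  have "lin g (mono u * (if i = j then 1 else 0) * mono v) = (if i = j then g (Free_Word (u @ v)) else 0)"
    by (simp add: mono_mult)
  then show ?thesis
    unfolding relator1_expand right_diff_distrib left_diff_distrib sum_distrib_left sum_distrib_right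
      mono_mult lin_diff lin_sum lin_single
    by (simp only: mult_1_left mult_1_right append_assoc append_Cons append_Nil mult.assoc)
qed

lemma lin_relator2:
  "lin g (mono u * relator2 i j * mono v) =
    (\<Sum>l\<in>UNIV. E $ l $ j * (\<Sum>m\<in>UNIV. \<Sum>k\<in>UNIV. D $ m $ k * g (Free_Word (u @ (i, m) # (l, k) # v))))
    - (if i = j then g (Free_Word (u @ v)) else 0)"
proof -
  have "lin g (mono u * (if i = j then 1 else 0) * mono v) = (if i = j then g (Free_Word (u @ v)) else 0)"
    by (simp add: mono_mult)
  then show ?thesis
    unfolding relator2_expand right_diff_distrib left_diff_distrib sum_distrib_left sum_distrib_right
      mono_mult lin_diff lin_sum lin_single
    by (simp only: mult_1_left mult_1_right append_assoc append_Cons append_Nil mult.assoc mult.left_commute mult.commute)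
qed

definition on_words :: "('n, 'k) family \<Rightarrow> ('n \<times> 'n) free_word \<Rightarrow> 'k" where
  "on_words F w = F (map fst (letters w)) (map snd (letters w))"

abbreviation pairing :: "('n, 'k) family \<Rightarrow> ('n \<times> 'n, 'k) free_algebra \<Rightarrow> 'k" where
  "pairing F \<equiv> lin (on_words F)"

lemma ideal_B_ideal: "ideal (B_ideal E) R"
  unfolding B_ideal_def by (intro ring.genideal_ideal ring_free_algebra) simp

lemma B_ideal_add: "f \<in> B_ideal E \<Longrightarrow> g \<in> B_ideal E \<Longrightarrow> f + g \<in> B_ideal E"
  using additive_subgroup.a_closed[OF ideal.axioms(1)[OF ideal_B_ideal], of f g] by simp

lemma B_ideal_mult: "f \<in> B_ideal E \<Longrightarrow> g * f \<in> B_ideal E" "f \<in> B_ideal E \<Longrightarrow> f * g \<in> B_ideal E"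
  using ideal.I_l_closed[OF ideal_B_ideal, of f g] ideal.I_r_closed[OF ideal_B_ideal, of f g] by simp_all

lemma B_ideal_zero: "0 \<in> B_ideal E"
  using additive_subgroup.zero_closed[OF ideal.axioms(1)[OF ideal_B_ideal]] by simp

lemma relators_in_ideal: "relator1 i j \<in> B_ideal E" "relator2 i j \<in> B_ideal E"
  using ring.genideal_self[OF ring_free_algebra, of "B_relators E"]
  by (auto simp: B_ideal_def B_relators_def)

lemma span_B_ideal: "pm.span (B_ideal E) = B_ideal E"
proof -
  have "pm.subspace (B_ideal E)"
    using B_ideal_add B_ideal_mult(1) B_ideal_zero
    by (intro pm.subspaceI) (auto simp: free_const_mult[symmetric])
  then show ?thesis
    by (simp add: pm.span_eq_iff)
qed

text \<open>Compatibility speaks about a relator between two monomials, and linearity extends this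
  to arbitrary factors; the elements killed in this way form an ideal.\<close>

lemma pairing_ideal:
  assumes F: "compatible F" and "f \<in> B_ideal E"
  shows "pairing F f = 0"
proof -
  \<comment> \<open>The largest two-sided ideal inside the kernel of the pairing.\<close>
  define J where "J = {f. \<forall>g h. pairing F (g * f * h) = 0}"
  have "ideal J R"
  proof (rule idealI[OF ring_free_algebra])
    show "subgroup J (add_monoid R)"
    proof (rule subgroup.intro)
      show "inv\<^bsub>add_monoid R\<^esub> x \<in> J" if "x \<in> J" for x
      proof -
        have "inv\<^bsub>add_monoid R\<^esub> x = - x"
          using abelian_group.minus_equality[OF ring.is_abelian_group[OF ring_free_algebra], of "- x" x]
          by (simp add: a_inv_def)
        then show ?thesis
          using that by (simp add: J_def)
      qed
    qed (auto simp: J_def distrib_left distrib_right)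
    show "x \<otimes>\<^bsub>R\<^esub> a \<in> J" "a \<otimes>\<^bsub>R\<^esub> x \<in> J" if "a \<in> J" for a x
      using that by (auto simp: J_def) (metis mult.assoc)+
  qed
  moreover have "B_relators E \<subseteq> J"
  proof -
    have mono: "lin g' (g * r * h) = 0" if *: "\<And>u v. lin g' (mono u * r * mono v) = 0"
      for g' g r and h :: "('n \<times> 'n, 'k) free_algebra"
    proof -
      have "g * r * h = (\<Sum>w\<in>Poly_Mapping.keys g. \<Sum>w'\<in>Poly_Mapping.keys h.
          scale_pm (Poly_Mapping.lookup h w') (scale_pm (Poly_Mapping.lookup g w) (mono (letters w) * r * mono (letters w'))))"
      proof -
        have "g * r * h = (\<Sum>w\<in>Poly_Mapping.keys g. Poly_Mapping.single w (Poly_Mapping.lookup g w)) * r *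
            (\<Sum>w'\<in>Poly_Mapping.keys h. Poly_Mapping.single w' (Poly_Mapping.lookup h w'))"
          by (simp only: poly_mapping_expand[symmetric])
        also have "\<dots> = (\<Sum>w\<in>Poly_Mapping.keys g. \<Sum>w'\<in>Poly_Mapping.keys h.
            Poly_Mapping.single w (Poly_Mapping.lookup g w) * r * Poly_Mapping.single w' (Poly_Mapping.lookup h w'))"
          by (simp only: sum_distrib_left sum_distrib_right sum.swap[of _ "Poly_Mapping.keys h"])
        also have "\<dots> = (\<Sum>w\<in>Poly_Mapping.keys g. \<Sum>w'\<in>Poly_Mapping.keys h.
          scale_pm (Poly_Mapping.lookup h w') (scale_pm (Poly_Mapping.lookup g w) (mono (letters w) * r * mono (letters w'))))"
          by (simp only: single_mono[of _ "Poly_Mapping.lookup _ _"] mult_scale_pm)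
        finally show ?thesis .
      qed
      moreover have "lin g' (Poly_Mapping.single w 1 * r * Poly_Mapping.single w' 1) = 0" for w w'
        using *[of "letters w" "letters w'"] by simp
      ultimately show ?thesis
        by (simp add: lin_sum)
    qed
    have 1: "pairing F (mono u * relator1 i j * mono v) = 0" for u v i j
      unfolding lin_relator1 using compatible_E[OF F, of "map fst u" "map snd u" "map fst v" "map snd v"]
      by (simp add: on_words_def) (simp add: mult.assoc[symmetric] sum_distrib_right[symmetric] DE)
    have 2: "pairing F (mono u * relator2 i j * mono v) = 0" for u v i j
    proof -
      have "(\<Sum>l\<in>UNIV. E $ l $ j * (D $ i $ l * z)) = (\<Sum>l\<in>UNIV. D $ i $ l * E $ l $ j) * z" for z
        unfolding sum_distrib_right by (simp only: ac_simps)
      then show ?thesis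
        unfolding lin_relator2 using compatible_D[OF F, of "map fst u" "map snd u" "map fst v" "map snd v"]
        by (simp add: on_words_def DE)
    qed
    have "relator1 i j \<in> J" "relator2 i j \<in> J" for i j
      unfolding J_def mem_Collect_eq by (intro allI mono[OF 1] mono[OF 2])+
    then show ?thesis
      unfolding B_relators_def by blast
  qed
  ultimately have "B_ideal E \<subseteq> J"
    unfolding B_ideal_def by (intro ring.genideal_minimal ring_free_algebra)
  then have "pairing F (1 * f * 1) = 0"
    using assms(2) unfolding J_def by blast
  then show ?thesis
    by simp
qed

lemma compatible_of_functional:
  assumes g: "\<And>f. f \<in> B_ideal E \<Longrightarrow> lin g f = 0"
  shows "compatible (\<lambda>I J. if length I = length J then g (Free_Word (zip I J)) else 0)"
proof (rule compatibleI_pair)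
  fix I J I' J' :: "'n list" and p j
  assume len: "length I = length J" "length I' = length J'"
  let ?u = "zip I J" and ?v = "zip I' J'"
  define x where "x = (\<lambda>k. \<Sum>l\<in>UNIV. \<Sum>m\<in>UNIV. E $ l $ m * g (Free_Word (?u @ (l, k) # (m, j) # ?v)))"
  have "(\<Sum>k\<in>UNIV. D $ i $ k * x k) = (if i = j then g (Free_Word (?u @ ?v)) else 0)" for i
  proof -
    have "lin g (mono ?u * relator1 i j * mono ?v) = 0"
      by (intro g B_ideal_mult relators_in_ideal)
    then show ?thesis
      unfolding lin_relator1 x_def by simp
  qed
  \<comment> \<open>Multiplication by E on the left undoes D in the relation D a^t E a = 1.\<close>
  then have "x p = (\<Sum>i\<in>UNIV. E $ p $ i * (if i = j then g (Free_Word (?u @ ?v)) else 0))"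
    using ED_sum[of p x] by simp
  then have "x p = E $ p $ j * g (Free_Word (?u @ ?v))"
    by (simp add: sum_if_delta)
  then show "(\<Sum>l\<in>UNIV. \<Sum>m\<in>UNIV. E $ l $ m * (if length (I @ l # m # I') = length (J @ p # j # J')
      then g (Free_Word (zip (I @ l # m # I') (J @ p # j # J'))) else 0)) =
    E $ p $ j * (if length (I @ I') = length (J @ J') then g (Free_Word (zip (I @ I') (J @ J'))) else 0)"
    using len by (simp add: x_def)
  define y where "y = (\<lambda>l. \<Sum>m\<in>UNIV. \<Sum>k\<in>UNIV. D $ m $ k * g (Free_Word (?u @ (p, m) # (l, k) # ?v)))"
  have "(\<Sum>l\<in>UNIV. E $ l $ i * y l) = (if p = i then g (Free_Word (?u @ ?v)) else 0)" for i
  proof -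
    have "lin g (mono ?u * relator2 p i * mono ?v) = 0"
      by (intro g B_ideal_mult relators_in_ideal)
    then show ?thesis
      unfolding lin_relator2 y_def by simp
  qed
  \<comment> \<open>Multiplication by D on the right undoes E in the relation a D a^t E = 1.\<close>
  then have "(\<Sum>i\<in>UNIV. (\<Sum>l\<in>UNIV. y l * E $ l $ i) * D $ i $ j) = (\<Sum>i\<in>UNIV. (if p = i then g (Free_Word (?u @ ?v)) else 0) * D $ i $ j)"
    by (simp add: mult.commute)
  also have "(\<Sum>i\<in>UNIV. (\<Sum>l\<in>UNIV. y l * E $ l $ i) * D $ i $ j) = (\<Sum>l\<in>UNIV. y l * (\<Sum>i\<in>UNIV. E $ l $ i * D $ i $ j))"
    unfolding sum_distrib_left sum_distrib_right by (subst sum.swap) (simp only: mult.assoc)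
  also have "\<dots> = y j"
    by (simp add: ED sum_if_delta)
  finally have "y j = D $ p $ j * g (Free_Word (?u @ ?v))"
    by (simp add: mult.commute sum_if_delta)
  then show "(\<Sum>l\<in>UNIV. \<Sum>m\<in>UNIV. D $ l $ m * (if length (I @ p # j # I') = length (J @ l # m # J')
      then g (Free_Word (zip (I @ p # j # I') (J @ l # m # J'))) else 0)) =
    D $ p $ j * (if length (I @ I') = length (J @ J') then g (Free_Word (zip (I @ I') (J @ J'))) else 0)"
    using len by (simp add: y_def)
qed (simp add: balanced_def)

text \<open>The ideal is a subspace, hence the common kernel of the functionals vanishing on it, and
  these are the compatible families. All equalities in the algebra are tested in this way.\<close>

lemma in_B_ideal_iff: "f \<in> B_ideal E \<longleftrightarrow> (\<forall>F. compatible F \<longrightarrow> pairing F f = 0)"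
proof
  assume *: "\<forall>F. compatible F \<longrightarrow> pairing F f = 0"
  have "lin g f = 0" if g: "\<forall>s\<in>B_ideal E. lin g s = 0" for g
  proof -
    let ?F = "\<lambda>I J. if length I = length J then g (Free_Word (zip I J)) else 0"
    have "on_words ?F w = g w" for w
      by (cases w) (simp add: on_words_def zip_map_fst_snd)
    then have "on_words ?F = g"
      by (rule ext)
    moreover have "compatible ?F"
      using g by (intro compatible_of_functional) blast
    ultimately show ?thesis
      using *[rule_format, of ?F] by simp
  qed
  then show "f \<in> B_ideal E"
    using in_span_iff[of f "B_ideal E"] by (simp add: span_B_ideal)
qed (simp add: pairing_ideal)

section \<open>The quotient algebra, its monomials and its functionals\<close>

abbreviation B :: "('k, ('n \<times> 'n, 'k) free_algebra set) module" where
  "B \<equiv> B_algebra E"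

abbreviation H :: "('k, ('n \<times> 'n, 'k) free_algebra set) hopf_algebra" where
  "H \<equiv> B_hopf E"

abbreviation bc :: "('n \<times> 'n, 'k) free_algebra \<Rightarrow> ('n \<times> 'n, 'k) free_algebra set" where
  "bc \<equiv> B_class E"

lemma bc_def': "bc f = {h + f |h. h \<in> B_ideal E}"
  by (auto simp: B_class_def a_r_coset_def r_coset_def)

lemma bc_eq_iff: "bc f = bc g \<longleftrightarrow> f - g \<in> B_ideal E"
proof -
  have f: "f \<in> bc f"
    using B_ideal_zero by (force simp: bc_def')
  have neg: "- h \<in> B_ideal E" if "h \<in> B_ideal E" for h
    using B_ideal_mult(1)[OF that, of "- 1"] by simp
  have sub: "bc f \<subseteq> bc g" if "f - g \<in> B_ideal E" for f g
  proof
    fix x assume "x \<in> bc f"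
    then obtain h where "h \<in> B_ideal E" "x = h + f"
      by (auto simp: bc_def')
    then have "x = (h + (f - g)) + g" "h + (f - g) \<in> B_ideal E"
      using that B_ideal_add by simp_all
    then show "x \<in> bc g"
      unfolding bc_def' by blast
  qed
  show ?thesis
  proof
    assume "bc f = bc g"
    then show "f - g \<in> B_ideal E"
      using f by (auto simp: bc_def')
  next
    assume *: "f - g \<in> B_ideal E"
    then show "bc f = bc g"
      using sub[OF *] sub[of g f] neg[OF *] by auto
  qed
qed

lemma bc_eq_pairing: "bc f = bc g \<longleftrightarrow> (\<forall>F. compatible F \<longrightarrow> pairing F f = pairing F g)"
  unfolding bc_eq_iff in_B_ideal_iff by simp

lemma mem_bc: "g \<in> bc f \<Longrightarrow> bc g = bc f"
  by (auto simp: bc_def' bc_eq_iff[unfolded bc_def'])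

lemma mem_bc_self: "f \<in> bc f"
  using B_ideal_zero by (force simp: bc_def')

lemma B_carrier: "carrier B = range bc"
  by (auto simp: B_algebra_def ring.defs module.defs FactRing_def A_RCOSETS_def RCOSETS_def B_class_def a_r_coset_def)

lemma B_add: "bc f \<oplus>\<^bsub>B\<^esub> bc g = bc (f + g)"
proof -
  have "bc f \<oplus>\<^bsub>B\<^esub> bc g = bc f <+>\<^bsub>R\<^esub> bc g"
    by (simp add: B_algebra_def ring.defs module.defs FactRing_def)
  also have "\<dots> = bc (f + g)"
    using abelian_subgroup.a_rcos_sum[OF abelian_subgroupI3[OF ideal.axioms(1)[OF ideal_B_ideal]
      ring.is_abelian_group[OF ring_free_algebra]], of f g]
    by (simp add: B_class_def)
  finally show ?thesis .
qed

lemma B_mult: "bc f \<otimes>\<^bsub>B\<^esub> bc g = bc (f * g)"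
proof -
  have "bc f \<otimes>\<^bsub>B\<^esub> bc g = rcoset_mult R (B_ideal E) (bc f) (bc g)"
    by (simp add: B_algebra_def ring.defs module.defs FactRing_def)
  also have "\<dots> = bc (f * g)"
    using ideal.rcoset_mult_add[OF ideal_B_ideal, of f g] by (simp add: B_class_def)
  finally show ?thesis .
qed

lemma B_one: "\<one>\<^bsub>B\<^esub> = bc 1"
  by (simp add: B_algebra_def ring.defs module.defs FactRing_def B_class_def)

lemma B_zero: "\<zero>\<^bsub>B\<^esub> = bc 0"
  by (auto simp: B_algebra_def ring.defs module.defs FactRing_def bc_def')

lemma B_smult: "c \<odot>\<^bsub>B\<^esub> bc f = bc (scale_pm c f)"
proof -
  have "c \<odot>\<^bsub>B\<^esub> bc f = induced (\<lambda>f. bc (free_const c * f)) (bc f)"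
    by (simp add: B_algebra_def ring.defs module.defs FactRing_def)
  also have "\<dots> = bc (free_const c * f)"
  proof (rule induced_eq[OF mem_bc_self])
    fix g assume "g \<in> bc f"
    then have "free_const c * (g - f) \<in> B_ideal E"
      by (intro B_ideal_mult) (auto simp: bc_def')
    then show "bc (free_const c * g) = bc (free_const c * f)"
      by (simp add: bc_eq_iff right_diff_distrib)
  qed
  finally show ?thesis
    by (simp add: free_const_mult)
qed

lemmas B_simps = B_add B_mult B_one B_zero B_smult

lemma H_simps [simp]:
  "carrier H = carrier B" "monoid.mult H = monoid.mult B" "one H = one B" "ring.zero H = ring.zero B"
  "add H = add B" "module.smult H = module.smult B"
  by (simp_all add: B_hopf_def hopf_algebra.defs module.defs)

lemma linear_ring_B: "linear_ring B"
proof -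
  have "ring B"
  proof (intro ringI abelian_groupI monoidI)
    fix x assume "x \<in> carrier B"
    then obtain f where "x = bc f"
      by (auto simp: B_carrier)
    then have "bc (- f) \<oplus>\<^bsub>B\<^esub> x = \<zero>\<^bsub>B\<^esub>"
      by (simp add: B_simps)
    then show "\<exists>y\<in>carrier B. y \<oplus>\<^bsub>B\<^esub> x = \<zero>\<^bsub>B\<^esub>"
      by (auto simp: B_carrier)
  qed (auto simp: B_carrier B_simps algebra_simps)
  moreover have "linear_ring_axioms B"
    by unfold_locales (auto simp: B_carrier B_simps mult_scale_pm)
  ultimately show ?thesis
    by (rule linear_ring.intro)
qed

sublocale B: linear_ring B
  by (rule linear_ring_B)

definition ev :: "('n, 'k) family \<Rightarrow> ('n \<times> 'n, 'k) free_algebra set \<Rightarrow> 'k" where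
  "ev F x = pairing F (SOME f. f \<in> x)"

lemma ev_bc:
  assumes "compatible F"
  shows "ev F (bc f) = pairing F f"
proof -
  have "(SOME g. g \<in> bc f) \<in> bc f"
    using someI[of "\<lambda>g. g \<in> bc f", OF mem_bc_self] .
  then show ?thesis
    unfolding ev_def using mem_bc bc_eq_pairing assms by blast
qed

lemma B_eqI:
  assumes "x \<in> carrier B" "y \<in> carrier B" "\<And>F. compatible F \<Longrightarrow> ev F x = ev F y"
  shows "x = y"
proof -
  obtain f g where "x = bc f" "y = bc g"
    using assms(1,2) by (auto simp: B_carrier)
  then show ?thesis
    using assms(3) by (simp add: bc_eq_pairing ev_bc)
qed

lemma ev_linear:
  assumes "compatible F"
  shows "x \<in> carrier B \<Longrightarrow> y \<in> carrier B \<Longrightarrow> ev F (x \<oplus>\<^bsub>B\<^esub> y) = ev F x + ev F y"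
    and "x \<in> carrier B \<Longrightarrow> ev F (c \<odot>\<^bsub>B\<^esub> x) = c * ev F x"
  using assms by (auto simp: B_carrier B_simps ev_bc)

text \<open>The matrix coefficients of a tensor power of V: the coproduct of \<open>u I J\<close> is
  the sum of \<open>u I K\<close> \<otimes> \<open>u K J\<close> over the words K.\<close>

definition u :: "'n list \<Rightarrow> 'n list \<Rightarrow> ('n \<times> 'n, 'k) free_algebra set" where
  "u I J = bc (mono (zip I J))"

lemma u_carrier [simp]: "u I J \<in> carrier B"
  by (simp add: u_def B_carrier)

lemma u_mult: "length I = length J \<Longrightarrow> u I J \<otimes>\<^bsub>B\<^esub> u K L = u (I @ K) (J @ L)"
  by (simp add: u_def B_mult mono_mult)

lemma u_Nil: "u [] [] = \<one>\<^bsub>B\<^esub>"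
  by (simp add: u_def B_one one_eq_mono)

lemma bc_single: "bc (Poly_Mapping.single w 1) = u (map fst (letters w)) (map snd (letters w))"
  by (cases w) (simp add: u_def zip_map_fst_snd)

lemma ev_u:
  assumes "compatible F" "length I = length J"
  shows "ev F (u I J) = F I J"
  using assms by (simp add: u_def ev_bc on_words_def)

lemma linear_on_class:
  assumes add: "\<And>x y. x \<in> carrier B \<Longrightarrow> y \<in> carrier B \<Longrightarrow> \<phi> (x \<oplus>\<^bsub>B\<^esub> y) = \<phi> x + \<phi> y"
    and scale: "\<And>c x. x \<in> carrier B \<Longrightarrow> \<phi> (c \<odot>\<^bsub>B\<^esub> x) = c * (\<phi> x :: 'k)"
  shows "\<phi> (bc f) = pairing (\<lambda>I J. \<phi> (u I J)) f"
proof -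
  have add': "\<phi> (bc (f + g)) = \<phi> (bc f) + \<phi> (bc g)" and scale': "\<phi> (bc (scale_pm c f)) = c * \<phi> (bc f)" for f g c
    using add[of "bc f" "bc g"] scale[of "bc f" c] by (simp_all add: B_carrier B_simps)
  have zero: "\<phi> (bc 0) = 0"
    using scale'[of 0 0] by simp
  have single: "\<phi> (bc (Poly_Mapping.single w c)) = c * on_words (\<lambda>I J. \<phi> (u I J)) w" for w c
    using scale'[of c "Poly_Mapping.single w 1"] by (simp add: bc_single on_words_def scale_pm_def)
  have "\<phi> (bc (\<Sum>w\<in>A. Poly_Mapping.single w (h w))) = (\<Sum>w\<in>A. h w * on_words (\<lambda>I J. \<phi> (u I J)) w)" if "finite A" for A h
    using that by (induction A rule: finite_induct) (simp_all add: zero add' single)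
  from this[of "Poly_Mapping.keys f" "Poly_Mapping.lookup f"] show ?thesis
    by (simp add: poly_mapping_expand[symmetric] lin_def)
qed

definition fam :: "(('n \<times> 'n, 'k) free_algebra set \<Rightarrow> 'k) \<Rightarrow> ('n, 'k) family" where
  "fam \<phi> = (\<lambda>I J. if length I = length J then \<phi> (u I J) else 0)"

lemma pairing_cong:
  assumes "\<And>I J. length I = length J \<Longrightarrow> F I J = G I J"
  shows "pairing F f = pairing G f"
  by (rule lin_fun_cong) (simp add: on_words_def assms)

lemma compatible_fam:
  assumes "\<And>x y. x \<in> carrier B \<Longrightarrow> y \<in> carrier B \<Longrightarrow> \<phi> (x \<oplus>\<^bsub>B\<^esub> y) = \<phi> x + \<phi> y"
    and "\<And>c x. x \<in> carrier B \<Longrightarrow> \<phi> (c \<odot>\<^bsub>B\<^esub> x) = c * \<phi> x"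
  shows "compatible (fam \<phi>)"
proof -
  let ?g = "\<lambda>w. \<phi> (bc (Poly_Mapping.single w 1))"
  have "lin ?g f = 0" if "f \<in> B_ideal E" for f
  proof -
    have "lin ?g f = \<phi> (bc f)"
      using linear_on_class[of \<phi>, OF assms] by (simp add: bc_single on_words_def[abs_def])
    also have "bc f = bc 0"
      using that by (simp add: bc_eq_iff)
    also have "\<phi> (bc 0) = 0"
      using assms(2)[of "bc 0" 0] by (simp add: B_carrier B_simps)
    finally show ?thesis .
  qed
  then have "compatible (\<lambda>I J. if length I = length J then ?g (Free_Word (zip I J)) else 0)"
    by (rule compatible_of_functional)
  then show ?thesis
    unfolding fam_def u_def .
qed

section \<open>Bilinear forms, the coproduct and Sweedler sums\<close>

lemma bilinear_compatible:
  assumes "bilinear_on B B b"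
  shows "x \<in> carrier B \<Longrightarrow> compatible (fam (\<lambda>y. b x y))" "y \<in> carrier B \<Longrightarrow> compatible (fam (\<lambda>x. b x y))"
  using assms unfolding bilinear_on_def by (auto intro!: compatible_fam)

text \<open>The family of the functional that sends x to the Sweedler sum of b over the coproduct of
  x.\<close>

definition contract :: "(('n \<times> 'n, 'k) free_algebra set \<Rightarrow> ('n \<times> 'n, 'k) free_algebra set \<Rightarrow> 'k) \<Rightarrow> ('n, 'k) family" where
  "contract b = (\<lambda>I J. if length I = length J then \<Sum>K\<in>words (length I). b (u I K) (u K J) else 0)"

lemma compatible_contract_bilinear:
  assumes "bilinear_on B B b"
  shows "compatible (contract b)"
proof -
  have "compatible (\<lambda>I J. if length I = length J then \<Sum>K\<in>words (length I).
      (if length I = length K \<and> length K = length J then b (u I K) (u K J) else 0) else 0)"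
  proof (rule compatible_contract[of "\<lambda>I J K L. if length I = length J \<and> length K = length L then b (u I J) (u K L) else 0"])
    show "compatible (\<lambda>I J. if length I = length J \<and> length K = length L then b (u I J) (u K L) else 0)"
      if "length K = length L" for K L
      using bilinear_compatible(2)[OF assms, of "u K L"] that by (simp add: fam_def)
    show "compatible (\<lambda>K L. if length I = length J \<and> length K = length L then b (u I J) (u K L) else 0)"
      if "length I = length J" for I J
      using bilinear_compatible(1)[OF assms, of "u I J"] that by (simp add: fam_def)
  qed
  moreover have "(\<lambda>I J. if length I = length J then \<Sum>K\<in>words (length I).
      (if length I = length K \<and> length K = length J then b (u I K) (u K J) else 0) else 0) = contract b"
    by (auto simp: contract_def intro!: ext sum.cong)
  ultimately show ?thesis
    by simp
qed

text \<open>A formal representative of the coproduct of the monomial w; \<open>coproduct\<close>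
  extends it linearly.\<close>

definition cop :: "('n \<times> 'n) list \<Rightarrow> (('n \<times> 'n, 'k) free_algebra set \<times> ('n \<times> 'n, 'k) free_algebra set) \<Rightarrow>\<^sub>0 'k" where
  "cop w = (\<Sum>K\<in>words (length w). Poly_Mapping.single (u (map fst w) K, u K (map snd w)) 1)"

lemma supported_sum: "(\<And>a. a \<in> A \<Longrightarrow> supported B (f a)) \<Longrightarrow> supported B (sum f A)"
  by (induction A rule: infinite_finite_induct) (simp_all add: B.supported_add)

lemma cop_supported: "supported B (cop w)"
  unfolding cop_def by (intro supported_sum) simp

lemma lin_cop: "lin g (cop w) = (\<Sum>K\<in>words (length w). g (u (map fst w) K, u K (map snd w)))"
  by (simp add: cop_def lin_sum)

abbreviation comult_gen :: "'n \<times> 'n \<Rightarrow> _" where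
  "comult_gen \<equiv> \<lambda>(i, j). \<Oplus>\<^bsub>B.T\<^esub>l\<in>UNIV. pure_tensor B B (bc (free_gen (i, l))) (bc (free_gen (l, j)))"

lemma comult_gen: "comult_gen p = B.cls (cop [p])"
proof -
  obtain i j where p: "p = (i, j)"
    by fastforce
  have "comult_gen p = (\<Oplus>\<^bsub>B.T\<^esub>l\<in>UNIV. B.cls (Poly_Mapping.single (u [i] [l], u [l] [j]) 1))"
    by (simp add: p pure_tensor_def u_def free_gen_def)
  also have "\<dots> = B.cls (\<Sum>l\<in>UNIV. Poly_Mapping.single (u [i] [l], u [l] [j]) 1)"
    by (intro B.T_finsum) simp_all
  also have "(\<Sum>l\<in>UNIV. Poly_Mapping.single (u [i] [l], u [l] [j]) 1) = cop [p]"
    by (simp add: cop_def p sum_words_Suc)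
  finally show ?thesis .
qed

lemma comult_word: "foldr (\<lambda>x y. comult_gen x \<otimes>\<^bsub>B.T\<^esub> y) w \<one>\<^bsub>B.T\<^esub> = B.cls (cop w)"
proof (induction w)
  case Nil
  then show ?case
    by (simp add: B.T_one cop_def u_Nil)
next
  case (Cons p w)
  have "comult_gen p \<otimes>\<^bsub>B.T\<^esub> B.cls (cop w) = B.cls (formal_tensor_mult B B (cop [p]) (cop w))"
    unfolding comult_gen by (rule B.T_mult) (rule cop_supported)+
  also have "\<dots> = B.cls (cop (p # w))"
    unfolding tensor_class_eq_iff
    by (auto simp: B.lin2_formal_tensor_mult lin_cop sum_words_Suc u_mult intro!: sum.cong)
  finally show ?case
    using Cons.IH by simp
qed

definition coproduct where
  "coproduct f = (\<Sum>w\<in>Poly_Mapping.keys f. scale_pm (Poly_Mapping.lookup f w) (cop (letters w)))"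

lemma coproduct_supported: "supported B (coproduct f)"
  unfolding coproduct_def by (intro supported_sum B.supported_scale cop_supported)

lemma lin2_coproduct: "lin2 b (coproduct f) = pairing (contract b) f"
  by (simp add: coproduct_def lin_sum lin_cop) (simp add: lin_def on_words_def contract_def)

lemma free_lift_comult: "free_lift B.T comult_gen f = B.cls (coproduct f)"
proof -
  have "free_lift B.T comult_gen f = (\<Oplus>\<^bsub>B.T\<^esub>w\<in>Poly_Mapping.keys f. B.cls (scale_pm (Poly_Mapping.lookup f w) (cop (letters w))))"
    unfolding free_lift_def comult_word B.T_smult ..
  also have "\<dots> = B.cls (coproduct f)"
    unfolding coproduct_def by (intro B.T_finsum B.supported_scale cop_supported) simp
  finally show ?thesis .
qed

text \<open>The value is independent of the representative because every bilinear form, composed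
  with the coproduct, gives a compatible family, which vanishes on the ideal.\<close>

lemma H_comult: "comult H (bc f) = B.cls (coproduct f)"
proof -
  have "comult H (bc f) = induced (free_lift B.T comult_gen) (bc f)"
    by (simp add: B_hopf_def hopf_algebra.defs module.defs)
  also have "\<dots> = free_lift B.T comult_gen f"
  proof (rule induced_eq[OF mem_bc_self])
    fix g assume "g \<in> bc f"
    then show "free_lift B.T comult_gen g = free_lift B.T comult_gen f"
      unfolding free_lift_comult tensor_class_eq_iff lin2_coproduct
      using mem_bc bc_eq_pairing compatible_contract_bilinear by blast
  qed
  finally show ?thesis
    by (simp only: free_lift_comult)
qed

lemma ground_field_simps [simp]:
  "carrier ground_field = UNIV" "x \<otimes>\<^bsub>ground_field\<^esub> y = x * y" "\<one>\<^bsub>ground_field\<^esub> = 1"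
  "\<zero>\<^bsub>ground_field\<^esub> = 0" "x \<oplus>\<^bsub>ground_field\<^esub> y = x + y" "x \<odot>\<^bsub>ground_field\<^esub> y = x * y"
  by (simp_all add: ground_field_def ring.defs module.defs)

lemma finsum_ground_field:
  assumes "finite A"
  shows "(\<Oplus>\<^bsub>ground_field\<^esub>a\<in>A. f a) = (\<Sum>a\<in>A. f a :: 'k)"
proof -
  interpret G: abelian_monoid "ground_field :: ('k, 'k) module"
    by (rule abelian_monoidI) (auto simp: add.assoc add.commute)
  show ?thesis
    using assms by (induction A rule: finite_induct) simp_all
qed

lemma sweedler_k:
  assumes "bilinear_on B B b"
  shows "sweedler_k H (bc f) b = pairing (contract b) f"
proof -
  have lift: "(\<Oplus>\<^bsub>ground_field\<^esub>p\<in>Poly_Mapping.keys g. Poly_Mapping.lookup g p \<odot>\<^bsub>ground_field\<^esub> b (fst p) (snd p)) = lin2 b g" for g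
    by (simp add: finsum_ground_field lin_def)
  have "sweedler_k H (bc f) b = lin2 b (coproduct f)"
    unfolding sweedler_def tensor_lift_def H_comult lift
    by (intro induced_eq mem_tensor_class lin2_tensor_class[OF assms])
  then show ?thesis
    by (simp only: lin2_coproduct)
qed

lemma B_finsum:
  assumes "finite A" "\<And>a. a \<in> A \<Longrightarrow> h a \<in> carrier B"
  shows "(\<Oplus>\<^bsub>H\<^esub>a\<in>A. h a) \<in> carrier B \<and> (\<forall>F. compatible F \<longrightarrow> ev F (\<Oplus>\<^bsub>H\<^esub>a\<in>A. h a) = (\<Sum>a\<in>A. ev F (h a)))"
proof -
  interpret H: abelian_monoid H
    by (rule abelian_monoidI) (simp_all add: B.a_assoc, simp add: B.a_comm)
  have zero: "ev F \<zero>\<^bsub>B\<^esub> = 0" if "compatible F" for F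
    using that by (simp add: B_zero ev_bc)
  show ?thesis
    using assms
  proof (induction A rule: finite_induct)
    case empty
    then show ?case
      by (simp add: zero)
  next
    case (insert a A)
    then have "h \<in> A \<rightarrow> carrier H" "h a \<in> carrier H"
      by auto
    then show ?case
      using insert by (simp add: ev_linear)
  qed
qed

text \<open>For values in the algebra, independence of the representative of the coproduct is
  checked after each functional, where it becomes the statement for bilinear forms with scalar
  values.\<close>

lemma sweedler_B:
  assumes closed: "\<And>x y. x \<in> carrier B \<Longrightarrow> y \<in> carrier B \<Longrightarrow> \<beta> x y \<in> carrier B"
    and bilinear: "\<And>F. compatible F \<Longrightarrow> bilinear_on B B (\<lambda>x y. ev F (\<beta> x y))"
  shows "sweedler H H (bc f) \<beta> \<in> carrier B"
    and "compatible F \<Longrightarrow> ev F (sweedler H H (bc f) \<beta>) = pairing (contract (\<lambda>x y. ev F (\<beta> x y))) f"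
proof -
  let ?L = "\<lambda>f. \<Oplus>\<^bsub>H\<^esub>p\<in>Poly_Mapping.keys f. Poly_Mapping.lookup f p \<odot>\<^bsub>H\<^esub> \<beta> (fst p) (snd p)"
  have L: "?L g \<in> carrier B" "compatible F \<Longrightarrow> ev F (?L g) = lin2 (\<lambda>x y. ev F (\<beta> x y)) g" if "supported B g" for g F
  proof -
    have closed': "Poly_Mapping.lookup g p \<odot>\<^bsub>H\<^esub> \<beta> (fst p) (snd p) \<in> carrier B" "\<beta> (fst p) (snd p) \<in> carrier B"
      if "p \<in> Poly_Mapping.keys g" for p
      using that \<open>supported B g\<close> by (auto intro!: closed B.smult_closed)
    show "?L g \<in> carrier B" "compatible F \<Longrightarrow> ev F (?L g) = lin2 (\<lambda>x y. ev F (\<beta> x y)) g"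
      using B_finsum[of "Poly_Mapping.keys g" "\<lambda>p. Poly_Mapping.lookup g p \<odot>\<^bsub>H\<^esub> \<beta> (fst p) (snd p)"] closed'
      by (simp_all add: ev_linear lin_def)
  qed
  have "sweedler H H (bc f) \<beta> = ?L (coproduct f)"
    unfolding sweedler_def tensor_lift_def H_comult
  proof (rule induced_eq[OF mem_tensor_class])
    fix g assume g: "g \<in> B.cls (coproduct f)"
    then have sup: "supported B g"
      using B.supported_class coproduct_supported by blast
    then show "?L g = ?L (coproduct f)"
      by (intro B_eqI) (simp_all only: L sup coproduct_supported lin2_tensor_class[OF bilinear g])
  qed
  then show "sweedler H H (bc f) \<beta> \<in> carrier B"
    "compatible F \<Longrightarrow> ev F (sweedler H H (bc f) \<beta>) = pairing (contract (\<lambda>x y. ev F (\<beta> x y))) f"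
    by (simp_all only: L coproduct_supported lin2_coproduct[of "\<lambda>x y. ev F (\<beta> x y)"])
qed

end

section \<open>Iterated Sweedler sums of bilinear maps\<close>

lemma lin_fun_add: "lin (\<lambda>x. g x + h x) f = lin g f + lin h f"
  by (simp add: lin_def distrib_left sum.distrib)

lemma lin_fun_scale: "lin (\<lambda>x. c * g x) f = c * lin g f"
  unfolding lin_def sum_distrib_left by (simp only: mult.left_commute)

lemma bilinear_onD:
  assumes "bilinear_on M N b"
  shows "x \<in> carrier M \<Longrightarrow> x' \<in> carrier M \<Longrightarrow> y \<in> carrier N \<Longrightarrow> b (x \<oplus>\<^bsub>M\<^esub> x') y = b x y + b x' y"
    and "x \<in> carrier M \<Longrightarrow> y \<in> carrier N \<Longrightarrow> y' \<in> carrier N \<Longrightarrow> b x (y \<oplus>\<^bsub>N\<^esub> y') = b x y + b x y'"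
    and "x \<in> carrier M \<Longrightarrow> y \<in> carrier N \<Longrightarrow> b (c \<odot>\<^bsub>M\<^esub> x) y = c * b x y"
    and "x \<in> carrier M \<Longrightarrow> y \<in> carrier N \<Longrightarrow> b x (c \<odot>\<^bsub>N\<^esub> y) = c * b x y"
  using assms by (auto simp: bilinear_on_def)

lemma bilinear_onI:
  assumes "\<And>x x' y. x \<in> carrier M \<Longrightarrow> x' \<in> carrier M \<Longrightarrow> y \<in> carrier N \<Longrightarrow> b (x \<oplus>\<^bsub>M\<^esub> x') y = b x y + b x' y"
    and "\<And>x y y'. x \<in> carrier M \<Longrightarrow> y \<in> carrier N \<Longrightarrow> y' \<in> carrier N \<Longrightarrow> b x (y \<oplus>\<^bsub>N\<^esub> y') = b x y + b x y'"
    and "\<And>c x y. x \<in> carrier M \<Longrightarrow> y \<in> carrier N \<Longrightarrow> b (c \<odot>\<^bsub>M\<^esub> x) y = c * b x y"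
    and "\<And>c x y. x \<in> carrier M \<Longrightarrow> y \<in> carrier N \<Longrightarrow> b x (c \<odot>\<^bsub>N\<^esub> y) = c * b x y"
  shows "bilinear_on M N b"
  using assms by (auto simp: bilinear_on_def)

context invertible_form
begin

lemma pairing_fun_add: "pairing (\<lambda>I J. F I J + G I J) f = pairing F f + pairing G f"
  by (simp add: on_words_def[abs_def] lin_fun_add)

lemma pairing_fun_scale: "pairing (\<lambda>I J. c * F I J) f = c * pairing F f"
  by (simp add: on_words_def[abs_def] lin_fun_scale)

lemma bilinear_cong:
  assumes "\<And>x y. x \<in> carrier B \<Longrightarrow> y \<in> carrier B \<Longrightarrow> b x y = b' x y"
  shows "bilinear_on B B b \<longleftrightarrow> bilinear_on B B b'"
  unfolding bilinear_on_def using assms by simp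

lemma bilinear_eqI:
  assumes "bilinear_on B B b" "bilinear_on B B b'" "x \<in> carrier B" "y \<in> carrier B"
    and eq: "\<And>I J K L. length I = length J \<Longrightarrow> length K = length L \<Longrightarrow> b (u I J) (u K L) = b' (u I J) (u K L)"
  shows "b x y = b' x y"
proof -
  obtain f g where x: "x = bc f" and y: "y = bc g"
    using assms(3,4) by (auto simp: B_carrier)
  have "h x y = pairing (\<lambda>I J. pairing (\<lambda>K L. h (u I J) (u K L)) g) f" if "bilinear_on B B h" for h
  proof -
    have "h x y = pairing (\<lambda>I J. h (u I J) y) f"
      unfolding x using that assms(4) by (intro linear_on_class) (auto simp: bilinear_on_def)
    also have "(\<lambda>I J. h (u I J) y) = (\<lambda>I J. pairing (\<lambda>K L. h (u I J) (u K L)) g)"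
      unfolding y using that by (intro ext linear_on_class) (auto simp: bilinear_on_def)
    finally show ?thesis .
  qed
  from this[OF assms(1)] this[OF assms(2)] show ?thesis
    by (auto intro!: pairing_cong eq)
qed

lemma sweedler_k_u:
  assumes "bilinear_on B B b" "length I = length J"
  shows "sweedler_k H (u I J) b = (\<Sum>K\<in>words (length I). b (u I K) (u K J))"
  using assms by (simp add: u_def sweedler_k) (simp add: on_words_def contract_def u_def)

text \<open>The common shape of the sums to come: convolution products, both sides of the cocycle
  identity, the laziness condition after applying a functional, and coboundaries.\<close>

abbreviation sweedler2 where
  "sweedler2 p q x y \<equiv> sweedler_k H x (\<lambda>x1 x2. sweedler_k H y (\<lambda>y1 y2. p x1 y1 * q x2 y2))"

lemma bilinear_prod:
  assumes "bilinear_on B B p" "bilinear_on B B q"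
  shows "x1 \<in> carrier B \<Longrightarrow> x2 \<in> carrier B \<Longrightarrow> bilinear_on B B (\<lambda>y1 y2. p x1 y1 * q x2 y2)"
    and "y1 \<in> carrier B \<Longrightarrow> y2 \<in> carrier B \<Longrightarrow> bilinear_on B B (\<lambda>x1 x2. p x1 y1 * q x2 y2)"
  by (auto intro!: bilinear_onI
    simp: bilinear_onD[OF assms(1)] bilinear_onD[OF assms(2)] distrib_left distrib_right mult.left_commute)

lemma sweedler_k_linear:
  assumes "bilinear_on B B b"
  shows "x \<in> carrier B \<Longrightarrow> y \<in> carrier B \<Longrightarrow> sweedler_k H (x \<oplus>\<^bsub>B\<^esub> y) b = sweedler_k H x b + sweedler_k H y b"
    and "x \<in> carrier B \<Longrightarrow> sweedler_k H (c \<odot>\<^bsub>B\<^esub> x) b = c * sweedler_k H x b"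
  using assms by (auto simp: B_carrier B_simps sweedler_k)

lemma sweedler_k_cong:
  assumes "bilinear_on B B b" "x \<in> carrier B"
    and "\<And>x y. x \<in> carrier B \<Longrightarrow> y \<in> carrier B \<Longrightarrow> b x y = b' x y"
  shows "sweedler_k H x b = sweedler_k H x b'"
proof -
  have "bilinear_on B B b'"
    using assms(1) bilinear_cong[of b b', OF assms(3)] by simp
  moreover have "contract b = contract b'"
    by (auto simp: contract_def assms(3) intro!: ext)
  ultimately show ?thesis
    using assms(1,2) by (auto simp: B_carrier sweedler_k)
qed

lemma sweedler_k_add:
  assumes "bilinear_on B B b" "bilinear_on B B b'" "x \<in> carrier B"
  shows "sweedler_k H x (\<lambda>x1 x2. b x1 x2 + b' x1 x2) = sweedler_k H x b + sweedler_k H x b'"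
proof -
  have "bilinear_on B B (\<lambda>x1 x2. b x1 x2 + b' x1 x2)"
    by (rule bilinear_onI) (simp_all add: bilinear_onD[OF assms(1)] bilinear_onD[OF assms(2)] distrib_left)
  moreover have "contract (\<lambda>x1 x2. b x1 x2 + b' x1 x2) = (\<lambda>I J. contract b I J + contract b' I J)"
    by (auto simp: contract_def sum.distrib intro!: ext)
  ultimately show ?thesis
    using assms by (auto simp: B_carrier sweedler_k pairing_fun_add)
qed

lemma sweedler_k_scale:
  assumes "bilinear_on B B b" "x \<in> carrier B"
  shows "sweedler_k H x (\<lambda>x1 x2. c * b x1 x2) = c * sweedler_k H x b"
proof -
  have "bilinear_on B B (\<lambda>x1 x2. c * b x1 x2)"
    by (rule bilinear_onI) (simp_all add: bilinear_onD[OF assms(1)] distrib_left mult.left_commute)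
  moreover have "contract (\<lambda>x1 x2. c * b x1 x2) = (\<lambda>I J. c * contract b I J)"
    by (auto simp: contract_def sum_distrib_left intro!: ext)
  ultimately show ?thesis
    using assms by (auto simp: B_carrier sweedler_k pairing_fun_scale)
qed

text \<open>The outer Sweedler sum is independent of the representative of the coproduct only if the
  inner sum is bilinear in the outer pair.\<close>

lemma sweedler2_inner:
  assumes p: "bilinear_on B B p" and q: "bilinear_on B B q" and y: "y \<in> carrier B"
  shows "bilinear_on B B (\<lambda>x1 x2. sweedler_k H y (\<lambda>y1 y2. p x1 y1 * q x2 y2))"
proof -
  note prod = bilinear_prod(1)[OF p q]
  have p': "p (x \<oplus>\<^bsub>B\<^esub> x') y1 = p x y1 + p x' y1" "p (c \<odot>\<^bsub>B\<^esub> x) y1 = c * p x y1"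
    and q': "q (x \<oplus>\<^bsub>B\<^esub> x') y1 = q x y1 + q x' y1" "q (c \<odot>\<^bsub>B\<^esub> x) y1 = c * q x y1"
    if "x \<in> carrier B" "x' \<in> carrier B" "y1 \<in> carrier B" for x x' y1 c
    using that p q by (auto simp: bilinear_on_def)
  show ?thesis
    unfolding bilinear_on_def
  proof (intro conjI allI ballI)
    fix x x' z assume c: "x \<in> carrier B" "x' \<in> carrier B" "z \<in> carrier B"
    show "sweedler_k H y (\<lambda>y1 y2. p (x \<oplus>\<^bsub>B\<^esub> x') y1 * q z y2) =
        sweedler_k H y (\<lambda>y1 y2. p x y1 * q z y2) + sweedler_k H y (\<lambda>y1 y2. p x' y1 * q z y2)"
      unfolding sweedler_k_add[OF prod[OF c(1,3)] prod[OF c(2,3)] y, symmetric]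
      using c y by (intro sweedler_k_cong prod) (auto simp: p' distrib_right)
    show "sweedler_k H y (\<lambda>y1 y2. p z y1 * q (x \<oplus>\<^bsub>B\<^esub> x') y2) =
        sweedler_k H y (\<lambda>y1 y2. p z y1 * q x y2) + sweedler_k H y (\<lambda>y1 y2. p z y1 * q x' y2)"
      unfolding sweedler_k_add[OF prod[OF c(3,1)] prod[OF c(3,2)] y, symmetric]
      using c y by (intro sweedler_k_cong prod) (auto simp: q' distrib_left)
  next
    fix a x z assume c: "x \<in> carrier B" "z \<in> carrier B"
    show "sweedler_k H y (\<lambda>y1 y2. p (a \<odot>\<^bsub>B\<^esub> x) y1 * q z y2) = a * sweedler_k H y (\<lambda>y1 y2. p x y1 * q z y2)"
      unfolding sweedler_k_scale[OF prod[OF c] y, symmetric]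
      using c y by (intro sweedler_k_cong prod) (auto simp: p'(2)[OF _ c(1)])
    show "sweedler_k H y (\<lambda>y1 y2. p x y1 * q (a \<odot>\<^bsub>B\<^esub> z) y2) = a * sweedler_k H y (\<lambda>y1 y2. p x y1 * q z y2)"
      unfolding sweedler_k_scale[OF prod[OF c] y, symmetric]
      using c y by (intro sweedler_k_cong prod) (auto simp: q'(2)[OF _ c(1)])
  qed
qed

lemma sweedler2_u:
  assumes "bilinear_on B B p" "bilinear_on B B q" "length I = length J" "length K = length L"
  shows "sweedler2 p q (u I J) (u K L) =
    (\<Sum>M\<in>words (length I). \<Sum>N\<in>words (length K). p (u I M) (u K N) * q (u M J) (u N L))"
proof -
  have "sweedler2 p q (u I J) (u K L) = (\<Sum>M\<in>words (length I). sweedler_k H (u K L) (\<lambda>y1 y2. p (u I M) y1 * q (u M J) y2))"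
    using assms by (intro sweedler_k_u sweedler2_inner) auto
  then show ?thesis
    using assms by (simp add: sweedler_k_u bilinear_prod)
qed

lemma sweedler2_bilinear:
  assumes p: "bilinear_on B B p" and q: "bilinear_on B B q"
  shows "bilinear_on B B (sweedler2 p q)"
  unfolding bilinear_on_def
proof (intro conjI allI ballI)
  note inner = sweedler2_inner[OF p q]
  fix x x' y assume c: "x \<in> carrier B" "x' \<in> carrier B" "y \<in> carrier B"
  show "sweedler2 p q (x \<oplus>\<^bsub>B\<^esub> x') y = sweedler2 p q x y + sweedler2 p q x' y"
    using c by (intro sweedler_k_linear inner)
  show "sweedler2 p q y (x \<oplus>\<^bsub>B\<^esub> x') = sweedler2 p q y x + sweedler2 p q y x'"
    unfolding sweedler_k_add[OF inner[OF c(1)] inner[OF c(2)] c(3), symmetric]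
    using c by (intro sweedler_k_cong inner) (auto intro!: sweedler_k_linear bilinear_prod(1)[OF p q])
next
  note inner = sweedler2_inner[OF p q]
  fix a x y assume c: "x \<in> carrier B" "y \<in> carrier B"
  show "sweedler2 p q (a \<odot>\<^bsub>B\<^esub> x) y = a * sweedler2 p q x y"
    using c by (intro sweedler_k_linear inner)
  show "sweedler2 p q x (a \<odot>\<^bsub>B\<^esub> y) = a * sweedler2 p q x y"
    unfolding sweedler_k_scale[OF inner[OF c(2)] c(1), symmetric]
    using c by (intro sweedler_k_cong inner) (auto intro!: sweedler_k_linear bilinear_prod(1)[OF p q])
qed

text \<open>The factors p and q depend on F, because the functional enters the factor that carries
  the element of the algebra.\<close>

lemma sweedler2_B:
  assumes closed: "\<And>x1 x2 y1 y2. x1 \<in> carrier B \<Longrightarrow> x2 \<in> carrier B \<Longrightarrow> y1 \<in> carrier B \<Longrightarrow> y2 \<in> carrier B \<Longrightarrow>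
      \<beta> x1 x2 y1 y2 \<in> carrier B"
    and pq: "\<And>F x1 x2 y1 y2. compatible F \<Longrightarrow> x1 \<in> carrier B \<Longrightarrow> x2 \<in> carrier B \<Longrightarrow> y1 \<in> carrier B \<Longrightarrow> y2 \<in> carrier B \<Longrightarrow>
      ev F (\<beta> x1 x2 y1 y2) = p F x1 y1 * q F x2 y2"
    and p: "\<And>F. compatible F \<Longrightarrow> bilinear_on B B (p F)" and q: "\<And>F. compatible F \<Longrightarrow> bilinear_on B B (q F)"
    and x: "x \<in> carrier B" and y: "y \<in> carrier B"
  shows "sweedler H H x (\<lambda>x1 x2. sweedler H H y (\<beta> x1 x2)) \<in> carrier B"
    and "compatible F \<Longrightarrow> ev F (sweedler H H x (\<lambda>x1 x2. sweedler H H y (\<beta> x1 x2))) = sweedler2 (p F) (q F) x y"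
proof -
  obtain f g where f: "x = bc f" and g: "y = bc g"
    using x y by (auto simp: B_carrier)
  have single: "sweedler H H z \<gamma> \<in> carrier B" "compatible F \<Longrightarrow> ev F (sweedler H H z \<gamma>) = sweedler_k H z (\<lambda>x y. ev F (\<gamma> x y))"
    if "z \<in> carrier B" "\<And>x y. x \<in> carrier B \<Longrightarrow> y \<in> carrier B \<Longrightarrow> \<gamma> x y \<in> carrier B"
      "\<And>F. compatible F \<Longrightarrow> bilinear_on B B (\<lambda>x y. ev F (\<gamma> x y))" for z \<gamma> F
    using that(1) sweedler_B[of \<gamma>, OF that(2,3)] by (auto simp: B_carrier sweedler_k[OF that(3)])
  have bil: "bilinear_on B B (\<lambda>y1 y2. ev F (\<beta> x1 x2 y1 y2))" if "compatible F" "x1 \<in> carrier B" "x2 \<in> carrier B" for F x1 x2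
    using bilinear_prod(1)[OF p q, OF that(1,1,2,3)] that by (subst bilinear_cong[OF pq]) auto
  have inner: "sweedler H H y (\<beta> x1 x2) \<in> carrier B"
    "compatible F \<Longrightarrow> ev F (sweedler H H y (\<beta> x1 x2)) = sweedler_k H y (\<lambda>y1 y2. p F x1 y1 * q F x2 y2)"
    if "x1 \<in> carrier B" "x2 \<in> carrier B" for x1 x2 F
  proof -
    show "sweedler H H y (\<beta> x1 x2) \<in> carrier B"
      by (rule single(1)[OF y]) (rule closed[OF that] bil[OF _ that]; assumption)+
    assume F: "compatible F"
    have "ev F (sweedler H H y (\<beta> x1 x2)) = sweedler_k H y (\<lambda>x y. ev F (\<beta> x1 x2 x y))"
      by (rule single(2)[OF y _ _ F]) (rule closed[OF that] bil[OF _ that]; assumption)+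
    also have "\<dots> = sweedler_k H y (\<lambda>y1 y2. p F x1 y1 * q F x2 y2)"
      using F that y by (intro sweedler_k_cong bil pq)
    finally show "ev F (sweedler H H y (\<beta> x1 x2)) = sweedler_k H y (\<lambda>y1 y2. p F x1 y1 * q F x2 y2)" .
  qed
  have bil2: "bilinear_on B B (\<lambda>x1 x2. ev F (sweedler H H y (\<beta> x1 x2)))" if "compatible F" for F
    using sweedler2_inner[OF p q y, OF that that] inner(2)[OF _ _ that] by (subst bilinear_cong) auto
  show "sweedler H H x (\<lambda>x1 x2. sweedler H H y (\<beta> x1 x2)) \<in> carrier B"
    by (rule single(1)[OF x]) (rule inner(1) bil2; assumption)+
  assume F: "compatible F"
  have "ev F (sweedler H H x (\<lambda>x1 x2. sweedler H H y (\<beta> x1 x2))) =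
      sweedler_k H x (\<lambda>x1 x2. ev F (sweedler H H y (\<beta> x1 x2)))"
    by (rule single(2)[OF x _ _ F]) (rule inner(1) bil2; assumption)+
  also have "\<dots> = sweedler2 (p F) (q F) x y"
    using F x by (intro sweedler_k_cong bil2 inner)
  finally show "ev F (sweedler H H x (\<lambda>x1 x2. sweedler H H y (\<beta> x1 x2))) = sweedler2 (p F) (q F) x y" .
qed

end

section \<open>Lazy functionals and lazy cocycles on B(E)\<close>

context invertible_form
begin

lemma H_counit: "counit H (bc f) = pairing delta f"
proof -
  let ?g = "\<lambda>(i, j). if i = j then 1 else 0 :: 'k"
  have word: "foldr (\<lambda>x y. ?g x \<otimes>\<^bsub>ground_field\<^esub> y) w \<one>\<^bsub>ground_field\<^esub> = delta (map fst w) (map snd w)" for w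
    by (induction w) (auto simp: delta_def)
  have lift: "free_lift ground_field ?g f = pairing delta f" for f
    unfolding free_lift_def word by (simp add: finsum_ground_field lin_def on_words_def)
  have "counit H (bc f) = induced (free_lift ground_field ?g) (bc f)"
    by (simp add: B_hopf_def hopf_algebra.defs module.defs)
  also have "\<dots> = free_lift ground_field ?g f"
    using mem_bc bc_eq_pairing compatible_delta unfolding lift by (intro induced_eq mem_bc_self) blast
  finally show ?thesis
    by (simp only: lift)
qed

lemma H_counit_ev: "x \<in> carrier B \<Longrightarrow> counit H x = ev delta x"
  by (auto simp: B_carrier H_counit ev_bc compatible_delta)

definition functional :: "('n, 'k) family \<Rightarrow> ('n \<times> 'n, 'k) free_algebra set \<Rightarrow> 'k" where
  "functional F = restrict (ev F) (carrier B)"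

lemma functional_closed: "compatible F \<Longrightarrow> functional F \<in> linear_functionals H"
  by (auto simp: functional_def linear_functionals_def ev_linear)

lemma fam_functional: "compatible F \<Longrightarrow> fam (functional F) = F"
  using compatible_balanced[of F] by (auto simp: fam_def functional_def ev_u balanced_def intro!: ext)

lemma compatible_fam_functional: "\<mu> \<in> linear_functionals H \<Longrightarrow> compatible (fam \<mu>)"
  by (rule compatible_fam) (auto simp: linear_functionals_def)

lemma functional_apply:
  assumes "\<mu> \<in> linear_functionals H"
  shows "\<mu> (bc f) = pairing (fam \<mu>) f"
proof -
  have "\<mu> (bc f) = pairing (\<lambda>I J. \<mu> (u I J)) f"
    using assms by (intro linear_on_class) (auto simp: linear_functionals_def)
  then show ?thesis
    by (simp add: fam_def cong: pairing_cong)
qed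

lemma functional_fam:
  assumes \<mu>: "\<mu> \<in> linear_functionals H"
  shows "functional (fam \<mu>) = \<mu>"
proof
  fix x
  show "functional (fam \<mu>) x = \<mu> x"
  proof (cases "x \<in> carrier B")
    case True
    then obtain f where "x = bc f"
      by (auto simp: B_carrier)
    then show ?thesis
      using True by (simp add: functional_def functional_apply[OF \<mu>] ev_bc compatible_fam_functional[OF \<mu>])
  next
    case False
    then show ?thesis
      using \<mu> by (simp add: functional_def linear_functionals_def extensional_def)
  qed
qed

lemma convolution_simps [simp]:
  "carrier (convolution H) = linear_functionals H"
  "\<one>\<^bsub>convolution H\<^esub> = functional delta"
  by (auto simp: convolution_def functional_def H_counit_ev)

lemma contract_functional:
  assumes "\<mu> \<in> linear_functionals H" "compatible G"
  shows "contract (\<lambda>x y. \<mu> x * ev G y) = conv (fam \<mu>) G" "contract (\<lambda>x y. \<mu> y * ev G x) = conv G (fam \<mu>)"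
proof -
  have bal: "balanced (conv (fam \<mu>) G)" "balanced (conv G (fam \<mu>))"
    using assms by (simp_all add: compatible_balanced compatible_fam_functional)
  have "contract (\<lambda>x y. \<mu> x * ev G y) I J = conv (fam \<mu>) G I J" "contract (\<lambda>x y. \<mu> y * ev G x) I J = conv G (fam \<mu>) I J" for I J
    using bal[THEN balancedD, of I J] assms(2)
    by (auto simp: contract_def conv_def fam_def ev_u mult.commute)
  then show "contract (\<lambda>x y. \<mu> x * ev G y) = conv (fam \<mu>) G" "contract (\<lambda>x y. \<mu> y * ev G x) = conv G (fam \<mu>)"
    by (auto intro!: ext)
qed

lemma bilinear_functional:
  assumes "\<mu> \<in> linear_functionals H" "compatible G"
  shows "bilinear_on B B (\<lambda>x y. \<mu> x * ev G y)" "bilinear_on B B (\<lambda>x y. \<mu> y * ev G x)"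
proof -
  have \<mu>: "\<mu> (x \<oplus>\<^bsub>B\<^esub> y) = \<mu> x + \<mu> y" "\<mu> (c \<odot>\<^bsub>B\<^esub> x) = c * \<mu> x" if "x \<in> carrier B" "y \<in> carrier B" for x y c
    using that assms(1) by (auto simp: linear_functionals_def)
  show "bilinear_on B B (\<lambda>x y. \<mu> x * ev G y)" "bilinear_on B B (\<lambda>x y. \<mu> y * ev G x)"
    by (rule bilinear_onI; simp add: \<mu> ev_linear[OF assms(2)] distrib_left distrib_right mult.left_commute)+
qed

lemma convolution_mult:
  assumes "\<mu> \<in> linear_functionals H" "\<nu> \<in> linear_functionals H"
  shows "\<mu> \<otimes>\<^bsub>convolution H\<^esub> \<nu> = functional (conv (fam \<mu>) (fam \<nu>))"
proof
  fix x
  have \<nu>: "\<nu> y = ev (fam \<nu>) y" if "y \<in> carrier B" for y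
    using fun_cong[OF functional_fam[OF assms(2)], of y] that by (simp add: functional_def)
  note c = compatible_fam_functional[OF assms(1)] compatible_fam_functional[OF assms(2)]
  have "sweedler_k H x (\<lambda>x1 x2. \<mu> x1 * \<nu> x2) = ev (conv (fam \<mu>) (fam \<nu>)) x" if x: "x \<in> carrier B"
  proof -
    obtain f where f: "x = bc f"
      using x by (auto simp: B_carrier)
    have "sweedler_k H x (\<lambda>x1 x2. \<mu> x1 * \<nu> x2) = sweedler_k H x (\<lambda>x1 x2. \<mu> x1 * ev (fam \<nu>) x2)"
      using \<nu> x bilinear_functional(1)[OF assms(1) c(2)] by (intro sweedler_k_cong[symmetric]) auto
    also have "\<dots> = ev (conv (fam \<mu>) (fam \<nu>)) x"
      using c by (simp add: f sweedler_k bilinear_functional[OF assms(1)] contract_functional[OF assms(1)] ev_bc compatible_conv)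
    finally show ?thesis .
  qed
  then show "(\<mu> \<otimes>\<^bsub>convolution H\<^esub> \<nu>) x = functional (conv (fam \<mu>) (fam \<nu>)) x"
    by (simp add: convolution_def functional_def)
qed

lemma fam_mult:
  assumes "\<mu> \<in> linear_functionals H" "\<nu> \<in> linear_functionals H"
  shows "fam (\<mu> \<otimes>\<^bsub>convolution H\<^esub> \<nu>) = conv (fam \<mu>) (fam \<nu>)"
  using assms by (simp add: convolution_mult fam_functional compatible_conv compatible_fam_functional)

lemma fam_inj: "\<mu> \<in> linear_functionals H \<Longrightarrow> \<nu> \<in> linear_functionals H \<Longrightarrow> fam \<mu> = fam \<nu> \<Longrightarrow> \<mu> = \<nu>"
  by (metis functional_fam)

lemma convolution_closed:
  "\<mu> \<in> linear_functionals H \<Longrightarrow> \<nu> \<in> linear_functionals H \<Longrightarrow> \<mu> \<otimes>\<^bsub>convolution H\<^esub> \<nu> \<in> linear_functionals H"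
  by (simp add: convolution_mult functional_closed compatible_conv compatible_fam_functional)

lemma fam_one: "fam (functional delta) = delta"
  by (rule fam_functional[OF compatible_delta])

text \<open>The monoid laws are pulled back from the matrix product along the injective map
  \<open>fam\<close>.\<close>

sublocale C: monoid "convolution H"
proof (rule monoidI; unfold convolution_simps)
  fix \<mu> \<nu> \<rho> assume *: "\<mu> \<in> linear_functionals H" "\<nu> \<in> linear_functionals H" "\<rho> \<in> linear_functionals H"
  show "\<mu> \<otimes>\<^bsub>convolution H\<^esub> \<nu> \<otimes>\<^bsub>convolution H\<^esub> \<rho> = \<mu> \<otimes>\<^bsub>convolution H\<^esub> (\<nu> \<otimes>\<^bsub>convolution H\<^esub> \<rho>)"
    using * by (intro fam_inj) (simp_all add: convolution_closed fam_mult conv_assoc)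
next
  fix \<mu> assume *: "\<mu> \<in> linear_functionals H"
  note one = functional_closed[OF compatible_delta]
  show "functional delta \<otimes>\<^bsub>convolution H\<^esub> \<mu> = \<mu>" "\<mu> \<otimes>\<^bsub>convolution H\<^esub> functional delta = \<mu>"
    using * one compatible_balanced[OF compatible_fam_functional[OF *]]
    by (auto intro!: fam_inj simp: convolution_closed fam_mult fam_one)
qed (simp_all add: convolution_closed functional_closed compatible_delta)

lemma convolution_UnitsI:
  assumes "compatible F" "compatible G" "conv F G = delta" "conv G F = delta"
  shows "functional F \<in> Units (convolution H)" "inv\<^bsub>convolution H\<^esub> functional F = functional G"
proof -
  have *: "functional F \<otimes>\<^bsub>convolution H\<^esub> functional G = \<one>\<^bsub>convolution H\<^esub>"
    "functional G \<otimes>\<^bsub>convolution H\<^esub> functional F = \<one>\<^bsub>convolution H\<^esub>"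
    using assms by (simp_all add: convolution_mult functional_closed fam_functional)
  then show U: "functional F \<in> Units (convolution H)"
    unfolding Units_def using assms by (auto simp: functional_closed)
  show "inv\<^bsub>convolution H\<^esub> functional F = functional G"
    using C.inv_unique[OF C.Units_l_inv[OF U] *(1)] assms C.Units_inv_closed[OF U] by (simp add: functional_closed)
qed

lemma fam_unit:
  assumes "\<mu> \<in> Units (convolution H)"
  shows "\<mu> \<in> linear_functionals H" "inv\<^bsub>convolution H\<^esub> \<mu> \<in> linear_functionals H"
    "conv (fam \<mu>) (fam (inv\<^bsub>convolution H\<^esub> \<mu>)) = delta" "conv (fam (inv\<^bsub>convolution H\<^esub> \<mu>)) (fam \<mu>) = delta"
proof -
  show *: "\<mu> \<in> linear_functionals H" "inv\<^bsub>convolution H\<^esub> \<mu> \<in> linear_functionals H"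
    using C.Units_closed[OF assms] C.Units_inv_closed[OF assms] by simp_all
  show "conv (fam \<mu>) (fam (inv\<^bsub>convolution H\<^esub> \<mu>)) = delta" "conv (fam (inv\<^bsub>convolution H\<^esub> \<mu>)) (fam \<mu>) = delta"
    using fam_mult[OF *] fam_mult[OF *(2,1)] C.Units_r_inv[OF assms] C.Units_l_inv[OF assms]
    by (simp_all add: fam_one)
qed

text \<open>Applying a functional F to the two sides of the laziness condition gives the products of
  \<open>fam \<mu>\<close> with F in the two orders.\<close>

lemma lazy_iff_central:
  assumes \<mu>: "\<mu> \<in> linear_functionals H"
  shows "(\<forall>x\<in>carrier B. sweedler H H x (\<lambda>x1 x2. \<mu> x1 \<odot>\<^bsub>H\<^esub> x2) = sweedler H H x (\<lambda>x1 x2. \<mu> x2 \<odot>\<^bsub>H\<^esub> x1))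
    \<longleftrightarrow> central (fam \<mu>)"
proof -
  have bil: "bilinear_on B B (\<lambda>x y. ev F (\<mu> x \<odot>\<^bsub>B\<^esub> y))" "bilinear_on B B (\<lambda>x y. ev F (\<mu> y \<odot>\<^bsub>B\<^esub> x))"
    and con: "contract (\<lambda>x y. ev F (\<mu> x \<odot>\<^bsub>B\<^esub> y)) = conv (fam \<mu>) F" "contract (\<lambda>x y. ev F (\<mu> y \<odot>\<^bsub>B\<^esub> x)) = conv F (fam \<mu>)"
    if F: "compatible F" for F
  proof -
    have eq: "ev F (\<mu> x \<odot>\<^bsub>B\<^esub> y) = \<mu> x * ev F y" if "y \<in> carrier B" for x y
      using ev_linear(2)[OF F that] .
    show "bilinear_on B B (\<lambda>x y. ev F (\<mu> x \<odot>\<^bsub>B\<^esub> y))" "bilinear_on B B (\<lambda>x y. ev F (\<mu> y \<odot>\<^bsub>B\<^esub> x))"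
      using bilinear_functional[OF \<mu> F] by (subst bilinear_cong; simp add: eq)+
    have "contract (\<lambda>x y. ev F (\<mu> x \<odot>\<^bsub>B\<^esub> y)) = contract (\<lambda>x y. \<mu> x * ev F y)"
      "contract (\<lambda>x y. ev F (\<mu> y \<odot>\<^bsub>B\<^esub> x)) = contract (\<lambda>x y. \<mu> y * ev F x)"
      by (auto simp: contract_def eq intro!: ext)
    then show "contract (\<lambda>x y. ev F (\<mu> x \<odot>\<^bsub>B\<^esub> y)) = conv (fam \<mu>) F" "contract (\<lambda>x y. ev F (\<mu> y \<odot>\<^bsub>B\<^esub> x)) = conv F (fam \<mu>)"
      by (simp_all add: contract_functional[OF \<mu> F])
  qed
  have s1: "sweedler H H (bc f) (\<lambda>x1 x2. \<mu> x1 \<odot>\<^bsub>B\<^esub> x2) \<in> carrier B"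
    "compatible F \<Longrightarrow> ev F (sweedler H H (bc f) (\<lambda>x1 x2. \<mu> x1 \<odot>\<^bsub>B\<^esub> x2)) = pairing (conv (fam \<mu>) F) f" for f F
    using sweedler_B[of "\<lambda>x1 x2. \<mu> x1 \<odot>\<^bsub>B\<^esub> x2"] bil(1) con(1) by auto
  have s2: "sweedler H H (bc f) (\<lambda>x1 x2. \<mu> x2 \<odot>\<^bsub>B\<^esub> x1) \<in> carrier B"
    "compatible F \<Longrightarrow> ev F (sweedler H H (bc f) (\<lambda>x1 x2. \<mu> x2 \<odot>\<^bsub>B\<^esub> x1)) = pairing (conv F (fam \<mu>)) f" for f F
    using sweedler_B[of "\<lambda>x1 x2. \<mu> x2 \<odot>\<^bsub>B\<^esub> x1"] bil(2) con(2) by auto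
  have "(\<forall>x\<in>carrier B. sweedler H H x (\<lambda>x1 x2. \<mu> x1 \<odot>\<^bsub>B\<^esub> x2) = sweedler H H x (\<lambda>x1 x2. \<mu> x2 \<odot>\<^bsub>B\<^esub> x1))
    \<longleftrightarrow> (\<forall>f F. compatible F \<longrightarrow> pairing (conv (fam \<mu>) F) f = pairing (conv F (fam \<mu>)) f)"
  proof (intro iffI allI impI ballI)
    fix f F assume *: "\<forall>x\<in>carrier B. sweedler H H x (\<lambda>x1 x2. \<mu> x1 \<odot>\<^bsub>B\<^esub> x2) = sweedler H H x (\<lambda>x1 x2. \<mu> x2 \<odot>\<^bsub>B\<^esub> x1)"
      and F: "compatible F"
    have "bc f \<in> carrier B"
      by (simp add: B_carrier)
    then show "pairing (conv (fam \<mu>) F) f = pairing (conv F (fam \<mu>)) f"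
      using s1(2)[OF F, of f] s2(2)[OF F, of f] * by simp
  next
    fix x assume *: "\<forall>f F. compatible F \<longrightarrow> pairing (conv (fam \<mu>) F) f = pairing (conv F (fam \<mu>)) f" and "x \<in> carrier B"
    then obtain f where "x = bc f"
      by (auto simp: B_carrier)
    then show "sweedler H H x (\<lambda>x1 x2. \<mu> x1 \<odot>\<^bsub>B\<^esub> x2) = sweedler H H x (\<lambda>x1 x2. \<mu> x2 \<odot>\<^bsub>B\<^esub> x1)"
      using * by (intro B_eqI) (simp_all add: s1 s2)
  qed
  also have "\<dots> \<longleftrightarrow> central (fam \<mu>)"
  proof
    assume *: "\<forall>f F. compatible F \<longrightarrow> pairing (conv (fam \<mu>) F) f = pairing (conv F (fam \<mu>)) f"
    have "conv (fam \<mu>) F I J = conv F (fam \<mu>) I J" if F: "compatible F" for F I J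
    proof (cases "length I = length J")
      case True
      then show ?thesis
        using *[rule_format, OF F, of "mono (zip I J)"] by (simp add: on_words_def)
    next
      case False
      then show ?thesis
        using F \<mu> by (simp add: balancedD compatible_balanced compatible_fam_functional)
    qed
    then show "central (fam \<mu>)"
      unfolding central_def using compatible_balanced[OF compatible_fam_functional[OF \<mu>]] by (auto intro!: ext)
  qed (simp add: centralD)
  finally show ?thesis
    by simp
qed

lemma lazy_functionals_iff:
  "\<mu> \<in> lazy_functionals H \<longleftrightarrow> \<mu> \<in> Units (convolution H) \<and> fam \<mu> [] [] = 1 \<and> central (fam \<mu>)"
proof -
  have "fam \<mu> [] [] = \<mu> \<one>\<^bsub>H\<^esub>"
    by (simp add: fam_def u_Nil)
  then show ?thesis
    using lazy_iff_central[of \<mu>] fam_unit(1)[of \<mu>] by (auto simp: lazy_functionals_def)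
qed

lemma lazy_mult:
  assumes "\<mu> \<in> lazy_functionals H" "\<nu> \<in> lazy_functionals H"
  shows "\<mu> \<otimes>\<^bsub>convolution H\<^esub> \<nu> \<in> lazy_functionals H"
proof -
  have *: "\<mu> \<in> Units (convolution H)" "\<nu> \<in> Units (convolution H)"
    using assms by (simp_all add: lazy_functionals_iff)
  then show ?thesis
    using assms by (simp add: lazy_functionals_iff fam_mult fam_unit(1) central_conv) (simp add: conv_def)
qed

lemma lazy_inv:
  assumes "\<mu> \<in> lazy_functionals H"
  shows "inv\<^bsub>convolution H\<^esub> \<mu> \<in> lazy_functionals H"
proof -
  have *: "\<mu> \<in> Units (convolution H)" "central (fam \<mu>)" "fam \<mu> [] [] = 1"
    using assms by (simp_all add: lazy_functionals_iff)
  note f = fam_unit[OF *(1)]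
  have "central (fam (inv\<^bsub>convolution H\<^esub> \<mu>))"
    by (rule central_inverse[OF *(2) compatible_balanced[OF compatible_fam_functional[OF f(2)]] f(3,4)])
  moreover have "fam (inv\<^bsub>convolution H\<^esub> \<mu>) [] [] = 1"
    using fun_cong[OF fun_cong[OF f(3)], of "[]" "[]"] *(3) by (simp add: conv_def delta_def)
  ultimately show ?thesis
    using *(1) by (simp add: lazy_functionals_iff)
qed

section \<open>Cocycles and coboundaries in terms of monomials\<close>

lemma bilinear_forms_iff:
  "\<sigma> \<in> bilinear_forms H \<longleftrightarrow> \<sigma> \<in> extensional (carrier B \<times> carrier B) \<and> bilinear_on B B (\<lambda>x y. \<sigma> (x, y))"
  by (simp add: bilinear_forms_def bilinear_on_def)

lemma bilinear_formD: "\<sigma> \<in> bilinear_forms H \<Longrightarrow> bilinear_on B B (\<lambda>x y. \<sigma> (x, y))"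
  by (simp add: bilinear_forms_iff)

lemma bilinear_form_eqI:
  assumes "\<sigma> \<in> bilinear_forms H" "\<tau> \<in> bilinear_forms H"
    and "\<And>I J K L. length I = length J \<Longrightarrow> length K = length L \<Longrightarrow> \<sigma> (u I J, u K L) = \<tau> (u I J, u K L)"
  shows "\<sigma> = \<tau>"
proof (rule extensionalityI[of _ "carrier B \<times> carrier B"])
  fix z assume "z \<in> carrier B \<times> carrier B"
  then show "\<sigma> z = \<tau> z"
    using bilinear_eqI[of "\<lambda>x y. \<sigma> (x, y)" "\<lambda>x y. \<tau> (x, y)" "fst z" "snd z"] assms
    by (auto simp: bilinear_forms_iff)
qed (use assms in \<open>simp_all add: bilinear_forms_iff\<close>)

lemma restrict_bilinear_form:
  assumes "bilinear_on B B b"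
  shows "(\<lambda>(x, y)\<in>carrier B \<times> carrier B. b x y) \<in> bilinear_forms H"
  unfolding bilinear_forms_iff using assms by (subst bilinear_cong[where b' = b]) auto

lemma bilinear_functional_mult:
  assumes "\<And>x y. x \<in> carrier B \<Longrightarrow> y \<in> carrier B \<Longrightarrow> \<phi> (x \<oplus>\<^bsub>B\<^esub> y) = \<phi> x + \<phi> y"
    and "\<And>c x. x \<in> carrier B \<Longrightarrow> \<phi> (c \<odot>\<^bsub>B\<^esub> x) = c * \<phi> x"
  shows "bilinear_on B B (\<lambda>x y. \<phi> (x \<otimes>\<^bsub>B\<^esub> y))"
  by (rule bilinear_onI) (simp_all add: assms B.l_distr B.r_distr B.smult_left B.smult_right)

lemma bilinear_mult:
  assumes "bilinear_on B B b" "z \<in> carrier B"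
  shows "bilinear_on B B (\<lambda>x y. b (x \<otimes>\<^bsub>B\<^esub> y) z)" "bilinear_on B B (\<lambda>x y. b z (x \<otimes>\<^bsub>B\<^esub> y))"
  using assms by (auto intro!: bilinear_functional_mult simp: bilinear_onD)

lemma bilinear_ev_mult: "compatible F \<Longrightarrow> bilinear_on B B (\<lambda>x y. ev F (x \<otimes>\<^bsub>B\<^esub> y))"
  by (rule bilinear_functional_mult) (simp_all add: ev_linear)

lemma bilinear_product:
  assumes "\<mu> \<in> linear_functionals H" "\<nu> \<in> linear_functionals H"
  shows "bilinear_on B B (\<lambda>x y. \<mu> x * \<nu> y)"
  using assms by (intro bilinear_onI) (auto simp: linear_functionals_def distrib_left distrib_right)

lemma convolution2_mult:
  "x \<in> carrier B \<Longrightarrow> y \<in> carrier B \<Longrightarrow>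
    (\<sigma> \<otimes>\<^bsub>convolution2 H\<^esub> \<tau>) (x, y) = sweedler2 (\<lambda>x y. \<sigma> (x, y)) (\<lambda>x y. \<tau> (x, y)) x y"
  by (simp add: convolution2_def)

lemma convolution2_closed:
  assumes "\<sigma> \<in> bilinear_forms H" "\<tau> \<in> bilinear_forms H"
  shows "\<sigma> \<otimes>\<^bsub>convolution2 H\<^esub> \<tau> \<in> bilinear_forms H"
  using restrict_bilinear_form[OF sweedler2_bilinear[OF bilinear_formD[OF assms(1)] bilinear_formD[OF assms(2)]]]
  by (simp add: convolution2_def)

lemma convolution2_u:
  assumes "\<sigma> \<in> bilinear_forms H" "\<tau> \<in> bilinear_forms H" "length I = length J" "length K = length L"
  shows "(\<sigma> \<otimes>\<^bsub>convolution2 H\<^esub> \<tau>) (u I J, u K L) =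
    (\<Sum>M\<in>words (length I). \<Sum>N\<in>words (length K). \<sigma> (u I M, u K N) * \<tau> (u M J, u N L))"
  using assms by (simp add: convolution2_mult sweedler2_u bilinear_formD)

lemma counit_u: "length I = length J \<Longrightarrow> counit H (u I J) = delta I J"
  by (simp add: H_counit_ev ev_u compatible_delta)

definition fam2 :: "(_ \<times> _ \<Rightarrow> 'k) \<Rightarrow> ('n, 'k) family2" where
  "fam2 \<sigma> I J K L = (if length I = length J \<and> length K = length L then \<sigma> (u I J, u K L) else 0)"

lemma compatible_fam2:
  assumes "\<sigma> \<in> bilinear_forms H"
  shows "length K = length L \<Longrightarrow> compatible (\<lambda>I J. fam2 \<sigma> I J K L)"
    "length I = length J \<Longrightarrow> compatible (\<lambda>K L. fam2 \<sigma> I J K L)"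
  using bilinear_compatible(1)[OF bilinear_formD[OF assms], of "u I J"]
    bilinear_compatible(2)[OF bilinear_formD[OF assms], of "u K L"]
  by (simp_all add: fam2_def fam_def)

lemma sweedler_lazy:
  assumes "\<sigma> \<in> bilinear_forms H" "x \<in> carrier B" "y \<in> carrier B"
  shows "sweedler H H x (\<lambda>x1 x2. sweedler H H y (\<lambda>y1 y2. \<sigma> (x1, y1) \<odot>\<^bsub>B\<^esub> (x2 \<otimes>\<^bsub>B\<^esub> y2))) \<in> carrier B"
    and "sweedler H H x (\<lambda>x1 x2. sweedler H H y (\<lambda>y1 y2. \<sigma> (x2, y2) \<odot>\<^bsub>B\<^esub> (x1 \<otimes>\<^bsub>B\<^esub> y1))) \<in> carrier B"
    and "compatible F \<Longrightarrow> ev F (sweedler H H x (\<lambda>x1 x2. sweedler H H y (\<lambda>y1 y2. \<sigma> (x1, y1) \<odot>\<^bsub>B\<^esub> (x2 \<otimes>\<^bsub>B\<^esub> y2)))) =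
      sweedler2 (\<lambda>x y. \<sigma> (x, y)) (\<lambda>x y. ev F (x \<otimes>\<^bsub>B\<^esub> y)) x y"
    and "compatible F \<Longrightarrow> ev F (sweedler H H x (\<lambda>x1 x2. sweedler H H y (\<lambda>y1 y2. \<sigma> (x2, y2) \<odot>\<^bsub>B\<^esub> (x1 \<otimes>\<^bsub>B\<^esub> y1)))) =
      sweedler2 (\<lambda>x y. ev F (x \<otimes>\<^bsub>B\<^esub> y)) (\<lambda>x y. \<sigma> (x, y)) x y"
proof -
  note p = bilinear_formD[OF assms(1)] and q = bilinear_ev_mult
  show "sweedler H H x (\<lambda>x1 x2. sweedler H H y (\<lambda>y1 y2. \<sigma> (x1, y1) \<odot>\<^bsub>B\<^esub> (x2 \<otimes>\<^bsub>B\<^esub> y2))) \<in> carrier B"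
    by (rule sweedler2_B(1)[where p = "\<lambda>F x y. \<sigma> (x, y)" and q = "\<lambda>F x y. ev F (x \<otimes>\<^bsub>B\<^esub> y)"])
      (simp_all add: ev_linear p q assms)
  show "sweedler H H x (\<lambda>x1 x2. sweedler H H y (\<lambda>y1 y2. \<sigma> (x2, y2) \<odot>\<^bsub>B\<^esub> (x1 \<otimes>\<^bsub>B\<^esub> y1))) \<in> carrier B"
    by (rule sweedler2_B(1)[where p = "\<lambda>F x y. ev F (x \<otimes>\<^bsub>B\<^esub> y)" and q = "\<lambda>F x y. \<sigma> (x, y)"])
      (simp_all add: ev_linear p q assms)
  assume F: "compatible F"
  show "ev F (sweedler H H x (\<lambda>x1 x2. sweedler H H y (\<lambda>y1 y2. \<sigma> (x1, y1) \<odot>\<^bsub>B\<^esub> (x2 \<otimes>\<^bsub>B\<^esub> y2)))) =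
      sweedler2 (\<lambda>x y. \<sigma> (x, y)) (\<lambda>x y. ev F (x \<otimes>\<^bsub>B\<^esub> y)) x y"
    by (rule sweedler2_B(2)[where p = "\<lambda>F x y. \<sigma> (x, y)" and q = "\<lambda>F x y. ev F (x \<otimes>\<^bsub>B\<^esub> y)"])
      (simp_all add: ev_linear p q assms F)
  show "ev F (sweedler H H x (\<lambda>x1 x2. sweedler H H y (\<lambda>y1 y2. \<sigma> (x2, y2) \<odot>\<^bsub>B\<^esub> (x1 \<otimes>\<^bsub>B\<^esub> y1)))) =
      sweedler2 (\<lambda>x y. ev F (x \<otimes>\<^bsub>B\<^esub> y)) (\<lambda>x y. \<sigma> (x, y)) x y"
    by (rule sweedler2_B(2)[where p = "\<lambda>F x y. ev F (x \<otimes>\<^bsub>B\<^esub> y)" and q = "\<lambda>F x y. \<sigma> (x, y)"])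
      (simp_all add: ev_linear p q assms F)
qed

text \<open>Every condition is read off at monomials, where double Sweedler sums become sums over
  pairs of intermediate words.\<close>

lemma lazy_cocycle_family:
  assumes \<sigma>: "\<sigma> \<in> lazy_cocycles H"
  obtains t where "lazy_cocycle_family (\<lambda>i j. E $ i $ j) (\<lambda>i j. D $ i $ j) (fam2 \<sigma>) t"
proof -
  from \<sigma> obtain \<tau> where bf: "\<sigma> \<in> bilinear_forms H" "\<tau> \<in> bilinear_forms H"
    and inv: "\<sigma> \<otimes>\<^bsub>convolution2 H\<^esub> \<tau> = \<one>\<^bsub>convolution2 H\<^esub>" "\<tau> \<otimes>\<^bsub>convolution2 H\<^esub> \<sigma> = \<one>\<^bsub>convolution2 H\<^esub>"
    by (auto simp: lazy_cocycles_def Units_def convolution2_def)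
  note bil = bilinear_formD[OF bf(1)]
  have one: "\<one>\<^bsub>convolution2 H\<^esub> (u I J, u K L) = delta I J * delta K L"
    if "length I = length J" "length K = length L" for I J K L
    using that by (simp add: convolution2_def counit_u)
  have "lazy_cocycle_family (\<lambda>i j. E $ i $ j) (\<lambda>i j. D $ i $ j) (fam2 \<sigma>) (fam2 \<tau>)"
  proof
    show "balanced2 (fam2 \<sigma>)" "balanced2 (fam2 \<tau>)"
      by (simp_all add: balanced2_def fam2_def)
  next
    fix K L :: "'n list"
    have unit: "\<sigma> (\<one>\<^bsub>B\<^esub>, x) = counit H x" "\<sigma> (x, \<one>\<^bsub>B\<^esub>) = counit H x" if "x \<in> carrier B" for x
      using \<sigma> that by (simp_all add: lazy_cocycles_def)
    show "fam2 \<sigma> [] [] K L = delta K L" "fam2 \<sigma> K L [] [] = delta K L"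
      by (auto simp: fam2_def unit u_Nil counit_u) (auto simp: delta_def)
  next
    fix I J K L P Q :: "'n list"
    assume len: "length I = length J" "length K = length L" "length P = length Q"
    have "sweedler2 (\<lambda>x y. \<sigma> (x \<otimes>\<^bsub>B\<^esub> y, u P Q)) (\<lambda>x y. \<sigma> (x, y)) (u I J) (u K L) =
        sweedler2 (\<lambda>x y. \<sigma> (u I J, x \<otimes>\<^bsub>B\<^esub> y)) (\<lambda>x y. \<sigma> (x, y)) (u K L) (u P Q)"
      using \<sigma> by (simp add: lazy_cocycles_def)
    then show "(\<Sum>M\<in>words (length I). \<Sum>N\<in>words (length K). fam2 \<sigma> (I @ K) (M @ N) P Q * fam2 \<sigma> M J N L) =
        (\<Sum>N\<in>words (length K). \<Sum>R\<in>words (length P). fam2 \<sigma> I J (K @ P) (N @ R) * fam2 \<sigma> N L R Q)"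
      using len by (simp add: sweedler2_u bilinear_mult[OF bil] bil u_mult fam2_def)
  next
    fix F and I J K L :: "'n list"
    assume F: "compatible F" and len: "length I = length J" "length K = length L"
    have "sweedler2 (\<lambda>x y. \<sigma> (x, y)) (\<lambda>x y. ev F (x \<otimes>\<^bsub>B\<^esub> y)) (u I J) (u K L) =
        sweedler2 (\<lambda>x y. ev F (x \<otimes>\<^bsub>B\<^esub> y)) (\<lambda>x y. \<sigma> (x, y)) (u I J) (u K L)"
      using \<sigma> sweedler_lazy(3,4)[OF bf(1) u_carrier[of I J] u_carrier[of K L] F] by (simp add: lazy_cocycles_def)
    then show "(\<Sum>M\<in>words (length I). \<Sum>N\<in>words (length K). fam2 \<sigma> I M K N * F (M @ N) (J @ L)) =
        (\<Sum>M\<in>words (length I). \<Sum>N\<in>words (length K). F (I @ K) (M @ N) * fam2 \<sigma> M J N L)"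
      using len by (simp add: sweedler2_u bilinear_ev_mult[OF F] bil u_mult fam2_def ev_u[OF F])
  next
    fix I J K L :: "'n list"
    assume len: "length I = length J" "length K = length L"
    show "(\<Sum>M\<in>words (length I). \<Sum>N\<in>words (length K). fam2 \<sigma> I M K N * fam2 \<tau> M J N L) = delta I J * delta K L"
      "(\<Sum>M\<in>words (length I). \<Sum>N\<in>words (length K). fam2 \<tau> I M K N * fam2 \<sigma> M J N L) = delta I J * delta K L"
      using convolution2_u[OF bf len] convolution2_u[OF bf(2,1) len] one[OF len] len by (simp_all add: inv fam2_def)
  qed (simp_all add: compatible_fam2 bf)
  then show thesis
    by (rule that)
qed

lemma coboundary_eq:
  "coboundary H \<mu> = (\<lambda>(x, y)\<in>carrier B \<times> carrier B.
    sweedler2 (\<lambda>x y. \<mu> x * \<mu> y) (\<lambda>x y. (inv\<^bsub>convolution H\<^esub> \<mu>) (x \<otimes>\<^bsub>B\<^esub> y)) x y)"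
  by (simp add: coboundary_def)

lemma
  assumes \<mu>: "\<mu> \<in> Units (convolution H)"
  shows coboundary_closed: "coboundary H \<mu> \<in> bilinear_forms H"
    and coboundary_u: "length I = length J \<Longrightarrow> length K = length L \<Longrightarrow> coboundary H \<mu> (u I J, u K L) =
      conv (tensor (length I) (fam \<mu>) (fam \<mu>)) (fam (inv\<^bsub>convolution H\<^esub> \<mu>)) (I @ K) (J @ L)"
proof -
  note lf = fam_unit[OF \<mu>]
  have p: "bilinear_on B B (\<lambda>x y. \<mu> x * \<mu> y)"
    by (rule bilinear_product[OF lf(1,1)])
  have q: "bilinear_on B B (\<lambda>x y. (inv\<^bsub>convolution H\<^esub> \<mu>) (x \<otimes>\<^bsub>B\<^esub> y))"
    using lf(2) by (intro bilinear_functional_mult) (auto simp: linear_functionals_def)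
  show "coboundary H \<mu> \<in> bilinear_forms H"
    unfolding coboundary_eq by (rule restrict_bilinear_form[OF sweedler2_bilinear[OF p q]])
  assume len: "length I = length J" "length K = length L"
  then show "coboundary H \<mu> (u I J, u K L) =
      conv (tensor (length I) (fam \<mu>) (fam \<mu>)) (fam (inv\<^bsub>convolution H\<^esub> \<mu>)) (I @ K) (J @ L)"
    by (simp add: coboundary_eq sweedler2_u[OF p q] conv_def sum_words_add tensor_def) (simp add: fam_def u_mult)
qed

text \<open>The inverse of \<open>\<mu>\<close> on the product has to pass \<open>\<nu>\<close>
  \<otimes> \<open>\<nu>\<close>. This works since the tensor square of a central family is central
  and the inverse of \<open>\<mu>\<close> is compatible.\<close>

lemma coboundary_mult:
  assumes \<mu>: "\<mu> \<in> lazy_functionals H" and \<nu>: "\<nu> \<in> lazy_functionals H"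
  shows "coboundary H (\<mu> \<otimes>\<^bsub>convolution H\<^esub> \<nu>) = coboundary H \<mu> \<otimes>\<^bsub>convolution2 H\<^esub> coboundary H \<nu>"
proof (rule bilinear_form_eqI)
  have U: "\<mu> \<in> Units (convolution H)" "\<nu> \<in> Units (convolution H)" "\<mu> \<otimes>\<^bsub>convolution H\<^esub> \<nu> \<in> Units (convolution H)"
    and cen: "central (fam \<nu>)" "central (fam (inv\<^bsub>convolution H\<^esub> \<mu>))"
    using assms lazy_mult[OF assms] lazy_inv[OF \<mu>] by (simp_all add: lazy_functionals_iff)
  show "coboundary H (\<mu> \<otimes>\<^bsub>convolution H\<^esub> \<nu>) \<in> bilinear_forms H"
    "coboundary H \<mu> \<otimes>\<^bsub>convolution2 H\<^esub> coboundary H \<nu> \<in> bilinear_forms H"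
    using U by (simp_all add: coboundary_closed convolution2_closed)
  note lf = fam_unit(1,2)[OF U(1)] fam_unit(1,2)[OF U(2)]
  let ?X = "fam \<mu>" and ?X' = "fam (inv\<^bsub>convolution H\<^esub> \<mu>)" and ?Y = "fam \<nu>" and ?Y' = "fam (inv\<^bsub>convolution H\<^esub> \<nu>)"
  note comp = lf[THEN compatible_fam_functional]
  \<comment> \<open>The inverse of the product comes with its factors in reversed order; they are
    exchanged because the inverse of \<open>\<mu>\<close> is central.\<close>
  have XY': "fam (inv\<^bsub>convolution H\<^esub> (\<mu> \<otimes>\<^bsub>convolution H\<^esub> \<nu>)) = conv ?X' ?Y'"
  proof -
    let ?P = "fam (inv\<^bsub>convolution H\<^esub> (\<mu> \<otimes>\<^bsub>convolution H\<^esub> \<nu>))"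
    have "conv ?X (conv (conv ?Y ?Y') ?X') = delta"
      using fam_unit(3)[OF U(1)] fam_unit(3)[OF U(2)] by simp
    then have "?P = conv ?P (conv (conv ?X ?Y) (conv ?Y' ?X'))"
      using compatible_balanced[OF compatible_fam_functional[OF fam_unit(2)[OF U(3)]]] by (simp add: conv_assoc)
    also have "\<dots> = conv (conv ?P (fam (\<mu> \<otimes>\<^bsub>convolution H\<^esub> \<nu>))) (conv ?Y' ?X')"
      by (simp only: fam_mult[OF lf(1,3)] conv_assoc)
    also have "\<dots> = conv ?Y' ?X'"
      by (simp add: fam_unit(4)[OF U(3)])
    finally show ?thesis
      using centralD[OF cen(2) comp(4)] by simp
  qed
  fix I J K L :: "'n list"
  assume len: "length I = length J" "length K = length L"
  define m where "m = length I"
  have s: "coboundary H \<mu> (u I M, u K N) = conv (tensor m ?X ?X) ?X' (I @ K) (M @ N)"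
    "coboundary H \<nu> (u M J, u N L) = conv (tensor m ?Y ?Y) ?Y' (M @ N) (J @ L)"
    if "length M = length I" "length N = length K" for M N
    using that len coboundary_u[OF U(1), of I M K N] coboundary_u[OF U(2), of M J N L] by (simp_all add: m_def)
  have "(coboundary H \<mu> \<otimes>\<^bsub>convolution2 H\<^esub> coboundary H \<nu>) (u I J, u K L) =
      conv (conv (tensor m ?X ?X) ?X') (conv (tensor m ?Y ?Y) ?Y') (I @ K) (J @ L)"
    using len U by (simp add: convolution2_u coboundary_closed s conv_def[of "conv (tensor m ?X ?X) ?X'"] sum_words_add)
  also have "conv (conv (tensor m ?X ?X) ?X') (conv (tensor m ?Y ?Y) ?Y') =
      conv (tensor m ?X ?X) (conv (conv ?X' (tensor m ?Y ?Y)) ?Y')"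
    by (simp only: conv_assoc)
  also have "\<dots> = conv (conv (tensor m ?X ?X) (tensor m ?Y ?Y)) (conv ?X' ?Y')"
    unfolding centralD[OF central_tensor[OF cen(1,1)] comp(2), symmetric] conv_assoc ..
  also have "\<dots> = conv (tensor m (fam (\<mu> \<otimes>\<^bsub>convolution H\<^esub> \<nu>)) (fam (\<mu> \<otimes>\<^bsub>convolution H\<^esub> \<nu>)))
      (fam (inv\<^bsub>convolution H\<^esub> (\<mu> \<otimes>\<^bsub>convolution H\<^esub> \<nu>)))"
    by (simp only: XY' conv_tensor fam_mult[OF lf(1,3)])
  finally show "coboundary H (\<mu> \<otimes>\<^bsub>convolution H\<^esub> \<nu>) (u I J, u K L) =
      (coboundary H \<mu> \<otimes>\<^bsub>convolution2 H\<^esub> coboundary H \<nu>) (u I J, u K L)"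
    using coboundary_u[OF U(3) len] by (simp add: m_def)
qed

lemma sum_delta_pair:
  fixes h :: "'n list \<Rightarrow> 'n list \<Rightarrow> 'k"
  assumes "length J = m" "length L = n"
  shows "(\<Sum>M\<in>words m. \<Sum>N\<in>words n. delta J M * delta L N * h M N) = h J L"
    and "(\<Sum>M\<in>words m. \<Sum>N\<in>words n. h M N * (delta M J * delta N L)) = h J L"
proof -
  have "(\<Sum>N\<in>words n. delta J M * delta L N * h M N) = (if J = M then \<Sum>N\<in>words n. if L = N then h M N else 0 else 0)"
    "(\<Sum>N\<in>words n. h M N * (delta M J * delta N L)) = (if M = J then \<Sum>N\<in>words n. if N = L then h M N else 0 else 0)" for M
    by (cases "J = M"; simp add: delta_def if_distrib[of "\<lambda>x. x * _"] if_distrib[of "\<lambda>x. _ * x"] cong: if_cong)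
      (cases "M = J"; simp add: delta_def if_distrib[of "\<lambda>x. x * _"] if_distrib[of "\<lambda>x. _ * x"] cong: if_cong)
  then show "(\<Sum>M\<in>words m. \<Sum>N\<in>words n. delta J M * delta L N * h M N) = h J L"
    "(\<Sum>M\<in>words m. \<Sum>N\<in>words n. h M N * (delta M J * delta N L)) = h J L"
    using assms by simp_all
qed

lemma counit_linear:
  "x \<in> carrier B \<Longrightarrow> y \<in> carrier B \<Longrightarrow> counit H (x \<oplus>\<^bsub>B\<^esub> y) = counit H x + counit H y"
  "x \<in> carrier B \<Longrightarrow> counit H (c \<odot>\<^bsub>B\<^esub> x) = c * counit H x"
  by (simp_all add: H_counit_ev ev_linear compatible_delta)

text \<open>This provides an element of the carrier, without which the quotient would have no cosets
  at all.\<close>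

lemma one_lazy_cocycle: "\<one>\<^bsub>convolution2 H\<^esub> \<in> lazy_cocycles H"
proof -
  let ?e = "\<one>\<^bsub>convolution2 H\<^esub>"
  have e: "?e (x, y) = counit H x * counit H y" if "x \<in> carrier B" "y \<in> carrier B" for x y
    using that by (simp add: convolution2_def)
  have "bilinear_on B B (\<lambda>x y. counit H x * counit H y)"
    by (rule bilinear_onI) (simp_all add: counit_linear distrib_left distrib_right)
  from restrict_bilinear_form[OF this] have bf: "?e \<in> bilinear_forms H"
    by (simp add: convolution2_def)
  note bil = bilinear_formD[OF bf]
  have e_u: "?e (u I J, u K L) = delta I J * delta K L" if "length I = length J" "length K = length L" for I J K L
    using that by (simp add: e counit_u)
  have "?e \<otimes>\<^bsub>convolution2 H\<^esub> ?e = ?e"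
  proof (rule bilinear_form_eqI[OF convolution2_closed[OF bf bf] bf])
    fix I J K L :: "'n list" assume len: "length I = length J" "length K = length L"
    have "(?e \<otimes>\<^bsub>convolution2 H\<^esub> ?e) (u I J, u K L) =
        (\<Sum>M\<in>words (length I). \<Sum>N\<in>words (length K). delta I M * delta K N * ?e (u M J, u N L))"
      using len by (simp add: convolution2_u[OF bf bf] e_u)
    then show "(?e \<otimes>\<^bsub>convolution2 H\<^esub> ?e) (u I J, u K L) = ?e (u I J, u K L)"
      by (simp add: sum_delta_pair)
  qed
  moreover have carrier2: "carrier (convolution2 H) = bilinear_forms H"
    by (simp add: convolution2_def)
  ultimately have unit: "?e \<in> Units (convolution2 H)"
    using bf carrier2 unfolding Units_def by blast
  have app: "delta (I @ K) (J @ L) = delta I J * (delta K L :: 'k)" if "length I = length J" for I J K L :: "'n list"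
    using that by (auto simp: delta_def)
  have cocycle: "sweedler2 (\<lambda>x y. ?e (x \<otimes>\<^bsub>B\<^esub> y, z)) (\<lambda>x y. ?e (x, y)) x y = counit H x * counit H y * counit H z"
    "sweedler2 (\<lambda>x y. ?e (z, x \<otimes>\<^bsub>B\<^esub> y)) (\<lambda>x y. ?e (x, y)) x y = counit H z * counit H x * counit H y"
    if c: "x \<in> carrier B" "y \<in> carrier B" "z \<in> carrier B" for x y z
  proof -
    note m = bilinear_mult[OF bil c(3)]
    show "sweedler2 (\<lambda>x y. ?e (x \<otimes>\<^bsub>B\<^esub> y, z)) (\<lambda>x y. ?e (x, y)) x y = counit H x * counit H y * counit H z"
    proof (rule bilinear_eqI[OF sweedler2_bilinear[OF m(1) bil] _ c(1,2)])
      show "bilinear_on B B (\<lambda>x y. counit H x * counit H y * counit H z)"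
        by (rule bilinear_onI) (simp_all add: counit_linear distrib_left distrib_right)
      fix I J K L :: "'n list" assume len: "length I = length J" "length K = length L"
      have "sweedler2 (\<lambda>x y. ?e (x \<otimes>\<^bsub>B\<^esub> y, z)) (\<lambda>x y. ?e (x, y)) (u I J) (u K L) =
          (\<Sum>M\<in>words (length I). \<Sum>N\<in>words (length K). ?e (u (I @ K) (M @ N), z) * (delta M J * delta N L))"
        using len by (simp add: sweedler2_u[OF m(1) bil] e_u u_mult)
      also have "\<dots> = ?e (u (I @ K) (J @ L), z)"
        using len by (intro sum_delta_pair(2)) auto
      finally show "sweedler2 (\<lambda>x y. ?e (x \<otimes>\<^bsub>B\<^esub> y, z)) (\<lambda>x y. ?e (x, y)) (u I J) (u K L) =
          counit H (u I J) * counit H (u K L) * counit H z"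
        using c(3) len by (simp add: e counit_u app)
    qed
    show "sweedler2 (\<lambda>x y. ?e (z, x \<otimes>\<^bsub>B\<^esub> y)) (\<lambda>x y. ?e (x, y)) x y = counit H z * counit H x * counit H y"
    proof (rule bilinear_eqI[OF sweedler2_bilinear[OF m(2) bil] _ c(1,2)])
      show "bilinear_on B B (\<lambda>x y. counit H z * counit H x * counit H y)"
        by (rule bilinear_onI) (simp_all add: counit_linear distrib_left distrib_right)
      fix I J K L :: "'n list" assume len: "length I = length J" "length K = length L"
      have "sweedler2 (\<lambda>x y. ?e (z, x \<otimes>\<^bsub>B\<^esub> y)) (\<lambda>x y. ?e (x, y)) (u I J) (u K L) =
          (\<Sum>M\<in>words (length I). \<Sum>N\<in>words (length K). ?e (z, u (I @ K) (M @ N)) * (delta M J * delta N L))"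
        using len by (simp add: sweedler2_u[OF m(2) bil] e_u u_mult)
      also have "\<dots> = ?e (z, u (I @ K) (J @ L))"
        using len by (intro sum_delta_pair(2)) auto
      finally show "sweedler2 (\<lambda>x y. ?e (z, x \<otimes>\<^bsub>B\<^esub> y)) (\<lambda>x y. ?e (x, y)) (u I J) (u K L) =
          counit H z * counit H (u I J) * counit H (u K L)"
        using c(3) len by (simp add: e counit_u app)
    qed
  qed
  have lazy: "sweedler H H x (\<lambda>x1 x2. sweedler H H y (\<lambda>y1 y2. ?e (x1, y1) \<odot>\<^bsub>B\<^esub> (x2 \<otimes>\<^bsub>B\<^esub> y2))) =
      sweedler H H x (\<lambda>x1 x2. sweedler H H y (\<lambda>y1 y2. ?e (x2, y2) \<odot>\<^bsub>B\<^esub> (x1 \<otimes>\<^bsub>B\<^esub> y1)))"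
    if c: "x \<in> carrier B" "y \<in> carrier B" for x y
  proof (rule B_eqI)
    fix F assume F: "compatible F"
    note q = bilinear_ev_mult[OF F]
    have "sweedler2 (\<lambda>x y. ?e (x, y)) (\<lambda>x y. ev F (x \<otimes>\<^bsub>B\<^esub> y)) x y = sweedler2 (\<lambda>x y. ev F (x \<otimes>\<^bsub>B\<^esub> y)) (\<lambda>x y. ?e (x, y)) x y"
    proof (rule bilinear_eqI[OF sweedler2_bilinear[OF bil q] sweedler2_bilinear[OF q bil] c])
      fix I J K L :: "'n list" assume len: "length I = length J" "length K = length L"
      have "sweedler2 (\<lambda>x y. ?e (x, y)) (\<lambda>x y. ev F (x \<otimes>\<^bsub>B\<^esub> y)) (u I J) (u K L) =
          (\<Sum>M\<in>words (length I). \<Sum>N\<in>words (length K). delta I M * delta K N * ev F (u (M @ N) (J @ L)))"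
        using len by (simp add: sweedler2_u[OF bil q] e_u u_mult)
      also have "\<dots> = ev F (u (I @ K) (J @ L))"
        by (intro sum_delta_pair(1)) auto
      also have "\<dots> = (\<Sum>M\<in>words (length I). \<Sum>N\<in>words (length K). ev F (u (I @ K) (M @ N)) * (delta M J * delta N L))"
        using len by (intro sum_delta_pair(2)[symmetric]) auto
      also have "\<dots> = sweedler2 (\<lambda>x y. ev F (x \<otimes>\<^bsub>B\<^esub> y)) (\<lambda>x y. ?e (x, y)) (u I J) (u K L)"
        using len by (simp add: sweedler2_u[OF q bil] e_u u_mult)
      finally show "sweedler2 (\<lambda>x y. ?e (x, y)) (\<lambda>x y. ev F (x \<otimes>\<^bsub>B\<^esub> y)) (u I J) (u K L) =
          sweedler2 (\<lambda>x y. ev F (x \<otimes>\<^bsub>B\<^esub> y)) (\<lambda>x y. ?e (x, y)) (u I J) (u K L)" .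
    qed
    then show "ev F (sweedler H H x (\<lambda>x1 x2. sweedler H H y (\<lambda>y1 y2. ?e (x1, y1) \<odot>\<^bsub>B\<^esub> (x2 \<otimes>\<^bsub>B\<^esub> y2)))) =
      ev F (sweedler H H x (\<lambda>x1 x2. sweedler H H y (\<lambda>y1 y2. ?e (x2, y2) \<odot>\<^bsub>B\<^esub> (x1 \<otimes>\<^bsub>B\<^esub> y1))))"
      unfolding sweedler_lazy(3,4)[OF bf c F] .
  qed (rule sweedler_lazy[OF bf c])+
  have "counit H \<one>\<^bsub>B\<^esub> = 1"
    using counit_u[of "[]" "[]"] by (simp add: u_Nil delta_def)
  then show ?thesis
    unfolding lazy_cocycles_def using unit by (simp add: e cocycle lazy)
qed

end

theorem corollary11:
  fixes E :: "'k::{alg_closed_field, field_char_0} ^ 'n ^ 'n"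
  assumes "CARD('n) \<ge> 2"
    and "invertible E"
  shows "trivial_group (lazy_cohomology (B_hopf E))"
proof -
  interpret invertible_form E
    by unfold_locales (rule assms(2))
  have Z: "lazy_cocycles H \<subseteq> lazy_coboundaries H"
  proof
    fix \<sigma> assume \<sigma>: "\<sigma> \<in> lazy_cocycles H"
    then have bf: "\<sigma> \<in> bilinear_forms H"
      by (auto simp: lazy_cocycles_def Units_def convolution2_def)
    obtain t where "lazy_cocycle_family (\<lambda>i j. E $ i $ j) (\<lambda>i j. D $ i $ j) (fam2 \<sigma>) t"
      using lazy_cocycle_family[OF \<sigma>] .
    then interpret S: lazy_cocycle_family "\<lambda>i j. E $ i $ j" "\<lambda>i j. D $ i $ j" "fam2 \<sigma>" t .
    obtain d where d: "d \<noteq> 0"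
      "\<And>i m. (\<Sum>k\<in>UNIV. \<Sum>l\<in>UNIV. D $ k $ l * fam2 \<sigma> [i] [k] [m] [l]) = d * D $ i $ m"
      "\<And>k l. (\<Sum>i\<in>UNIV. \<Sum>j\<in>UNIV. E $ i $ j * fam2 \<sigma> [i] [k] [j] [l]) = d * E $ k $ l"
      using S.schur by blast
    \<comment> \<open>The square root of the scalar exists because the field is algebraically
      closed.\<close>
    obtain c where c: "c ^ 2 = d"
      using nth_root_exists[of 2 d] by auto
    then have c': "c \<noteq> 0" "c * c = d"
      using d(1) by (auto simp: power2_eq_square)
    interpret N: normalized_cocycle_family "\<lambda>i j. E $ i $ j" "\<lambda>i j. D $ i $ j" "fam2 \<sigma>" t c
      by (unfold_locales; simp only: c' d not_False_eq_True)
    note triv = N.trivialization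
    have U: "functional N.\<kappa> \<in> Units (convolution H)" "inv\<^bsub>convolution H\<^esub> functional N.\<kappa> = functional N.\<nu>"
      using convolution_UnitsI[of N.\<kappa> N.\<nu>] triv N.\<nu>_compatible by auto
    have fam: "fam (functional N.\<kappa>) = N.\<kappa>" "fam (functional N.\<nu>) = N.\<nu>"
      using triv N.\<nu>_compatible by (simp_all add: fam_functional)
    have "functional N.\<kappa> \<in> lazy_functionals H"
      using triv U by (simp add: lazy_functionals_iff fam)
    moreover have "coboundary H (functional N.\<kappa>) = \<sigma>"
    proof (rule bilinear_form_eqI[OF coboundary_closed[OF U(1)] bf])
      fix I J K L :: "'n list" assume len: "length I = length J" "length K = length L"
      have "coboundary H (functional N.\<kappa>) (u I J, u K L) = conv (tensor (length I) N.\<kappa> N.\<kappa>) N.\<nu> (I @ K) (J @ L)"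
        using coboundary_u[OF U(1) len] by (simp add: U fam)
      also have "\<dots> = cut (fam2 \<sigma>) (length I) (I @ K) (J @ L)"
        using triv by simp
      finally show "coboundary H (functional N.\<kappa>) (u I J, u K L) = \<sigma> (u I J, u K L)"
        using len by (simp add: cut_def fam2_def)
    qed
    ultimately show "\<sigma> \<in> lazy_coboundaries H"
      unfolding lazy_coboundaries_def by blast
  qed
  define G where "G = lazy_cocycle_group H"
  define Bd where "Bd = lazy_coboundaries H"
  have mult: "monoid.mult G = monoid.mult (convolution2 H)"
    by (simp add: G_def lazy_cocycle_group_def)
  have closed: "a \<otimes>\<^bsub>G\<^esub> b \<in> Bd" if ab: "a \<in> Bd" "b \<in> Bd" for a b
  proof -
    obtain \<mu> \<nu> where \<mu>: "a = coboundary H \<mu>" "\<mu> \<in> lazy_functionals H" and \<nu>: "b = coboundary H \<nu>" "\<nu> \<in> lazy_functionals H"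
      using ab unfolding Bd_def lazy_coboundaries_def by blast
    have "a \<otimes>\<^bsub>G\<^esub> b = coboundary H (\<mu> \<otimes>\<^bsub>convolution H\<^esub> \<nu>)"
      unfolding mult \<mu> \<nu> by (rule coboundary_mult[OF \<mu>(2) \<nu>(2), symmetric])
    then show ?thesis
      using lazy_mult[OF \<mu>(2) \<nu>(2)] unfolding Bd_def lazy_coboundaries_def by blast
  qed
  \<comment> \<open>The equation is solved by the coboundary of \<open>\<nu>\<close> times the
    inverse of \<open>\<mu>\<close>, as coboundaries of lazy functionals are multiplicative.\<close>
  have ex: "\<exists>h\<in>Bd. b = h \<otimes>\<^bsub>G\<^esub> a" if ab: "a \<in> Bd" "b \<in> Bd" for a b
  proof -
    obtain \<mu> \<nu> where \<mu>: "a = coboundary H \<mu>" "\<mu> \<in> lazy_functionals H" and \<nu>: "b = coboundary H \<nu>" "\<nu> \<in> lazy_functionals H"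
      using ab unfolding Bd_def lazy_coboundaries_def by blast
    have U: "\<mu> \<in> Units (convolution H)" "\<nu> \<in> Units (convolution H)"
      using \<mu> \<nu> by (simp_all add: lazy_functionals_iff)
    let ?\<rho> = "\<nu> \<otimes>\<^bsub>convolution H\<^esub> inv\<^bsub>convolution H\<^esub> \<mu>"
    have \<rho>: "?\<rho> \<in> lazy_functionals H"
      using \<mu> \<nu> by (intro lazy_mult lazy_inv)
    have "?\<rho> \<otimes>\<^bsub>convolution H\<^esub> \<mu> = \<nu>"
      using U C.Units_closed C.Units_inv_closed by (simp add: C.m_assoc del: convolution_simps)
    then have "b = coboundary H ?\<rho> \<otimes>\<^bsub>G\<^esub> a"
      using coboundary_mult[OF \<rho> \<mu>(2)] by (simp add: \<mu> \<nu> mult)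
    then show ?thesis
      using \<rho> unfolding Bd_def lazy_coboundaries_def by blast
  qed
  \<comment> \<open>One inclusion is closure under products, the other is solvability of b = h a
    within the coboundaries. As all cocycles are coboundaries, \<open>Bd\<close> is the only
    coset.\<close>
  have coset: "r_coset G Bd a = Bd" if "a \<in> Bd" for a
    using that closed ex by (auto simp: r_coset_def)
  have one: "\<one>\<^bsub>convolution2 H\<^esub> \<in> carrier G"
    using one_lazy_cocycle by (simp add: G_def lazy_cocycle_group_def)
  have GZ: "carrier G \<subseteq> Bd"
    using Z by (simp add: G_def lazy_cocycle_group_def Bd_def)
  have carrier: "carrier (G Mod Bd) = {Bd}"
    using one GZ coset by (auto simp: FactGroup_def RCOSETS_def)
  have "Bd <#>\<^bsub>G\<^esub> Bd = Bd"
  proof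
    show "Bd <#>\<^bsub>G\<^esub> Bd \<subseteq> Bd"
      using closed by (auto simp: set_mult_def)
    show "Bd \<subseteq> Bd <#>\<^bsub>G\<^esub> Bd"
    proof
      fix b assume b: "b \<in> Bd"
      then obtain h where "h \<in> Bd" "b = h \<otimes>\<^bsub>G\<^esub> b"
        using ex[OF b b] by blast
      then show "b \<in> Bd <#>\<^bsub>G\<^esub> Bd"
        using b unfolding set_mult_def by blast
    qed
  qed
  then have "group (G Mod Bd)"
    using carrier by (intro groupI) (auto simp: FactGroup_def)
  then show ?thesis
    using carrier unfolding trivial_group_def lazy_cohomology_def G_def Bd_def by (simp add: FactGroup_def)
qed

end
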